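(* Let $\Phi$ be a linear random dynamical system on $\mathbb{R}^d$ over an ergodic base $\theta$ with time set $\mathbb{T}\in\{\mathbb{Z},\mathbb{R}\}$. Then the projectivised system $\mathbb{P}\Phi$ on $\mathbb{P}^{d-1}$ has a unique finest weak Morse decomposition $\{M_1,\dots,M_n\}$. Moreover $n\le d$, and for almost every $\omega\in\Omega$ one has $$\mathbb{P}^{-1}M_1(\omega)\oplus\dots\oplus\mathbb{P}^{-1}M_n(\omega)=\mathbb{R}^d .$$
   Context: Setting. $(\Omega,\mathcal{F},\mu)$ is a complete probability space, $\mathbb{T}=\mathbb{Z}$ or $\mathbb{T}=\mathbb{R}$, and $\theta:\mathbb{T}\times\Omega\to\Omega$, $(t,\omega)\mapsto\theta_t\omega$, is a (measurable) $\mu$-preserving ergodic dynamical system. If $\mathbb{T}=\mathbb{R}$, $\Omega$ is also a metric space and $t\mapsto\theta_t\omega$ is continuous for every $\omega$. A linear random dynamical system on $\mathbb{R}^d$ is a map $\Phi:\mathbb{T}\times\Omega\to\mathbb{R}^{d\times d}$ such that $(t,\omega,x)\mapsto\Phi(t,\omega)x$ is measurable, $\Phi(0,\omega)=\mathrm{Id}$, $\Phi(t+s,\omega)=\Phi(t,\theta_s\omega)\Phi(s,\omega)$ for all $t,s,\omega$, and $(t,x)\mapsto\Phi(t,\omega)x$ is continuous for each $\omega$ (so each $\Phi(t,\omega)$ is invertible). Projective space. $\mathbb{P}^{d-1}$ is real projective space, $\mathbb{P}x$ is the class of $x\ne0$, with metric $d_{\mathbb{P}}(\mathbb{P}x,\mathbb{P}y)=\min\{|\frac{x}{\|x\|}-\frac{y}{\|y\|}|,|\frac{x}{\|x\|}+\frac{y}{\|y\|}|\}$;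 $\mathbb{P}\Phi(t,\omega)\mathbb{P}x:=\mathbb{P}(\Phi(t,\omega)x)$. For $A\subset\mathbb{P}^{d-1}$, $\mathbb{P}^{-1}A:=\{x\neq0:\mathbb{P}x\in A\}\cup\{0\}$. Random sets. Let $X=\mathbb{P}^{d-1}$ and $\varphi=\mathbb{P}\Phi$. A random set is a set $D\in\mathcal{B}(X)\otimes\mathcal{F}$, with fibres $D(\omega)=\{x:(x,\omega)\in D\}$; it is closed/open/compact if every fibre is. It is forward (backward) invariant if $\varphi(t,\omega)D(\omega)\subseteq D(\theta_t\omega)$ for all $\omega$ and all $t\ge0$ ($t\le0$), and invariant if $\varphi(t,\omega)D(\omega)=D(\theta_t\omega)$ for all $\omega$ and $t\in\mathbb{T}$. Put $\operatorname{dist}(A,B)=\sup_{a\in A}\inf_{b\in B}d(a,b)$ for nonempty sets, $\operatorname{dist}(\emptyset,\emptyset)=\operatorname{dist}(\emptyset,A)=0$, $\operatorname{dist}(A,\emptyset)=\infty$. Attractors and repellers. An invariant compact random set $A$ is a local weak attractor if there is a forward invariant open random set $U$ with $U(\omega)\supset A(\omega)$ a.s. such that for each closed random set $C\subset U$ and every $\varepsilon>0$, $\lim_{t\to\infty}\mu\{\omega:\operatorname{dist}(\varphi(t,\omega)C(\omega),A(\theta_t\omega))>\varepsilon\}=0$. Its basin is $B(A)(\omega)=\{x\in X:\varphi(t,\omega)x\in U(\theta_t\omega)\text{ for some }t\ge0\}$ (independent of $U$ up to null sets). A local weak repeller is defined analogously with backward invariant $U$ and $t\to-\infty$. For a local weak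 attractor $A$, $R:=X\setminus B(A)$ is a local weak repeller, and $(A,R)$ is called a weak attractor-repeller pair. Morse decompositions. If $(A_i,R_i)$, $i=0,\dots,n$, are weak attractor-repeller pairs with a.s. $\emptyset=A_0(\omega)\subsetneq A_1(\omega)\subsetneq\dots\subsetneq A_n(\omega)=X$, then $\{M_1,\dots,M_n\}$ with $M_i:=A_i\cap R_{i-1}$ is a weak Morse decomposition of $X$. A decomposition $\{M_1,\dots,M_n\}$ is finer than $\{\tilde M_1,\dots,\tilde M_m\}$ if for each $i\in\{1,\dots,m\}$ there is $j\in\{1,\dots,n\}$ with $M_j(\omega)\subset\tilde M_i(\omega)$ a.s. A minimal element of this partial ordering is called a finest weak Morse decomposition. Random sets that agree almost surely are identified. *)

theory Defs
  imports "HOL-Probability.Probability"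
begin

section \<open>Linear random dynamical systems\<close>

text \<open>
  The time set is a set \<open>T\<close> of reals, either the integers or the whole line;
  the values of \<open>\<theta>\<close> and \<open>\<Phi>\<close> at times outside \<open>T\<close> and outside \<open>space M\<close> are irrelevant.

  For \<open>T = \<int>\<close>, measurability of \<open>(t, \<omega>) \<mapsto> \<theta> t \<omega>\<close> amounts to measurability of each \<open>\<theta> t\<close>.
  For \<open>T = \<real>\<close>, joint measurability is required only with respect to the completion of the
  product of Lebesgue measure and \<open>M\<close>, which follows from measurability with respect to the
  product sigma-algebra. As \<open>M\<close> is complete, the latter would exclude even
  rotation flows on the circle: sections in \<open>t\<close> of preimages of arbitrary null sets need not be Borel.

  The metric on \<open>\<Omega>\<close> enters only through continuity of \<open>t \<mapsto> \<theta> t \<omega>\<close>;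
  no relation between it and the sigma-algebra is assumed.
\<close>

locale ergodic_base = prob_space M + complete_measure M
  for M :: "'w measure" +
  fixes T :: "real set" and \<theta> :: "real \<Rightarrow> 'w \<Rightarrow> 'w"
  assumes time_set: "T = \<int> \<or> T = UNIV"
    and theta_measurable: "t \<in> T \<Longrightarrow> \<theta> t \<in> measurable M M"
    and theta_joint_measurable:
      "T = UNIV \<Longrightarrow> (\<lambda>(t, \<omega>). \<theta> t \<omega>) \<in> measurable (completion (lborel \<Otimes>\<^sub>M M)) M"
    and theta_zero: "\<omega> \<in> space M \<Longrightarrow> \<theta> 0 \<omega> = \<omega>"
    and theta_add: "t \<in> T \<Longrightarrow> s \<in> T \<Longrightarrow> \<omega> \<in> space M \<Longrightarrow> \<theta> (t + s) \<omega> = \<theta> t (\<theta> s \<omega>)"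
    and theta_preserving: "t \<in> T \<Longrightarrow> distr M M (\<theta> t) = M"
    and theta_ergodic:
      "B \<in> sets M \<Longrightarrow> (\<forall>t\<in>T. \<theta> t -` B \<inter> space M = B) \<Longrightarrow> measure M B = 0 \<or> measure M B = 1"
    and theta_continuous:
      "T = UNIV \<Longrightarrow> \<exists>m :: 'w metric. mspace m = space M \<and>
        (\<forall>\<omega>\<in>space M. continuous_map euclideanreal (mtopology_of m) (\<lambda>t. \<theta> t \<omega>))"

locale linear_rds = ergodic_base M T \<theta>
  for M :: "'w measure" and T :: "real set" and \<theta> :: "real \<Rightarrow> 'w \<Rightarrow> 'w" +
  fixes \<Phi> :: "real \<Rightarrow> 'w \<Rightarrow> real ^ 'n ^ 'n"
  assumes cocycle_measurable:
      "(\<lambda>(t, \<omega>, x). \<Phi> t \<omega> *v x) \<in> borel_measurable (restrict_space borel T \<Otimes>\<^sub>M (M \<Otimes>\<^sub>M borel))"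
    and cocycle_zero: "\<omega> \<in> space M \<Longrightarrow> \<Phi> 0 \<omega> = mat 1"
    and cocycle_add:
      "t \<in> T \<Longrightarrow> s \<in> T \<Longrightarrow> \<omega> \<in> space M \<Longrightarrow> \<Phi> (t + s) \<omega> = \<Phi> t (\<theta> s \<omega>) ** \<Phi> s \<omega>"
    and cocycle_continuous:
      "\<omega> \<in> space M \<Longrightarrow> continuous_on (T \<times> UNIV) (\<lambda>(t, x). \<Phi> t \<omega> *v x)"


section \<open>Real projective space\<close>

definition projrel :: "real ^ 'n \<Rightarrow> real ^ 'n \<Rightarrow> bool" where
  "projrel x y \<longleftrightarrow> x \<noteq> 0 \<and> y \<noteq> 0 \<and> (\<exists>c. y = c *\<^sub>R x)"

lemma projrel_nonzero_scalar:
  assumes "projrel x y"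
  obtains c where "c \<noteq> 0" "y = c *\<^sub>R x" "x \<noteq> 0"
  using assms unfolding projrel_def by (metis scaleR_zero_left)

lemma part_equivp_projrel: "part_equivp (projrel :: real ^ 'n::finite \<Rightarrow> _)"
proof (rule part_equivpI)
  have "projrel (axis undefined 1) (axis undefined 1 :: real ^ 'n)"
    unfolding projrel_def by (auto simp: axis_eq_0_iff intro: exI[of _ 1])
  then show "\<exists>x :: real ^ 'n. projrel x x" by blast
  show "symp (projrel :: real ^ 'n \<Rightarrow> _)"
  proof (rule sympI)
    fix x y :: "real ^ 'n"
    assume "projrel x y"
    then obtain c where c: "c \<noteq> 0" "y = c *\<^sub>R x" "x \<noteq> 0" by (rule projrel_nonzero_scalar)
    then have "x = inverse c *\<^sub>R y" by simp
    with c show "projrel y x" unfolding projrel_def by (metis scaleR_eq_0_iff)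
  qed
  show "transp (projrel :: real ^ 'n \<Rightarrow> _)"
    unfolding projrel_def by (rule transpI) (metis scaleR_scaleR)
qed

text \<open>
  \<open>'n projective\<close> is the projective space of \<open>real ^ 'n\<close>. The abstraction map
  \<open>abs_projective\<close> is \<open>x \<mapsto> \<P>x\<close>; it is meaningful for \<open>x \<noteq> 0\<close> only.
\<close>

quotient_type (overloaded) 'n projective = "real ^ 'n::finite" / partial: projrel
  by (rule part_equivp_projrel)

definition proj_dist :: "real ^ 'n \<Rightarrow> real ^ 'n \<Rightarrow> real" where
  "proj_dist x y = min (norm (x /\<^sub>R norm x - y /\<^sub>R norm y)) (norm (x /\<^sub>R norm x + y /\<^sub>R norm y))"

lemma projrel_normalize:
  assumes "projrel x y"
  shows "y /\<^sub>R norm y = x /\<^sub>R norm x \<or> y /\<^sub>R norm y = - (x /\<^sub>R norm x)"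
proof -
  obtain c where c: "c \<noteq> 0" "y = c *\<^sub>R x" "x \<noteq> 0" using assms by (rule projrel_nonzero_scalar)
  then show ?thesis by (cases "c > 0") (auto simp: field_simps)
qed

lemma proj_dist_cong:
  assumes "projrel x x'" "projrel y y'"
  shows "proj_dist x y = proj_dist x' y'"
proof -
  define a b a' b' where "a = x /\<^sub>R norm x" and "b = y /\<^sub>R norm y"
    and "a' = x' /\<^sub>R norm x'" and "b' = y' /\<^sub>R norm y'"
  have "a' = a \<or> a' = - a" "b' = b \<or> b' = - b"
    using projrel_normalize[OF assms(1)] projrel_normalize[OF assms(2)]
    unfolding a_def b_def a'_def b'_def by auto
  moreover have "norm (- a - b) = norm (a + b)" "norm (- a + b) = norm (a - b)"
    using norm_minus_cancel[of "a + b"] norm_minus_commute[of b a] by (simp_all add: algebra_simps)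
  ultimately have "min (norm (a - b)) (norm (a + b)) = min (norm (a' - b')) (norm (a' + b'))"
    by (auto simp: min.commute norm_minus_commute)
  then show ?thesis
    unfolding proj_dist_def a_def b_def a'_def b'_def .
qed

lemma proj_dist_triangle: "proj_dist x z \<le> proj_dist x y + proj_dist y z"
proof -
  define a b c where "a = x /\<^sub>R norm x" and "b = y /\<^sub>R norm y" and "c = z /\<^sub>R norm z"
  have "norm (a - c) \<le> norm (a - b) + norm (b - c)"
    using norm_triangle_ineq[of "a - b" "b - c"] by simp
  moreover have "norm (a - c) \<le> norm (a + b) + norm (b + c)"
    using norm_triangle_ineq4[of "a + b" "b + c"] by simp
  moreover have "norm (a + c) \<le> norm (a - b) + norm (b + c)"
    using norm_triangle_ineq[of "a - b" "b + c"] by simp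
  moreover have "norm (a + c) \<le> norm (a + b) + norm (b - c)"
    using norm_triangle_ineq4[of "a + b" "b - c"] by simp
  ultimately show ?thesis
    unfolding proj_dist_def a_def[symmetric] b_def[symmetric] c_def[symmetric] by linarith
qed

lemma proj_dist_zero_iff:
  assumes "x \<noteq> 0" "y \<noteq> 0"
  shows "proj_dist x y = 0 \<longleftrightarrow> projrel x y"
proof
  assume "projrel x y"
  then show "proj_dist x y = 0"
    using projrel_normalize unfolding proj_dist_def by fastforce
next
  assume "proj_dist x y = 0"
  then have "x /\<^sub>R norm x = y /\<^sub>R norm y \<or> x /\<^sub>R norm x = - (y /\<^sub>R norm y)"
    unfolding proj_dist_def by (auto simp: min_def eq_neg_iff_add_eq_0 split: if_splits)
  then have "norm y *\<^sub>R (x /\<^sub>R norm x) = y \<or> norm y *\<^sub>R (x /\<^sub>R norm x) = - y"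
  proof
    assume "x /\<^sub>R norm x = y /\<^sub>R norm y"
    then have "norm y *\<^sub>R (x /\<^sub>R norm x) = norm y *\<^sub>R (y /\<^sub>R norm y)" by (rule arg_cong)
    with assms show ?thesis by simp
  next
    assume "x /\<^sub>R norm x = - (y /\<^sub>R norm y)"
    then have "norm y *\<^sub>R (x /\<^sub>R norm x) = norm y *\<^sub>R (- (y /\<^sub>R norm y))" by (rule arg_cong)
    with assms show ?thesis by simp
  qed
  then have "y = (norm y / norm x) *\<^sub>R x \<or> y = (- (norm y / norm x)) *\<^sub>R x"
  proof
    assume "norm y *\<^sub>R (x /\<^sub>R norm x) = y"
    then show ?thesis by (simp add: divide_inverse)
  next
    assume "norm y *\<^sub>R (x /\<^sub>R norm x) = - y"
    then have "y = - (norm y *\<^sub>R (x /\<^sub>R norm x))" by simp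
    also have "\<dots> = (- (norm y / norm x)) *\<^sub>R x" by (simp add: divide_inverse)
    finally show ?thesis by blast
  qed
  with assms show "projrel x y" unfolding projrel_def by blast
qed

instantiation projective :: (finite) metric_space
begin

lift_definition dist_projective :: "'a projective \<Rightarrow> 'a projective \<Rightarrow> real" is proj_dist
  by (rule proj_dist_cong)

definition uniformity_projective :: "('a projective \<times> 'a projective) filter" where
  "uniformity_projective = (INF e\<in>{0<..}. principal {(x, y). dist x y < e})"

definition open_projective :: "'a projective set \<Rightarrow> bool" where
  "open_projective U \<longleftrightarrow> (\<forall>x\<in>U. \<forall>\<^sub>F (x', y) in uniformity. x' = x \<longrightarrow> y \<in> U)"

instance
proof
  fix x y z :: "'a projective"
  show "dist x y = 0 \<longleftrightarrow> x = y"
    by transfer (metis proj_dist_zero_iff projrel_def)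
  show "dist x y \<le> dist x z + dist y z"
  proof -
    have comm: "proj_dist a b = proj_dist b a" for a b :: "real ^ 'a"
      unfolding proj_dist_def by (metis add.commute norm_minus_commute)
    show ?thesis by transfer (metis comm proj_dist_triangle)
  qed
qed (rule uniformity_projective_def open_projective_def)+

end

text \<open>For invertible \<open>A\<close> the following does not depend on the choice of representative.\<close>

definition proj_map :: "real ^ 'n ^ 'n \<Rightarrow> 'n::finite projective \<Rightarrow> 'n projective" where
  "proj_map A p = abs_projective (A *v rep_projective p)"

lemma proj_map_abs_projective:
  fixes A :: "real ^ 'n::finite ^ 'n"
  assumes "invertible A" "x \<noteq> 0"
  shows "proj_map A (abs_projective x) = abs_projective (A *v x)"
proof -
  have "projrel x x" using assms(2) unfolding projrel_def by (auto intro: exI[of _ 1])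
  then have "projrel (rep_projective (abs_projective x)) x"
    by (rule Quotient3_rep_abs[OF Quotient3_projective])
  then obtain c where c: "c \<noteq> 0" "x = c *\<^sub>R rep_projective (abs_projective x)"
    "rep_projective (abs_projective x) \<noteq> 0" by (rule projrel_nonzero_scalar)
  have inj: "A *v v \<noteq> 0" if "v \<noteq> 0" for v
    using that assms(1) by (metis invertible_def matrix_left_invertible_ker)
  have "A *v x = c *\<^sub>R (A *v rep_projective (abs_projective x))"
    by (subst c(2)) (simp add: matrix_vector_mult_scaleR)
  then have "projrel (A *v rep_projective (abs_projective x)) (A *v x)"
    unfolding projrel_def using inj[OF c(3)] inj[OF assms(2)] by blast
  then show ?thesis unfolding proj_map_def by (rule Quotient3_rel_abs[OF Quotient3_projective])
qed

definition projectivisation ::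
  "(real \<Rightarrow> 'w \<Rightarrow> real ^ 'n ^ 'n) \<Rightarrow> real \<Rightarrow> 'w \<Rightarrow> 'n::finite projective \<Rightarrow> 'n projective" where
  "projectivisation \<Phi> t \<omega> = proj_map (\<Phi> t \<omega>)"

definition proj_vimage :: "'n::finite projective set \<Rightarrow> (real ^ 'n) set" where
  "proj_vimage A = {x. x \<noteq> 0 \<and> abs_projective x \<in> A} \<union> {0}"


section \<open>Random sets\<close>

definition fibre :: "('x \<times> 'w) set \<Rightarrow> 'w \<Rightarrow> 'x set" where
  "fibre D \<omega> = {x. (x, \<omega>) \<in> D}"

definition random_set :: "'w measure \<Rightarrow> ('x::topological_space \<times> 'w) set \<Rightarrow> bool" where
  "random_set M D \<longleftrightarrow> D \<in> sets (borel \<Otimes>\<^sub>M M)"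

definition closed_random_set :: "'w measure \<Rightarrow> ('x::topological_space \<times> 'w) set \<Rightarrow> bool" where
  "closed_random_set M D \<longleftrightarrow> random_set M D \<and> (\<forall>\<omega>\<in>space M. closed (fibre D \<omega>))"

definition open_random_set :: "'w measure \<Rightarrow> ('x::topological_space \<times> 'w) set \<Rightarrow> bool" where
  "open_random_set M D \<longleftrightarrow> random_set M D \<and> (\<forall>\<omega>\<in>space M. open (fibre D \<omega>))"

definition compact_random_set :: "'w measure \<Rightarrow> ('x::topological_space \<times> 'w) set \<Rightarrow> bool" where
  "compact_random_set M D \<longleftrightarrow> random_set M D \<and> (\<forall>\<omega>\<in>space M. compact (fibre D \<omega>))"

definition ae_equal :: "'w measure \<Rightarrow> ('x \<times> 'w) set \<Rightarrow> ('x \<times> 'w) set \<Rightarrow> bool" where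
  "ae_equal M D E \<longleftrightarrow> (AE \<omega> in M. fibre D \<omega> = fibre E \<omega>)"

definition semidist :: "'x::metric_space set \<Rightarrow> 'x set \<Rightarrow> ereal" where
  "semidist A B =
    (if A = {} then 0 else if B = {} then \<infinity> else SUP a\<in>A. INF b\<in>B. ereal (dist a b))"

definition forward_invariant ::
  "'w measure \<Rightarrow> real set \<Rightarrow> (real \<Rightarrow> 'w \<Rightarrow> 'w) \<Rightarrow> (real \<Rightarrow> 'w \<Rightarrow> 'x \<Rightarrow> 'x) \<Rightarrow> ('x \<times> 'w) set \<Rightarrow> bool" where
  "forward_invariant M T \<theta> \<phi> D \<longleftrightarrow>
    (\<forall>\<omega>\<in>space M. \<forall>t\<in>T. 0 \<le> t \<longrightarrow> \<phi> t \<omega> ` fibre D \<omega> \<subseteq> fibre D (\<theta> t \<omega>))"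

definition invariant ::
  "'w measure \<Rightarrow> real set \<Rightarrow> (real \<Rightarrow> 'w \<Rightarrow> 'w) \<Rightarrow> (real \<Rightarrow> 'w \<Rightarrow> 'x \<Rightarrow> 'x) \<Rightarrow> ('x \<times> 'w) set \<Rightarrow> bool" where
  "invariant M T \<theta> \<phi> D \<longleftrightarrow>
    (\<forall>\<omega>\<in>space M. \<forall>t\<in>T. \<phi> t \<omega> ` fibre D \<omega> = fibre D (\<theta> t \<omega>))"


section \<open>Weak attractors and weak Morse decompositions\<close>

text \<open>
  The events below are measurable because \<open>M\<close> is complete (measurable projection). On measurable
  sets \<open>outer_measure_of M\<close> is the measure of the set; it is used so that the definition
  does not refer to the default value 0 that \<open>emeasure\<close> takes on sets not known to be measurable.
\<close>

definition attractor_neighbourhood ::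
  "'w measure \<Rightarrow> real set \<Rightarrow> (real \<Rightarrow> 'w \<Rightarrow> 'w) \<Rightarrow> (real \<Rightarrow> 'w \<Rightarrow> 'x::metric_space \<Rightarrow> 'x) \<Rightarrow>
    ('x \<times> 'w) set \<Rightarrow> ('x \<times> 'w) set \<Rightarrow> bool" where
  "attractor_neighbourhood M T \<theta> \<phi> A U \<longleftrightarrow>
    open_random_set M U \<and> forward_invariant M T \<theta> \<phi> U \<and>
    (AE \<omega> in M. fibre A \<omega> \<subseteq> fibre U \<omega>) \<and>
    (\<forall>C. closed_random_set M C \<and> C \<subseteq> U \<longrightarrow>
      (\<forall>\<epsilon>>0. ((\<lambda>t. outer_measure_of M
                {\<omega> \<in> space M. semidist (\<phi> t \<omega> ` fibre C \<omega>) (fibre A (\<theta> t \<omega>)) > ereal \<epsilon>})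
              \<longlongrightarrow> 0) (inf at_top (principal T))))"

definition local_weak_attractor ::
  "'w measure \<Rightarrow> real set \<Rightarrow> (real \<Rightarrow> 'w \<Rightarrow> 'w) \<Rightarrow> (real \<Rightarrow> 'w \<Rightarrow> 'x::metric_space \<Rightarrow> 'x) \<Rightarrow>
    ('x \<times> 'w) set \<Rightarrow> bool" where
  "local_weak_attractor M T \<theta> \<phi> A \<longleftrightarrow>
    compact_random_set M A \<and> invariant M T \<theta> \<phi> A \<and> (\<exists>U. attractor_neighbourhood M T \<theta> \<phi> A U)"

definition basin ::
  "'w measure \<Rightarrow> real set \<Rightarrow> (real \<Rightarrow> 'w \<Rightarrow> 'w) \<Rightarrow> (real \<Rightarrow> 'w \<Rightarrow> 'x \<Rightarrow> 'x) \<Rightarrow>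
    ('x \<times> 'w) set \<Rightarrow> ('x \<times> 'w) set" where
  "basin M T \<theta> \<phi> U = {(x, \<omega>). \<omega> \<in> space M \<and> (\<exists>t\<in>T. 0 \<le> t \<and> \<phi> t \<omega> x \<in> fibre U (\<theta> t \<omega>))}"

text \<open>
  The basin depends on the neighbourhood \<open>U\<close> only up to null sets; the repeller \<open>R\<close> may be
  the complement of the basin formed with any admissible \<open>U\<close>. That \<open>R\<close> is a local weak
  repeller is a consequence and hence not part of the definition.
\<close>

definition weak_attractor_repeller_pair ::
  "'w measure \<Rightarrow> real set \<Rightarrow> (real \<Rightarrow> 'w \<Rightarrow> 'w) \<Rightarrow> (real \<Rightarrow> 'w \<Rightarrow> 'x::metric_space \<Rightarrow> 'x) \<Rightarrow>
    ('x \<times> 'w) set \<Rightarrow> ('x \<times> 'w) set \<Rightarrow> bool" where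
  "weak_attractor_repeller_pair M T \<theta> \<phi> A R \<longleftrightarrow>
    local_weak_attractor M T \<theta> \<phi> A \<and>
    (\<exists>U. attractor_neighbourhood M T \<theta> \<phi> A U \<and> R = (UNIV \<times> space M) - basin M T \<theta> \<phi> U)"

text \<open>A decomposition with \<open>n\<close> members is a family \<open>D\<close>, of which only \<open>D 1, \<dots>, D n\<close> matter.\<close>

definition weak_morse_decomposition ::
  "'w measure \<Rightarrow> real set \<Rightarrow> (real \<Rightarrow> 'w \<Rightarrow> 'w) \<Rightarrow> (real \<Rightarrow> 'w \<Rightarrow> 'x::metric_space \<Rightarrow> 'x) \<Rightarrow>
    nat \<Rightarrow> (nat \<Rightarrow> ('x \<times> 'w) set) \<Rightarrow> bool" where
  "weak_morse_decomposition M T \<theta> \<phi> n D \<longleftrightarrow>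
    (\<exists>A R.
      (\<forall>i\<in>{0..n}. weak_attractor_repeller_pair M T \<theta> \<phi> (A i) (R i)) \<and>
      (AE \<omega> in M. fibre (A 0) \<omega> = {} \<and>
        (\<forall>i<n. fibre (A i) \<omega> \<subset> fibre (A (Suc i)) \<omega>) \<and> fibre (A n) \<omega> = UNIV) \<and>
      (\<forall>i\<in>{1..n}. D i = A i \<inter> R (i - 1)))"

definition finer ::
  "'w measure \<Rightarrow> nat \<Rightarrow> (nat \<Rightarrow> ('x \<times> 'w) set) \<Rightarrow> nat \<Rightarrow> (nat \<Rightarrow> ('x \<times> 'w) set) \<Rightarrow> bool" where
  "finer M n D m E \<longleftrightarrow>
    (\<forall>i\<in>{1..m}. \<exists>j\<in>{1..n}. AE \<omega> in M. fibre (D j) \<omega> \<subseteq> fibre (E i) \<omega>)"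

text \<open>
  Equality of \<open>{D 1, \<dots>, D n}\<close> and \<open>{E 1, \<dots>, E m}\<close> when random sets that agree almost surely
  are identified; the order of the members is immaterial.
\<close>

definition same_decomposition ::
  "'w measure \<Rightarrow> nat \<Rightarrow> (nat \<Rightarrow> ('x \<times> 'w) set) \<Rightarrow> nat \<Rightarrow> (nat \<Rightarrow> ('x \<times> 'w) set) \<Rightarrow> bool" where
  "same_decomposition M n D m E \<longleftrightarrow>
    (\<exists>\<pi>. bij_betw \<pi> {1..n} {1..m} \<and> (\<forall>i\<in>{1..n}. ae_equal M (D i) (E (\<pi> i))))"

definition finest_weak_morse_decomposition ::
  "'w measure \<Rightarrow> real set \<Rightarrow> (real \<Rightarrow> 'w \<Rightarrow> 'w) \<Rightarrow> (real \<Rightarrow> 'w \<Rightarrow> 'x::metric_space \<Rightarrow> 'x) \<Rightarrow>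
    nat \<Rightarrow> (nat \<Rightarrow> ('x \<times> 'w) set) \<Rightarrow> bool" where
  "finest_weak_morse_decomposition M T \<theta> \<phi> n D \<longleftrightarrow>
    weak_morse_decomposition M T \<theta> \<phi> n D \<and>
    (\<forall>m E. weak_morse_decomposition M T \<theta> \<phi> m E \<and> finer M m E n D \<longrightarrow>
      same_decomposition M m E n D)"

definition is_direct_sum :: "nat \<Rightarrow> (nat \<Rightarrow> 'v::real_vector set) \<Rightarrow> bool" where
  "is_direct_sum n V \<longleftrightarrow>
    (\<forall>i\<in>{1..n}. subspace (V i)) \<and>
    (\<forall>x. \<exists>!v. v \<in> (\<Pi>\<^sub>E i\<in>{1..n}. V i) \<and> (\<Sum>i = 1..n. v i) = x)"

end

theory Submission
  imports Defs
begin

text \<open>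
  Write \<open>V = \<P>\<^sup>-\<^sup>1 A(\<omega>)\<close> and \<open>W = \<P>\<^sup>-\<^sup>1 R(\<omega>)\<close> for a weak attractor-repeller pair \<open>(A, R)\<close>. The core
  of the proof is that almost surely \<open>V\<close> and \<open>W\<close> are linear subspaces and \<open>\<real>\<^sup>d = V \<oplus> W\<close>
  (\<open>subspace_attractor\<close>, \<open>subspace_repeller\<close>, \<open>attractor_plus_repeller\<close>). Without integrability
  there are no Lyapunov exponents to separate the two spaces; the argument is projective instead.

  A closed cone which is not a subspace contains vectors \<open>b\<close>, \<open>b'\<close> such that \<open>b + r b'\<close> lies outside
  the cone for all \<open>r > 0\<close> (\<open>not_subspace_gap\<close>). Relative to \<open>b\<close> and \<open>b'\<close>, the
  coordinate ratios of \<open>b + r b'\<close> and \<open>b + r\<^sup>-\<^sup>1 b'\<close> differ by the factor \<open>r\<^sup>2\<close>, and linear maps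
  preserve this factor. Hence if \<open>r\<close> is small, the images of these two points cannot both stay at a
  fixed distance from the lines spanned by the images of \<open>b\<close> and \<open>b'\<close> (\<open>separated_segment_bound\<close>).
  Dynamics forces them to do so.
  For the cone over \<open>R\<close>, the points \<open>b + r b'\<close> lie in the basin, so forward in time they approach
  \<open>A\<close>, and by recurrence \<open>A\<close> is, at infinitely many of these times, at least a fixed distance away
  from \<open>R\<close>. For the cone over \<open>A\<close>, the points lie outside \<open>A\<close>; backward in time they must, at infinitely
  many times, be a fixed distance away from \<open>A\<close>, because a neighbourhood of \<open>A\<close> of fixed size is
  contracted to \<open>A\<close> by the time the dynamics returns to \<open>\<omega>\<close>. Finally, if some \<open>z\<close> were not in
  \<open>V + W\<close>, the space spanned by \<open>V\<close> and \<open>z\<close> would avoid \<open>W\<close>, hence be attracted to the image of \<open>V\<close>,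
  which has smaller dimension.

  Attraction holds in probability only, so it is first made almost sure along a sequence of integer
  times (\<open>null_along_subsequence\<close>) and then combined with recurrence of measure preserving maps
  (\<open>recurrence\<close>) to find good times (\<open>forward_good_times\<close>, \<open>backward_good_times\<close>). The
  events involved quantify existentially over projective space; they are measurable by the
  measurable projection theorem (\<open>measurable_projection\<close>).

  Next, any two attractors are comparable almost surely (\<open>attractors_totally_ordered\<close>). If neither
  contained the other, ergodicity and attraction would give points of \<open>A \<inter> R'\<close> and of \<open>A' \<inter> R\<close>,
  spanned by \<open>x\<close> and \<open>y\<close> say. Then \<open>x + y\<close> lies in both basins, so forward in time its direction
  approaches \<open>A\<close> and loses its \<open>y\<close>-component, but it also approaches \<open>A'\<close> and loses its \<open>x\<close>-component.

  A strictly increasing chain of attractors is therefore a flag of subspaces. It has length at most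
  \<open>d\<close>, and its Morse sets \<open>A\<^sub>i \<inter> R\<^sub>i\<^sub>-\<^sub>1\<close> span a direct sum decomposition. A chain of maximal length
  contains every attractor up to null sets, because a missing one could be inserted; so its
  Morse decomposition is finer than every other one, which makes it the unique finest one.
\<close>


section \<open>The measurable projection theorem\<close>

text \<open>
  The \<open>k\<close>-th rectangle \<open>K k \<sigma> \<times> F k \<sigma>\<close> may look
  at the first \<open>k\<close> values of \<open>\<sigma>\<close> only. Functions that satisfy
  this condition replace families indexed by finite sequences.
\<close>

definition souslin_scheme ::
  "'w measure \<Rightarrow> (nat \<Rightarrow> (nat \<Rightarrow> nat) \<Rightarrow> 'x::topological_space set) \<Rightarrow> (nat \<Rightarrow> (nat \<Rightarrow> nat) \<Rightarrow> 'w set) \<Rightarrow> bool" where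
  "souslin_scheme M K F \<longleftrightarrow>
    (\<forall>k \<sigma>. closed (K k \<sigma>) \<and> F k \<sigma> \<in> sets M) \<and>
    (\<forall>k \<sigma> \<tau>. (\<forall>i<k. \<sigma> i = \<tau> i) \<longrightarrow> K k \<sigma> = K k \<tau> \<and> F k \<sigma> = F k \<tau>)"

text \<open>
  The sets that arise from closed rectangles by the Souslin operation. Unlike the Borel
  hierarchy, this single class contains all measurable sets and has a representation to which
  the compactness argument of the projection theorem applies.
\<close>

definition souslin :: "'w measure \<Rightarrow> ('x::topological_space \<times> 'w) set \<Rightarrow> bool" where
  "souslin M D \<longleftrightarrow>
    (\<exists>K F. souslin_scheme M K F \<and> D = {(x, \<omega>). \<exists>\<sigma>. \<forall>k. x \<in> K k \<sigma> \<and> \<omega> \<in> F k \<sigma>})"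

lemma souslin_rectangle:
  assumes "closed C" "B \<in> sets M"
  shows "souslin M (C \<times> B)"
  unfolding souslin_def souslin_scheme_def
  using assms by (intro exI[of _ "\<lambda>_ _. C"] exI[of _ "\<lambda>_ _. B"]) auto

text \<open>
  The first value of the index sequence selects the member of the union, the remaining ones
  index the scheme of that member.
\<close>

lemma souslin_UN:
  fixes D :: "nat \<Rightarrow> ('x::topological_space \<times> 'w) set"
  assumes "\<And>j. souslin M (D j)"
  shows "souslin M (\<Union>j. D j)"
proof -
  have "\<forall>j. \<exists>K F. souslin_scheme M K F \<and> D j = {(x, \<omega>). \<exists>\<sigma>. \<forall>k. x \<in> K k \<sigma> \<and> \<omega> \<in> F k \<sigma>}"
    using assms unfolding souslin_def by blast
  from choice[OF this] obtain K where "\<forall>j. \<exists>F. souslin_scheme M (K j) F \<and>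
    D j = {(x, \<omega>). \<exists>\<sigma>. \<forall>k. x \<in> K j k \<sigma> \<and> \<omega> \<in> F k \<sigma>}" by blast
  from choice[OF this] obtain F where KF: "\<And>j. souslin_scheme M (K j) (F j)"
    and D: "\<And>j. D j = {(x, \<omega>). \<exists>\<sigma>. \<forall>k. x \<in> K j k \<sigma> \<and> \<omega> \<in> F j k \<sigma>}" by blast
  define K' where "K' k \<sigma> = (case k of 0 \<Rightarrow> UNIV | Suc l \<Rightarrow> K (\<sigma> 0) l (\<lambda>i. \<sigma> (Suc i)))"
    for k and \<sigma> :: "nat \<Rightarrow> nat"
  define F' where "F' k \<sigma> = (case k of 0 \<Rightarrow> space M | Suc l \<Rightarrow> F (\<sigma> 0) l (\<lambda>i. \<sigma> (Suc i)))"
    for k and \<sigma> :: "nat \<Rightarrow> nat"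
  have "closed (K' k \<sigma>) \<and> F' k \<sigma> \<in> sets M" for k \<sigma>
    using KF by (cases k) (auto simp: K'_def F'_def souslin_scheme_def)
  moreover have "K' k \<sigma> = K' k \<tau> \<and> F' k \<sigma> = F' k \<tau>" if "\<forall>i<k. \<sigma> i = \<tau> i" for k \<sigma> \<tau>
  proof (cases k)
    case (Suc l)
    then have "\<sigma> 0 = \<tau> 0" "\<forall>i<l. \<sigma> (Suc i) = \<tau> (Suc i)" using that by auto
    then show ?thesis
      using KF[of "\<tau> 0"] unfolding K'_def F'_def Suc souslin_scheme_def by simp
  qed (simp add: K'_def F'_def)
  ultimately have "souslin_scheme M K' F'" unfolding souslin_scheme_def by blast
  moreover have "(\<Union>j. D j) = {(x, \<omega>). \<exists>\<sigma>. \<forall>k. x \<in> K' k \<sigma> \<and> \<omega> \<in> F' k \<sigma>}"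
  proof (intro set_eqI iffI; clarify)
    fix x \<omega> j assume "(x, \<omega>) \<in> D j"
    then obtain \<sigma> where s: "\<And>k. x \<in> K j k \<sigma> \<and> \<omega> \<in> F j k \<sigma>" unfolding D by auto
    then have "\<omega> \<in> space M"
      using KF[of j] sets.sets_into_space unfolding souslin_scheme_def by (metis in_mono)
    then have "x \<in> K' k (case_nat j \<sigma>) \<and> \<omega> \<in> F' k (case_nat j \<sigma>)" for k
      using s by (cases k) (auto simp: K'_def F'_def)
    then show "\<exists>\<sigma>. \<forall>k. x \<in> K' k \<sigma> \<and> \<omega> \<in> F' k \<sigma>" by blast
  next
    fix x \<omega> \<sigma> assume s: "\<forall>k. x \<in> K' k \<sigma> \<and> \<omega> \<in> F' k \<sigma>"
    have "x \<in> K (\<sigma> 0) k (\<lambda>i. \<sigma> (Suc i)) \<and> \<omega> \<in> F (\<sigma> 0) k (\<lambda>i. \<sigma> (Suc i))" for k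
      using s[rule_format, of "Suc k"] by (simp add: K'_def F'_def)
    then have "(x, \<omega>) \<in> D (\<sigma> 0)" unfolding D by blast
    then show "(x, \<omega>) \<in> (\<Union>j. D j)" by blast
  qed
  ultimately show ?thesis unfolding souslin_def by blast
qed

text \<open>
  One sequence encodes a sequence for each member of the intersection, through the pairing
  function \<open>prod_encode\<close>. As pairing is strictly increasing in its second argument,
  the encoded scheme still depends on initial segments only.
\<close>

lemma souslin_INT:
  fixes D :: "nat \<Rightarrow> ('x::topological_space \<times> 'w) set"
  assumes "\<And>j. souslin M (D j)"
  shows "souslin M (\<Inter>j. D j)"
proof -
  have "\<forall>j. \<exists>K F. souslin_scheme M K F \<and> D j = {(x, \<omega>). \<exists>\<sigma>. \<forall>k. x \<in> K k \<sigma> \<and> \<omega> \<in> F k \<sigma>}"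
    using assms unfolding souslin_def by blast
  from choice[OF this] obtain K where "\<forall>j. \<exists>F. souslin_scheme M (K j) F \<and>
    D j = {(x, \<omega>). \<exists>\<sigma>. \<forall>k. x \<in> K j k \<sigma> \<and> \<omega> \<in> F k \<sigma>}" by blast
  from choice[OF this] obtain F where KF: "\<And>j. souslin_scheme M (K j) (F j)"
    and D: "\<And>j. D j = {(x, \<omega>). \<exists>\<sigma>. \<forall>k. x \<in> K j k \<sigma> \<and> \<omega> \<in> F j k \<sigma>}" by blast
  define row where "row \<sigma> j = (\<lambda>i. \<sigma> (prod_encode (j, i)))" for \<sigma> :: "nat \<Rightarrow> nat" and j
  define K' where "K' k \<sigma> = (case prod_decode k of (j, l) \<Rightarrow> K j l (row \<sigma> j))" for k \<sigma>
  define F' where "F' k \<sigma> = (case prod_decode k of (j, l) \<Rightarrow> F j l (row \<sigma> j))" for k \<sigma>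
  have "closed (K' k \<sigma>) \<and> F' k \<sigma> \<in> sets M" for k \<sigma>
    using KF by (auto simp: K'_def F'_def souslin_scheme_def split: prod.splits)
  moreover have "K' k \<sigma> = K' k \<tau> \<and> F' k \<sigma> = F' k \<tau>" if eq: "\<forall>i<k. \<sigma> i = \<tau> i" for k \<sigma> \<tau>
  proof -
    obtain j l where jl: "prod_decode k = (j, l)" by fastforce
    then have k: "k = prod_encode (j, l)" by (metis prod_decode_inverse)
    have "row \<sigma> j i = row \<tau> j i" if "i < l" for i
    proof -
      have "triangle (j + i) < triangle (j + l)"
        using \<open>i < l\<close> by (induction l) (auto simp: less_Suc_eq)
      then have "prod_encode (j, i) < k" unfolding k prod_encode_def by simp
      then show ?thesis using eq unfolding row_def by simp
    qed
    then show ?thesis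
      using KF[of j] unfolding K'_def F'_def jl souslin_scheme_def by simp
  qed
  ultimately have "souslin_scheme M K' F'" unfolding souslin_scheme_def by blast
  moreover have "(\<Inter>j. D j) = {(x, \<omega>). \<exists>\<sigma>. \<forall>k. x \<in> K' k \<sigma> \<and> \<omega> \<in> F' k \<sigma>}"
  proof (intro set_eqI iffI; clarify)
    fix x \<omega> assume "(x, \<omega>) \<in> (\<Inter>j. D j)"
    then have "\<forall>j. \<exists>\<sigma>. \<forall>k. x \<in> K j k \<sigma> \<and> \<omega> \<in> F j k \<sigma>" using D by auto
    then obtain s where s: "\<And>j k. x \<in> K j k (s j) \<and> \<omega> \<in> F j k (s j)" by metis
    define \<sigma> where "\<sigma> n = (case prod_decode n of (j, i) \<Rightarrow> s j i)" for n
    have "row \<sigma> j = s j" for j unfolding row_def \<sigma>_def by simp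
    then have "x \<in> K' k \<sigma> \<and> \<omega> \<in> F' k \<sigma>" for k
      using s by (auto simp: K'_def F'_def split: prod.splits)
    then show "\<exists>\<sigma>. \<forall>k. x \<in> K' k \<sigma> \<and> \<omega> \<in> F' k \<sigma>" by blast
  next
    fix x \<omega> \<sigma> j assume s: "\<forall>k. x \<in> K' k \<sigma> \<and> \<omega> \<in> F' k \<sigma>"
    have "x \<in> K j l (row \<sigma> j) \<and> \<omega> \<in> F j l (row \<sigma> j)" for l
      using s[rule_format, of "prod_encode (j, l)"] by (simp add: K'_def F'_def)
    then show "(x, \<omega>) \<in> D j" unfolding D by blast
  qed
  ultimately show ?thesis unfolding souslin_def by blast
qed

lemma souslin_Un: "souslin M D \<Longrightarrow> souslin M E \<Longrightarrow> souslin M (D \<union> E)"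
proof -
  assume "souslin M D" "souslin M E"
  then have "souslin M (\<Union>j. if j = (0::nat) then D else E)" by (intro souslin_UN) auto
  also have "(\<Union>j. if j = (0::nat) then D else E) = D \<union> E" by (auto split: if_splits)
  finally show ?thesis .
qed

lemma open_eq_UN_closed:
  fixes V :: "'x::metric_space set"
  assumes "open V"
  shows "\<exists>C :: nat \<Rightarrow> 'x set. (\<forall>j. closed (C j)) \<and> V = (\<Union>j. C j)"
proof (intro exI conjI allI)
  define C where "C j = {x. \<forall>y. y \<notin> V \<longrightarrow> inverse (real (Suc j)) \<le> dist x y}" for j
  show "closed (C j)" for j
  proof -
    have "C j = (\<Inter>y\<in>-V. {x. inverse (real (Suc j)) \<le> dist x y})" unfolding C_def by auto
    moreover have "closed {x. inverse (real (Suc j)) \<le> dist x y}" for y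
      by (intro closed_Collect_le continuous_intros)
    ultimately show ?thesis by auto
  qed
  show "V = (\<Union>j. C j)"
  proof (intro set_eqI iffI)
    fix x assume "x \<in> V"
    then obtain e where e: "e > 0" "ball x e \<subseteq> V" using assms open_contains_ball by blast
    then obtain j where "inverse (real (Suc j)) < e" using reals_Archimedean by blast
    moreover have "e \<le> dist x y" if "y \<notin> V" for y
      using that e(2) by (meson in_mono mem_ball not_le)
    ultimately have "x \<in> C j" unfolding C_def by fastforce
    then show "x \<in> (\<Union>j. C j)" by blast
  next
    fix x assume "x \<in> (\<Union>j. C j)"
    then obtain j where j: "\<And>y. y \<notin> V \<Longrightarrow> inverse (real (Suc j)) \<le> dist x y"
      unfolding C_def by auto
    have "0 < inverse (real (Suc j))" by simp
    then show "x \<in> V" using j[of x] by (metis dist_self not_le)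
  qed
qed

text \<open>
  Souslin sets need not be closed under complements, but the Souslin sets with Souslin
  complement form a sigma-algebra. It contains the rectangles because open sets are countable
  unions of closed ones.
\<close>

lemma souslin_if_measurable:
  fixes D :: "('x::metric_space \<times> 'w) set"
  assumes "D \<in> sets (borel \<Otimes>\<^sub>M M)"
  shows "souslin M D"
proof -
  define \<S> where "\<S> = {D :: ('x \<times> 'w) set. D \<subseteq> UNIV \<times> space M \<and> souslin M D \<and> souslin M (UNIV \<times> space M - D)}"
  have sa: "sigma_algebra (UNIV \<times> space M) \<S>"
  proof (rule sigma_algebra_iff2[THEN iffD2], intro conjI ballI allI impI)
    show "\<S> \<subseteq> Pow (UNIV \<times> space M)" unfolding \<S>_def by auto
    show "{} \<in> \<S>"
      using souslin_rectangle[of "{}" "{}" M] souslin_rectangle[of UNIV "space M" M]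
      unfolding \<S>_def by simp
    fix D assume "D \<in> \<S>"
    then show "UNIV \<times> space M - D \<in> \<S>"
      unfolding \<S>_def by (auto simp: double_diff)
  next
    fix D :: "nat \<Rightarrow> ('x \<times> 'w) set" assume D: "range D \<subseteq> \<S>"
    then have "souslin M (\<Union>j. D j)" by (intro souslin_UN) (auto simp: \<S>_def)
    moreover have "souslin M (\<Inter>j. UNIV \<times> space M - D j)"
      using D by (intro souslin_INT) (auto simp: \<S>_def)
    moreover have "(\<Inter>j. UNIV \<times> space M - D j) = UNIV \<times> space M - (\<Union>j. D j)" by auto
    ultimately show "(\<Union>j. D j) \<in> \<S>" using D unfolding \<S>_def by auto
  qed
  interpret sigma_algebra "UNIV \<times> space M" \<S> by (rule sa)
  have rect: "C \<times> B \<in> \<S>" if "closed C" "B \<in> sets M" for C :: "'x set" and B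
  proof -
    have "open (- C)" using that(1) by (rule open_Compl)
    then obtain K :: "nat \<Rightarrow> 'x set" where K: "\<And>j. closed (K j)" "- C = (\<Union>j. K j)"
      using open_eq_UN_closed[of "- C"] by auto
    have "souslin M (\<Union>j. K j \<times> space M)" by (rule souslin_UN, rule souslin_rectangle[OF K(1) sets.top])
    moreover have "souslin M (UNIV \<times> (space M - B))" by (rule souslin_rectangle[OF closed_UNIV sets.compl_sets[OF that(2)]])
    ultimately have "souslin M ((\<Union>j. K j \<times> space M) \<union> (UNIV \<times> (space M - B)))"
      by (rule souslin_Un)
    moreover have "(\<Union>j. K j \<times> space M) \<union> (UNIV \<times> (space M - B)) = UNIV \<times> space M - C \<times> B"
      using K(2) sets.sets_into_space[OF that(2)] by auto
    ultimately show ?thesis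
      using that souslin_rectangle[OF that] sets.sets_into_space[OF that(2)] unfolding \<S>_def by auto
  qed
  have "a \<times> space M \<in> \<S>" if "a \<in> sets borel" for a :: "'x set"
  proof -
    have "a \<in> sigma_sets UNIV (Collect closed)" using that unfolding borel_eq_closed by simp
    then show ?thesis
    proof induction
      case (Basic a) then show ?case by (auto intro: rect)
    next
      case Empty then show ?case by simp
    next
      case (Compl a)
      then have "UNIV \<times> space M - a \<times> space M \<in> \<S>" by blast
      also have "UNIV \<times> space M - a \<times> space M = (UNIV - a) \<times> space M" by auto
      finally show ?case .
    next
      case (Union a)
      then have "(\<Union>i. a i \<times> space M) \<in> \<S>" by blast
      also have "(\<Union>i. a i \<times> space M) = (\<Union>i. a i) \<times> space M" by auto
      finally show ?case .
    qed
  qed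
  then have "a \<times> b \<in> \<S>" if "a \<in> sets borel" "b \<in> sets M" for a b
  proof -
    have "(a \<times> space M) \<inter> (UNIV \<times> b) \<in> \<S>"
      using that \<open>\<And>a. a \<in> sets borel \<Longrightarrow> a \<times> space M \<in> \<S>\<close> rect[of UNIV b] by (intro Int) auto
    also have "(a \<times> space M) \<inter> (UNIV \<times> b) = a \<times> b" using sets.sets_into_space[OF that(2)] by auto
    finally show ?thesis .
  qed
  then have "{a \<times> b | a b. a \<in> sets borel \<and> b \<in> sets M} \<subseteq> \<S>" by auto
  then have "sigma_sets (UNIV \<times> space M) {a \<times> b | a b. a \<in> sets borel \<and> b \<in> sets M} \<subseteq> \<S>"
    by (rule sigma_sets_subset)
  then show ?thesis using assms unfolding sets_pair_measure \<S>_def by auto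
qed

lemma compact_box: "compact {\<sigma> :: nat \<Rightarrow> nat. \<forall>i. \<sigma> i \<le> n i}"
proof -
  have "compactin (product_topology (\<lambda>i. euclidean :: nat topology) UNIV) (\<Pi>\<^sub>E i\<in>UNIV. {..n i})"
    by (subst compactin_PiE) (auto simp: finite_imp_compact)
  then have "compact (\<Pi>\<^sub>E i\<in>UNIV. {..n i})"
    unfolding euclidean_product_topology compactin_euclidean_iff .
  also have "(\<Pi>\<^sub>E i\<in>UNIV. {..n i}) = {\<sigma>. \<forall>i. \<sigma> i \<le> n i}" by (auto simp: PiE_def)
  finally show ?thesis .
qed

text \<open>
  For fixed \<open>\<omega>\<close> the \<open>k\<close>-th condition is locally constant in the
  index sequence and closed in the point, so it is closed in both. This is what makes
  compactness usable for points and index sequences simultaneously.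
\<close>

lemma closed_scheme_section:
  fixes K :: "nat \<Rightarrow> (nat \<Rightarrow> nat) \<Rightarrow> 'x::topological_space set"
  assumes "souslin_scheme M K F"
  shows "closed {(x, \<sigma>). x \<in> K k \<sigma> \<and> \<omega> \<in> F k \<sigma>}"
proof -
  have dep: "K k \<sigma> = K k \<tau> \<and> F k \<sigma> = F k \<tau>" if "\<forall>i<k. \<sigma> i = \<tau> i" for \<sigma> \<tau>
    using assms that unfolding souslin_scheme_def by blast
  let ?cyl = "\<lambda>\<tau>. {\<sigma> :: nat \<Rightarrow> nat. \<forall>i<k. \<sigma> i = \<tau> i}"
  have open_cyl: "open (?cyl \<tau>)" for \<tau>
  proof -
    have "open ((\<lambda>\<sigma>. \<sigma> i) -` {\<tau> i} :: (nat \<Rightarrow> nat) set)" for i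
      by (rule open_vimage[OF discrete_topology_class.open_discrete continuous_on_product_coordinates])
    then have "open (\<Inter>i\<in>{..<k}. (\<lambda>\<sigma>. \<sigma> i) -` {\<tau> i} :: (nat \<Rightarrow> nat) set)"
      by (intro open_INT) auto
    also have "(\<Inter>i\<in>{..<k}. (\<lambda>\<sigma>. \<sigma> i) -` {\<tau> i}) = ?cyl \<tau>" by auto
    finally show ?thesis .
  qed
  have "- {(x, \<sigma>). x \<in> K k \<sigma> \<and> \<omega> \<in> F k \<sigma>} =
    (\<Union>\<tau>. (if \<omega> \<in> F k \<tau> then - K k \<tau> else UNIV) \<times> ?cyl \<tau>)" (is "?L = ?R")
  proof (intro set_eqI iffI)
    fix p assume "p \<in> ?L"
    then have "p \<in> (if \<omega> \<in> F k (snd p) then - K k (snd p) else UNIV) \<times> ?cyl (snd p)"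
      by (auto simp: mem_Times_iff split_beta)
    then show "p \<in> ?R" by blast
  next
    fix p assume "p \<in> ?R"
    then obtain \<tau> where "p \<in> (if \<omega> \<in> F k \<tau> then - K k \<tau> else UNIV) \<times> ?cyl \<tau>" by blast
    then show "p \<in> ?L" using dep[of "snd p" \<tau>] by (auto simp: mem_Times_iff split_beta split: if_splits)
  qed
  moreover have "open ?R"
    using open_cyl assms unfolding souslin_scheme_def
    by (intro open_UN ballI open_Times) auto
  ultimately show ?thesis unfolding closed_def by simp
qed

text \<open>
  Outer measure of the projection behaves like a capacity. Bounding the values of the index
  sequence one after the other costs arbitrarily little outer measure, since outer measure is
  continuous along increasing unions. The index sequences obeying all bounds form a compact box,
  and over a compact box the projection commutes with the intersection of the scheme, which
  makes it measurable. So the projection has measurable subsets of measure arbitrarily close to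
  its outer measure, and completeness does the rest.
\<close>

theorem measurable_projection:
  fixes D :: "('x::metric_space \<times> 'w) set"
  assumes cmp: "compact (UNIV :: 'x set)" and M: "complete_measure M" "finite_measure M"
    and D: "D \<in> sets (borel \<Otimes>\<^sub>M M)"
  shows "snd ` D \<in> sets M"
proof -
  interpret complete_measure M by fact
  interpret finite_measure M by fact
  obtain K F where KF: "souslin_scheme M K F"
    and D_eq: "D = {(x, \<omega>). \<exists>\<sigma>. \<forall>k. x \<in> K k \<sigma> \<and> \<omega> \<in> F k \<sigma>}"
    using souslin_if_measurable[OF D] unfolding souslin_def by blast
  define P where "P S = {\<omega>. \<exists>\<sigma>\<in>S. \<exists>x. \<forall>k. x \<in> K k \<sigma> \<and> \<omega> \<in> F k \<sigma>}" for S
  have F_sets: "F k \<sigma> \<in> sets M" for k \<sigma> using KF unfolding souslin_scheme_def by blast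
  have P_space: "P S \<subseteq> space M" for S
  proof
    fix \<omega> assume "\<omega> \<in> P S"
    then obtain \<sigma> where "\<omega> \<in> F 0 \<sigma>" unfolding P_def by blast
    then show "\<omega> \<in> space M" using F_sets sets.sets_into_space by blast
  qed
  have proj: "snd ` D = P UNIV" unfolding D_eq P_def by force
  define cyl where "cyl n j = {\<sigma> :: nat \<Rightarrow> nat. \<forall>i<j. \<sigma> i \<le> n i}" for n :: "nat \<Rightarrow> nat" and j :: nat
  have inner: "\<exists>B\<in>sets M. B \<subseteq> P UNIV \<and> a \<le> emeasure M B" if a: "a < outer_measure_of M (P UNIV)" for a
  proof -
    have "\<exists>f. \<forall>j. (a < outer_measure_of M (P (cyl (f j) j))) \<and> (\<forall>i<j. f (Suc j) i = f j i)"
    proof (rule dependent_nat_choice)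
      show "\<exists>f. a < outer_measure_of M (P (cyl f 0))" using a unfolding cyl_def by simp
      fix f j assume a: "a < outer_measure_of M (P (cyl f j))"
      let ?C = "\<lambda>m. P (cyl (f(j := m)) (Suc j))"
      \<comment> \<open>Relaxing the bound on the \<open>j\<close>-th value exhausts the set without that bound.\<close>
      have "incseq ?C"
      proof (rule incseq_SucI)
        fix m
        have "cyl (f(j := m)) (Suc j) \<subseteq> cyl (f(j := Suc m)) (Suc j)"
          unfolding cyl_def by (auto simp: less_Suc_eq)
        then show "?C m \<subseteq> ?C (Suc m)" unfolding P_def by blast
      qed
      then have "(SUP m. outer_measure_of M (?C m)) = outer_measure_of M (\<Union>m. ?C m)"
        by (intro SUP_outer_measure_of_incseq P_space)
      also have "(\<Union>m. ?C m) = P (cyl f j)"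
      proof (intro set_eqI iffI)
        fix \<omega> assume "\<omega> \<in> (\<Union>m. ?C m)"
        then obtain m \<sigma> where s: "\<sigma> \<in> cyl (f(j := m)) (Suc j)" "\<exists>x. \<forall>k. x \<in> K k \<sigma> \<and> \<omega> \<in> F k \<sigma>"
          unfolding P_def by blast
        then have "\<sigma> \<in> cyl f j" unfolding cyl_def by (auto simp: less_Suc_eq split: if_splits)
        then show "\<omega> \<in> P (cyl f j)" using s(2) unfolding P_def by blast
      next
        fix \<omega> assume "\<omega> \<in> P (cyl f j)"
        then obtain \<sigma> where s: "\<sigma> \<in> cyl f j" "\<exists>x. \<forall>k. x \<in> K k \<sigma> \<and> \<omega> \<in> F k \<sigma>" unfolding P_def by blast
        then have "\<sigma> \<in> cyl (f(j := \<sigma> j)) (Suc j)" unfolding cyl_def by auto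
        then show "\<omega> \<in> (\<Union>m. ?C m)" using s unfolding P_def by blast
      qed
      finally have "a < (SUP m. outer_measure_of M (?C m))" using a by (simp only:)
      then obtain m where "a < outer_measure_of M (?C m)" unfolding less_SUP_iff by blast
      then show "\<exists>g. a < outer_measure_of M (P (cyl g (Suc j))) \<and> (\<forall>i<j. g i = f i)"
        by (intro exI[of _ "f(j := m)"]) simp
    qed
    then obtain f where f: "\<And>j. a < outer_measure_of M (P (cyl (f j) j))"
      and f_Suc: "\<And>i j. i < j \<Longrightarrow> f (Suc j) i = f j i" by blast
    define n where "n i = f (Suc i) i" for i
    have f_n: "f j i = n i" if "i < j" for i j
      using that
    proof (induction j)
      case (Suc j) then show ?case using f_Suc[of i j] unfolding n_def by (cases "i = j") auto
    qed simp
    then have n: "a < outer_measure_of M (P (cyl n j))" for j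
      using f[of j] unfolding cyl_def by simp
    define box where "box = {\<sigma> :: nat \<Rightarrow> nat. \<forall>i. \<sigma> i \<le> n i}"
    \<comment> \<open>\<open>Q k\<close> keeps only the first conditions. Only the first \<open>k\<close>
      values of the index sequence matter there, so padding with zeros reduces the union to
      countably many rectangles.\<close>
    define Q where "Q k = {\<omega>. \<exists>\<sigma>\<in>box. \<exists>x. \<forall>j\<le>k. x \<in> K j \<sigma> \<and> \<omega> \<in> F j \<sigma>}" for k
    have dep: "K k \<sigma> = K k \<tau> \<and> F k \<sigma> = F k \<tau>" if "\<forall>i<k. \<sigma> i = \<tau> i" for k \<sigma> \<tau>
      using KF that unfolding souslin_scheme_def by blast
    define pad where "pad xs i = (if i < length xs then xs ! i else 0)" for xs :: "nat list" and i
    have trunc: "\<exists>xs. length xs = k \<and> pad xs \<in> box \<and> (\<forall>j\<le>k. K j \<sigma> = K j (pad xs) \<and> F j \<sigma> = F j (pad xs))"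
      if "\<sigma> \<in> cyl n k" for \<sigma> k
    proof (intro exI[of _ "map \<sigma> [0..<k]"] conjI allI impI)
      show "pad (map \<sigma> [0..<k]) \<in> box" using that unfolding pad_def box_def cyl_def by auto
      fix j assume "j \<le> k"
      then have "\<forall>i<j. \<sigma> i = pad (map \<sigma> [0..<k]) i" unfolding pad_def by auto
      then show "K j \<sigma> = K j (pad (map \<sigma> [0..<k]))" "F j \<sigma> = F j (pad (map \<sigma> [0..<k]))"
        using dep by blast+
    qed simp
    have box_cyl: "box \<subseteq> cyl n k" for k unfolding box_def cyl_def by auto
    have Q_sets: "Q k \<in> sets M" for k
    proof -
      let ?B = "\<lambda>xs. if pad xs \<in> box \<and> (\<Inter>j\<in>{..k}. K j (pad xs)) \<noteq> {} then (\<Inter>j\<in>{..k}. F j (pad xs)) else {}"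
      have eq: "Q k = (\<Union>xs. ?B xs)"
      proof (intro set_eqI iffI)
        fix \<omega> assume "\<omega> \<in> Q k"
        then obtain \<sigma> x where s: "\<sigma> \<in> box" "\<forall>j\<le>k. x \<in> K j \<sigma> \<and> \<omega> \<in> F j \<sigma>" unfolding Q_def by blast
        then obtain xs where xs: "pad xs \<in> box" "\<forall>j\<le>k. K j \<sigma> = K j (pad xs) \<and> F j \<sigma> = F j (pad xs)"
          using trunc[of \<sigma> k] box_cyl by blast
        then have "\<omega> \<in> ?B xs" using s by auto
        then show "\<omega> \<in> (\<Union>xs. ?B xs)" by blast
      next
        fix \<omega> assume "\<omega> \<in> (\<Union>xs. ?B xs)"
        then obtain xs where xs: "\<omega> \<in> ?B xs" by blast
        then have "pad xs \<in> box" "(\<Inter>j\<in>{..k}. K j (pad xs)) \<noteq> {}" "\<omega> \<in> (\<Inter>j\<in>{..k}. F j (pad xs))"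
          by (auto split: if_splits)
        then show "\<omega> \<in> Q k" unfolding Q_def by blast
      qed
      have "?B xs \<in> sets M" for xs
        using F_sets by (auto intro!: sets.finite_INT)
      then have "(\<Union>xs. ?B xs) \<in> sets M" by (intro sets.countable_UN) blast
      then show ?thesis unfolding eq .
    qed
    have P_Q: "P (cyl n k) \<subseteq> Q k" for k
    proof
      fix \<omega> assume "\<omega> \<in> P (cyl n k)"
      then obtain \<sigma> x where s: "\<sigma> \<in> cyl n k" "\<And>j. x \<in> K j \<sigma> \<and> \<omega> \<in> F j \<sigma>" unfolding P_def by blast
      then obtain xs where "pad xs \<in> box" "\<forall>j\<le>k. K j \<sigma> = K j (pad xs) \<and> F j \<sigma> = F j (pad xs)"
        using trunc[of \<sigma> k] by blast
      then have "pad xs \<in> box \<and> (\<forall>j\<le>k. x \<in> K j (pad xs) \<and> \<omega> \<in> F j (pad xs))" using s(2) by metis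
      then show "\<omega> \<in> Q k" unfolding Q_def by blast
    qed
    have "decseq Q"
    proof (rule decseq_SucI, rule subsetI)
      fix k \<omega> assume "\<omega> \<in> Q (Suc k)"
      then obtain \<sigma> x where "\<sigma> \<in> box" "\<forall>j\<le>Suc k. x \<in> K j \<sigma> \<and> \<omega> \<in> F j \<sigma>" unfolding Q_def by blast
      then show "\<omega> \<in> Q k" unfolding Q_def using le_SucI by blast
    qed
    have "(\<Inter>k. Q k) \<subseteq> P box"
    proof
      fix \<omega> assume w: "\<omega> \<in> (\<Inter>k. Q k)"
      let ?Z = "\<lambda>k. {(x, \<sigma>). x \<in> K k \<sigma> \<and> \<omega> \<in> F k \<sigma>}"
      have "(UNIV \<times> box) \<inter> (\<Inter>k\<in>UNIV. ?Z k) \<noteq> {}"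
      proof (rule compact_imp_fip_image)
        show "compact (UNIV \<times> box :: ('x \<times> (nat \<Rightarrow> nat)) set)"
          using cmp compact_box unfolding box_def by (intro compact_Times) 
        show "closed (?Z k)" for k by (rule closed_scheme_section[OF KF])
        fix I :: "nat set" assume "finite I"
        then obtain k where k: "\<forall>j\<in>I. j \<le> k" unfolding finite_nat_set_iff_bounded_le by blast
        have "\<omega> \<in> Q k" using w by blast
        then obtain \<sigma> x where "\<sigma> \<in> box" "\<forall>j\<le>k. x \<in> K j \<sigma> \<and> \<omega> \<in> F j \<sigma>" unfolding Q_def by blast
        then have "(x, \<sigma>) \<in> (UNIV \<times> box) \<inter> (\<Inter>k\<in>I. ?Z k)" using k by auto
        then show "(UNIV \<times> box) \<inter> (\<Inter>k\<in>I. ?Z k) \<noteq> {}" by blast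
      qed
      then have "\<exists>p. p \<in> (UNIV \<times> box) \<inter> (\<Inter>k\<in>UNIV. ?Z k)" by (rule ex_in_conv[THEN iffD2])
      then obtain p where p: "p \<in> (UNIV \<times> box) \<inter> (\<Inter>k\<in>UNIV. ?Z k)" by (rule exE)
      then have "snd p \<in> box" "\<forall>k. fst p \<in> K k (snd p) \<and> \<omega> \<in> F k (snd p)"
        by (auto simp: mem_Times_iff split_beta)
      then show "\<omega> \<in> P box" unfolding P_def by blast
    qed
    then have "(\<Inter>k. Q k) \<subseteq> P UNIV" unfolding P_def by blast
    moreover have "a \<le> emeasure M (\<Inter>k. Q k)"
    proof -
      have "a \<le> emeasure M (Q k)" for k
        using n[of k] outer_measure_of_mono[OF P_Q[of k], of M] Q_sets[of k] by simp
      then have "a \<le> (INF k. emeasure M (Q k))" by (intro INF_greatest)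
      also have "\<dots> = emeasure M (\<Inter>k. Q k)"
        using Q_sets \<open>decseq Q\<close> by (intro INF_emeasure_decseq) auto
      finally show ?thesis .
    qed
    ultimately show ?thesis using Q_sets by (intro bexI[of _ "\<Inter>k. Q k"]) auto
  qed
  obtain E where E: "E \<in> sets M" "P UNIV \<subseteq> E" "outer_measure_of M (P UNIV) = emeasure M E"
    using outer_measure_of_attain[OF P_space] by blast
  define \<B> where "\<B> = {B \<in> sets M. B \<subseteq> P UNIV}"
  have "(SUP B\<in>\<B>. emeasure M B) = emeasure M E"
  proof (rule antisym)
    show "(SUP B\<in>\<B>. emeasure M B) \<le> emeasure M E"
      using E by (intro SUP_least emeasure_mono) (auto simp: \<B>_def)
    show "emeasure M E \<le> (SUP B\<in>\<B>. emeasure M B)"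
    proof (rule dense_le)
      fix a assume "a < emeasure M E"
      then obtain B where "B \<in> \<B>" "a \<le> emeasure M B" using inner E(3) unfolding \<B>_def by auto
      then show "a \<le> (SUP B\<in>\<B>. emeasure M B)" by (meson SUP_upper2)
    qed
  qed
  moreover have "emeasure M ` \<B> \<noteq> {}" unfolding \<B>_def by blast
  ultimately obtain g where g: "range g \<subseteq> emeasure M ` \<B>" "emeasure M E = (SUP i::nat. g i)"
    using ennreal_Sup_countable_SUP by metis
  then have "\<forall>i. \<exists>B. B \<in> \<B> \<and> g i = emeasure M B" by auto
  from choice[OF this] obtain B where B: "\<And>i. B i \<in> \<B>" "\<And>i. g i = emeasure M (B i)" by blast
  let ?B = "\<Union>i. B i"
  have B': "?B \<in> sets M" "?B \<subseteq> P UNIV" using B(1) unfolding \<B>_def by auto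
  have "emeasure M E \<le> emeasure M ?B"
    unfolding g(2) B(2) using B' by (intro SUP_least emeasure_mono) auto
  then have "emeasure M E = emeasure M ?B"
    using emeasure_mono[of ?B E M] B' E by (intro antisym) auto
  moreover have "emeasure M ?B < \<infinity>" using emeasure_finite less_top by (metis infinity_ennreal_def)
  ultimately show ?thesis
    unfolding proj by (intro complete_sets_sandwich[OF B'(1) E(1) B'(2) E(2)]) auto
qed

section \<open>Projective space and linear maps\<close>

lemma projrel_refl: "x \<noteq> 0 \<Longrightarrow> projrel x x"
  unfolding projrel_def by (auto intro: exI[of _ 1])

lemma abs_projective_eq_iff:
  "x \<noteq> 0 \<Longrightarrow> y \<noteq> 0 \<Longrightarrow> abs_projective x = abs_projective y \<longleftrightarrow> projrel x y"
  using Quotient3_rel[OF Quotient3_projective, of x y] projrel_refl by blast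

lemma dist_abs_projective:
  "x \<noteq> 0 \<Longrightarrow> y \<noteq> 0 \<Longrightarrow> dist (abs_projective x) (abs_projective y) = proj_dist x y"
  by (intro dist_projective.abs_eq projrel_refl)

lemma projective_cases:
  obtains x where "norm x = 1" "p = abs_projective x"
proof -
  have r: "projrel (rep_projective p) (rep_projective p)"
    by (rule Quotient3_rep_reflp[OF Quotient3_projective])
  then have nz: "rep_projective p \<noteq> 0" unfolding projrel_def by blast
  let ?x = "rep_projective p /\<^sub>R norm (rep_projective p)"
  have "norm ?x = 1" using nz by simp
  moreover have "projrel (rep_projective p) ?x"
    using nz unfolding projrel_def by auto
  then have "abs_projective (rep_projective p) = abs_projective ?x"
    by (rule Quotient3_rel_abs[OF Quotient3_projective])
  then have "p = abs_projective ?x" by (simp add: Quotient3_abs_rep[OF Quotient3_projective])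
  ultimately show ?thesis by (rule that)
qed

text \<open>
  Normalisation is Lipschitz away from the origin; all estimates of projective distances below
  come from this inequality.
\<close>

lemma norm_normalize_diff_le:
  fixes x y :: "'a::real_normed_vector"
  assumes "x \<noteq> 0" "y \<noteq> 0"
  shows "norm (x /\<^sub>R norm x - y /\<^sub>R norm y) \<le> 2 * norm (x - y) / norm y"
proof -
  have "x /\<^sub>R norm x - y /\<^sub>R norm y = (x - y) /\<^sub>R norm y + (inverse (norm x) - inverse (norm y)) *\<^sub>R x"
    by (simp add: algebra_simps)
  also have "norm \<dots> \<le> norm (x - y) / norm y + \<bar>inverse (norm x) - inverse (norm y)\<bar> * norm x"
    by (rule order_trans[OF norm_triangle_ineq]) (simp add: divide_inverse_commute)
  also have "\<bar>inverse (norm x) - inverse (norm y)\<bar> * norm x = \<bar>norm y - norm x\<bar> / norm y"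
    using assms by (simp add: abs_if field_simps)
  also have "\<dots> \<le> norm (x - y) / norm y"
    using norm_triangle_ineq3[of y x] by (simp add: divide_right_mono norm_minus_commute)
  finally show ?thesis by simp
qed

lemma dist_abs_projective_le:
  assumes "x \<noteq> 0" "y \<noteq> 0"
  shows "dist (abs_projective x) (abs_projective y) \<le> 2 * norm (x - y) / norm y"
  using norm_normalize_diff_le[OF assms] by (auto simp: dist_abs_projective assms proj_dist_def)

lemma continuous_on_abs_projective:
  "continuous_on {x. x \<noteq> 0} (abs_projective :: real ^ 'n::finite \<Rightarrow> _)"
proof (unfold continuous_on_iff, intro ballI allI impI)
  fix x :: "real ^ 'n" and e :: real assume x: "x \<in> {x. x \<noteq> 0}" and e: "0 < e"
  let ?d = "e * norm x / 2"
  have "dist (abs_projective x') (abs_projective x) < e" if "x' \<noteq> 0" "dist x' x < ?d" for x'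
  proof -
    have "dist (abs_projective x') (abs_projective x) \<le> 2 * norm (x' - x) / norm x"
      using x that by (intro dist_abs_projective_le) auto
    also have "\<dots> < e" using x that by (simp add: dist_norm field_simps)
    finally show ?thesis .
  qed
  moreover have "?d > 0" using x e by simp
  ultimately show "\<exists>d>0. \<forall>x'\<in>{x. x \<noteq> 0}. dist x' x < d \<longrightarrow> dist (abs_projective x') (abs_projective x) < e"
    by blast
qed

lemma compact_UNIV_projective: "compact (UNIV :: 'n::finite projective set)"
proof -
  have "compact (abs_projective ` sphere (0 :: real ^ 'n) 1)"
    by (intro compact_continuous_image compact_sphere continuous_on_subset[OF continuous_on_abs_projective]) auto
  also have "abs_projective ` sphere (0 :: real ^ 'n) 1 = UNIV"
    using projective_cases by (metis (no_types, lifting) UNIV_eq_I imageI mem_sphere_0)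
  finally show ?thesis .
qed

definition proj_image :: "(real ^ 'n::finite) set \<Rightarrow> 'n projective set" where
  "proj_image E = abs_projective ` (E - {0})"

lemma compact_proj_image_subspace:
  fixes E :: "(real ^ 'n::finite) set"
  assumes "subspace E"
  shows "compact (proj_image E)"
proof -
  have "compact (E \<inter> sphere 0 1)"
    using closed_Int_compact[OF closed_subspace[OF assms] compact_sphere] .
  then have "compact (abs_projective ` (E \<inter> sphere 0 1))"
    by (intro compact_continuous_image continuous_on_subset[OF continuous_on_abs_projective]) auto
  also have "abs_projective ` (E \<inter> sphere 0 1) = proj_image E"
  proof (unfold proj_image_def, intro equalityI subsetI)
    fix p assume "p \<in> abs_projective ` (E - {0})"
    then obtain x where x: "x \<in> E" "x \<noteq> 0" "p = abs_projective x" by blast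
    have "projrel x (x /\<^sub>R norm x)" using x unfolding projrel_def by auto
    then have "p = abs_projective (x /\<^sub>R norm x)" using x(2,3) by (subst x(3), subst abs_projective_eq_iff) auto
    moreover have "x /\<^sub>R norm x \<in> E \<inter> sphere 0 1" using x assms by (simp add: subspace_scale)
    ultimately show "p \<in> abs_projective ` (E \<inter> sphere 0 1)" by blast
  qed auto
  finally show ?thesis .
qed

lemma zero_in_proj_vimage [simp]: "0 \<in> proj_vimage A"
  by (simp add: proj_vimage_def)

lemma proj_vimage_iff: "x \<noteq> 0 \<Longrightarrow> x \<in> proj_vimage A \<longleftrightarrow> abs_projective x \<in> A"
  by (simp add: proj_vimage_def)

lemma proj_vimage_subset_iff: "A \<subseteq> B \<longleftrightarrow> proj_vimage A \<subseteq> proj_vimage B"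
proof
  assume l: "proj_vimage A \<subseteq> proj_vimage B"
  show "A \<subseteq> B"
  proof
    fix p assume "p \<in> A"
    obtain x where x: "norm x = 1" "p = abs_projective x" by (rule projective_cases)
    then have "x \<noteq> 0" by auto
    then show "p \<in> B" using \<open>p \<in> A\<close> x l proj_vimage_iff by blast
  qed
qed (auto simp: proj_vimage_def)

lemma proj_vimage_Int: "proj_vimage (A \<inter> B) = proj_vimage A \<inter> proj_vimage B"
  by (auto simp: proj_vimage_def)

lemma proj_vimage_empty: "proj_vimage {} = {0}"
  by (auto simp: proj_vimage_def)

lemma proj_vimage_UNIV: "proj_vimage UNIV = UNIV"
  by (auto simp: proj_vimage_def)

lemma proj_vimage_scaleR:
  assumes "x \<in> proj_vimage A"
  shows "c *\<^sub>R x \<in> proj_vimage A"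
proof (cases "c *\<^sub>R x = 0")
  case False
  then have "x \<noteq> 0" "projrel x (c *\<^sub>R x)" unfolding projrel_def by auto
  then show ?thesis using False assms abs_projective_eq_iff[of x "c *\<^sub>R x"] by (simp add: proj_vimage_def)
next
  case True
  then show ?thesis by (simp only: zero_in_proj_vimage)
qed

lemma invertible_mult_eq_0:
  fixes \<Psi> :: "real ^ 'n::finite ^ 'n"
  assumes "invertible \<Psi>"
  shows "\<Psi> *v x = 0 \<longleftrightarrow> x = 0"
  using assms by (metis invertible_def matrix_left_invertible_ker matrix_vector_mult_0_right)

text \<open>
  The projective map is Lipschitz: a representative of norm 1 is mapped to a vector whose norm
  is bounded below through the inverse matrix.
\<close>

lemma continuous_on_proj_map:
  fixes \<Psi> :: "real ^ 'n::finite ^ 'n"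
  assumes "invertible \<Psi>"
  shows "continuous_on UNIV (proj_map \<Psi>)"
proof -
  obtain \<Xi> where \<Xi>: "\<Xi> ** \<Psi> = mat 1" using assms unfolding invertible_def by blast
  obtain B where B: "B > 0" "\<And>x. norm (\<Psi> *v x) \<le> norm x * B"
    using bounded_linear.pos_bounded[OF matrix_vector_mul_bounded_linear] by blast
  obtain B' where B': "B' > 0" "\<And>x. norm (\<Xi> *v x) \<le> norm x * B'"
    using bounded_linear.pos_bounded[OF matrix_vector_mul_bounded_linear] by blast
  have lower: "1 \<le> norm (\<Psi> *v x) * B'" if "norm x = 1" for x
    using B'(2)[of "\<Psi> *v x"] that by (simp add: matrix_vector_mul_assoc \<Xi>)
  have lip: "dist (proj_map \<Psi> p) (proj_map \<Psi> q) \<le> 2 * B * B' * dist p q" for p q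
  proof -
    obtain x where x: "norm x = 1" "p = abs_projective x" by (rule projective_cases)
    obtain y where y: "norm y = 1" "q = abs_projective y" by (rule projective_cases)
    have nz: "x \<noteq> 0" "y \<noteq> 0" using x y by auto
    have *: "dist (proj_map \<Psi> p) (proj_map \<Psi> q) \<le> 2 * B * B' * norm (z - y)"
      if z: "norm z = 1" "p = abs_projective z" for z
    proof -
      have nz: "z \<noteq> 0" "y \<noteq> 0" using z y by auto
      have "dist (proj_map \<Psi> p) (proj_map \<Psi> q) \<le> 2 * norm (\<Psi> *v z - \<Psi> *v y) / norm (\<Psi> *v y)"
        unfolding z(2) y(2) proj_map_abs_projective[OF assms nz(1)] proj_map_abs_projective[OF assms nz(2)]
        by (rule dist_abs_projective_le) (simp_all add: invertible_mult_eq_0[OF assms] nz)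
      also have "\<dots> = 2 * norm (\<Psi> *v (z - y)) * (1 / norm (\<Psi> *v y))"
        by (simp add: matrix_vector_mult_diff_distrib)
      also have "\<dots> \<le> 2 * (norm (z - y) * B) * B'"
      proof (rule mult_mono)
        have "norm (\<Psi> *v y) > 0" using nz by (simp add: invertible_mult_eq_0[OF assms])
        then show "1 / norm (\<Psi> *v y) \<le> B'" using lower[OF y(1)] by (simp add: field_simps)
      qed (use B in auto)
      finally show ?thesis by (simp add: mult_ac)
    qed
    have "projrel x (- x)" unfolding projrel_def using nz by (auto intro: exI[of _ "-1"])
    then have "p = abs_projective (- x)" using abs_projective_eq_iff[of x "- x"] nz x by simp
    then have "dist (proj_map \<Psi> p) (proj_map \<Psi> q) \<le> 2 * B * B' * norm (x - y)"
      "dist (proj_map \<Psi> p) (proj_map \<Psi> q) \<le> 2 * B * B' * norm (x + y)"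
      using *[OF x] *[of "- x"] x(1) norm_minus_cancel[of "x + y"] by (simp_all add: algebra_simps)
    moreover have "dist p q = min (norm (x - y)) (norm (x + y))"
      unfolding x y using nz x y by (simp add: dist_abs_projective proj_dist_def)
    ultimately show ?thesis by (auto simp: min_def)
  qed
  show ?thesis
  proof (unfold continuous_on_iff, intro ballI allI impI)
    fix p and e :: real assume "0 < e"
    have "dist (proj_map \<Psi> q) (proj_map \<Psi> p) < e" if "dist q p < e / (2 * B * B')" for q
      using order.strict_trans1[OF lip[of q p], of e] that B B' by (simp add: field_simps)
    then show "\<exists>d>0. \<forall>q\<in>UNIV. dist q p < d \<longrightarrow> dist (proj_map \<Psi> q) (proj_map \<Psi> p) < e"
      using \<open>0 < e\<close> B B' by (intro exI[of _ "e / (2 * B * B')"]) auto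
  qed
qed

text \<open>
  The two assumed distances bound the ratio of the norms of the images of \<open>b\<close> and
  \<open>b'\<close> from both sides; the product of the two bounds involves \<open>r\<close>
  alone. This is the invariance of the cross-ratio.
\<close>

lemma separated_segment_bound:
  fixes \<Psi> :: "real ^ 'n::finite ^ 'n"
  assumes \<Psi>: "invertible \<Psi>" and r: "0 < r" and nz: "b \<noteq> 0" "b' \<noteq> 0" "b + r *\<^sub>R b' \<noteq> 0" "b + inverse r *\<^sub>R b' \<noteq> 0"
    and "0 \<le> \<delta>"
    and d: "\<delta> \<le> dist (proj_map \<Psi> (abs_projective (b + r *\<^sub>R b'))) (proj_map \<Psi> (abs_projective b))"
    and d': "\<delta> \<le> dist (proj_map \<Psi> (abs_projective (b + inverse r *\<^sub>R b'))) (proj_map \<Psi> (abs_projective b'))"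
  shows "\<delta> \<le> 2 * r"
proof -
  define u u' where "u = \<Psi> *v b" and "u' = \<Psi> *v b'"
  have nz': "u \<noteq> 0" "u' \<noteq> 0" unfolding u_def u'_def using nz by (simp_all add: invertible_mult_eq_0[OF \<Psi>])
  have lin: "\<Psi> *v (b + s *\<^sub>R b') = u + s *\<^sub>R u'" for s
    unfolding u_def u'_def by (simp add: matrix_vector_right_distrib matrix_vector_mult_scaleR)
  have nz'': "u + r *\<^sub>R u' \<noteq> 0" "u + inverse r *\<^sub>R u' \<noteq> 0"
    using nz(3,4) invertible_mult_eq_0[OF \<Psi>] lin by metis+
  have im: "proj_map \<Psi> (abs_projective b) = abs_projective u"
    "proj_map \<Psi> (abs_projective b') = abs_projective u'"
    "proj_map \<Psi> (abs_projective (b + r *\<^sub>R b')) = abs_projective (u + r *\<^sub>R u')"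
    "proj_map \<Psi> (abs_projective (b + inverse r *\<^sub>R b')) = abs_projective (u + inverse r *\<^sub>R u')"
    using proj_map_abs_projective[OF \<Psi>] nz lin unfolding u_def u'_def by metis+
  have "\<delta> \<le> 2 * norm (u + r *\<^sub>R u' - u) / norm u"
    using d dist_abs_projective_le[OF nz''(1) nz'(1)] unfolding im by linarith
  then have 1: "\<delta> * norm u \<le> 2 * r * norm u'" using nz' r by (simp add: field_simps)
  have "abs_projective (inverse r *\<^sub>R u') = abs_projective u'"
    using nz' r by (subst abs_projective_eq_iff) (auto simp: projrel_def intro!: exI[of _ r])
  then have "\<delta> \<le> 2 * norm (u + inverse r *\<^sub>R u' - inverse r *\<^sub>R u') / norm (inverse r *\<^sub>R u')"
    using d' dist_abs_projective_le[OF nz''(2), of "inverse r *\<^sub>R u'"] nz' r unfolding im by simp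
  then have 2: "\<delta> * norm u' \<le> 2 * r * norm u" using nz' r by (simp add: field_simps)
  have "\<delta> * \<delta> * norm u \<le> \<delta> * (2 * r * norm u')"
    using mult_left_mono[OF 1 \<open>0 \<le> \<delta>\<close>] by (simp add: mult_ac)
  also have "\<dots> = 2 * r * (\<delta> * norm u')" by simp
  also have "\<dots> \<le> 2 * r * (2 * r * norm u)" using 2 r by (intro mult_left_mono) auto
  finally have "\<delta> * \<delta> * norm u \<le> (2 * r) * (2 * r) * norm u" by simp
  then have "\<delta> * \<delta> \<le> (2 * r) * (2 * r)" using nz' by simp
  then show ?thesis using r by (metis abs_le_square_iff abs_of_nonneg \<open>0 \<le> \<delta>\<close> power2_eq_square less_imp_le mult_nonneg_nonneg zero_le_numeral)
qed

text \<open>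
  A cone over a projective set fails to be a subspace only through a sum \<open>x + y\<close>.
  The segment from \<open>x\<close> to \<open>y\<close> leaves the cone at its midpoint; take
  for \<open>b\<close> and \<open>b'\<close> the end points of the gap around the midpoint.
\<close>

lemma not_subspace_gap:
  fixes A :: "'n::finite projective set"
  assumes A: "closed A" and ns: "\<not> subspace (proj_vimage A)"
  obtains b b' where "b \<noteq> 0" "b' \<noteq> 0" "b \<in> proj_vimage A" "b' \<in> proj_vimage A"
    "\<And>r. 0 < r \<Longrightarrow> b + r *\<^sub>R b' \<notin> proj_vimage A"
proof -
  let ?V = "proj_vimage A"
  obtain x y where xy: "x \<in> ?V" "y \<in> ?V" "x + y \<notin> ?V"
    using ns unfolding subspace_def by (auto intro: proj_vimage_scaleR)
  define z where "z s = (1 - s) *\<^sub>R x + s *\<^sub>R y" for s :: real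
  have x0: "x \<noteq> 0" "y \<noteq> 0" using xy by auto
  have nz: "z s \<noteq> 0" for s
  proof
    assume z0: "z s = 0"
    have "\<exists>c. x = c *\<^sub>R y \<or> y = c *\<^sub>R x"
    proof (cases "s = 0")
      case False
      have "s *\<^sub>R y = - ((1 - s) *\<^sub>R x)" using z0 unfolding z_def by (simp add: add_eq_0_iff)
      then have "inverse s *\<^sub>R s *\<^sub>R y = inverse s *\<^sub>R (- (1 - s)) *\<^sub>R x" by (simp only: scaleR_minus_left)
      then have "y = (inverse s * - (1 - s)) *\<^sub>R x" using False by simp
      then show ?thesis by blast
    qed (use z0 x0 in \<open>auto simp: z_def\<close>)
    then have "\<exists>c. x + y = c *\<^sub>R y \<or> x + y = c *\<^sub>R x"
      by (metis add.commute scaleR_left_distrib scaleR_one)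
    then show False using xy proj_vimage_scaleR by metis
  qed
  define S where "S = {s. z s \<in> ?V}"
  have "closed S"
  proof -
    have "continuous_on UNIV (\<lambda>s. abs_projective (z s))"
      by (rule continuous_on_compose2[OF continuous_on_abs_projective])
        (use nz in \<open>auto simp: z_def intro!: continuous_intros\<close>)
    then have "closed ((\<lambda>s. abs_projective (z s)) -` A)" using A by (simp add: continuous_on_closed_vimage)
    also have "(\<lambda>s. abs_projective (z s)) -` A = S" unfolding S_def using nz by (auto simp: proj_vimage_iff)
    finally show ?thesis .
  qed
  have half: "1/2 \<notin> S"
  proof
    assume "1/2 \<in> S"
    then have "2 *\<^sub>R z (1/2) \<in> ?V" unfolding S_def using proj_vimage_scaleR by blast
    then show False using xy by (simp add: z_def scaleR_add_right)
  qed
  have "0 \<in> S" "1 \<in> S" unfolding S_def z_def using xy by simp_all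
  define s where "s = Sup (S \<inter> {0..1/2})"
  define t where "t = Inf (S \<inter> {1/2..1})"
  have s: "s \<in> S \<inter> {0..1/2}" unfolding s_def
    using \<open>closed S\<close> \<open>0 \<in> S\<close> by (intro closed_contains_Sup closed_Int) auto
  have t: "t \<in> S \<inter> {1/2..1}" unfolding t_def
    using \<open>closed S\<close> \<open>1 \<in> S\<close> by (intro closed_contains_Inf closed_Int) auto
  have gap: "\<tau> \<notin> S" if "s < \<tau>" "\<tau> < t" for \<tau>
  proof
    assume "\<tau> \<in> S"
    show False
    proof (cases "\<tau> \<le> 1/2")
      case True
      then have "\<tau> \<in> S \<inter> {0..1/2}" using \<open>\<tau> \<in> S\<close> s that by auto
      then have "\<tau> \<le> s" unfolding s_def by (intro cSup_upper) auto
      then show False using that by simp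
    next
      case False
      then have "\<tau> \<in> S \<inter> {1/2..1}" using \<open>\<tau> \<in> S\<close> t that by auto
      then have "t \<le> \<tau>" unfolding t_def by (intro cInf_lower) auto
      then show False using that by simp
    qed
  qed
  have "s \<noteq> 1/2" "t \<noteq> 1/2" using s t half by blast+
  then have st: "s < 1/2" "1/2 < t" using s t by auto
  show ?thesis
  proof (rule that[of "z s" "z t"])
    show "z s \<noteq> 0" "z t \<noteq> 0" by (rule nz)+
    show "z s \<in> ?V" "z t \<in> ?V" using s t unfolding S_def by auto
    fix r :: real assume r: "0 < r"
    \<comment> \<open>\<open>b + r b'\<close> is a multiple of the point with parameter \<open>\<tau>\<close>,
      which lies in the gap.\<close>
    define \<tau> where "\<tau> = (s + r * t) / (1 + r)"
    have "s < \<tau>" "\<tau> < t" unfolding \<tau>_def using r st by (auto simp: field_simps)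
    then have "z \<tau> \<notin> ?V" using gap unfolding S_def by blast
    moreover have "z \<tau> = inverse (1 + r) *\<^sub>R (z s + r *\<^sub>R z t)"
    proof -
      have c: "(1 + r) * (1 - \<tau>) = (1 - s) + r * (1 - t)" "(1 + r) * \<tau> = s + r * t"
        unfolding \<tau>_def using r by (auto simp: field_simps)
      have "(1 + r) *\<^sub>R z \<tau> = ((1 + r) * (1 - \<tau>)) *\<^sub>R x + ((1 + r) * \<tau>) *\<^sub>R y"
        unfolding z_def by (simp add: scaleR_add_right)
      also have "\<dots> = z s + r *\<^sub>R z t"
        unfolding c z_def by (simp add: algebra_simps)
      finally have "(1 + r) *\<^sub>R z \<tau> = z s + r *\<^sub>R z t" .
      then have "inverse (1 + r) *\<^sub>R (1 + r) *\<^sub>R z \<tau> = inverse (1 + r) *\<^sub>R (z s + r *\<^sub>R z t)" by simp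
      then show ?thesis using r by simp
    qed
    ultimately show "z s + r *\<^sub>R z t \<notin> ?V" using proj_vimage_scaleR by metis
  qed
qed

section \<open>Random closed sets\<close>

lemma compact_UNIV_countable_dense:
  assumes "compact (UNIV :: 'x::metric_space set)"
  obtains Q :: "'x::metric_space set" where "countable Q" "\<And>x e. 0 < e \<Longrightarrow> \<exists>q\<in>Q. dist x q < e"
proof -
  have "\<forall>n::nat. \<exists>k. finite k \<and> UNIV \<subseteq> (\<Union>x\<in>k. ball (x::'x) (inverse (real (Suc n))))"
    using seq_compact_imp_totally_bounded[OF compact_imp_seq_compact[OF assms]] by auto
  from choice[OF this] obtain k :: "nat \<Rightarrow> 'x set"
    where k: "\<And>n. finite (k n)" "\<And>n. UNIV \<subseteq> (\<Union>x\<in>k n. ball x (inverse (real (Suc n))))" by auto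
  show ?thesis
  proof (rule that[of "\<Union>n. k n"])
    show "countable (\<Union>n. k n)" using k(1) by (simp add: countable_finite)
    fix x :: 'x and e :: real assume "0 < e"
    then obtain n where n: "inverse (real (Suc n)) < e" using reals_Archimedean by blast
    obtain q where "q \<in> k n" "x \<in> ball q (inverse (real (Suc n)))" using k(2)[of n] by blast
    then show "\<exists>q\<in>\<Union>n. k n. dist x q < e"
      using n by (intro bexI[of _ q]) (auto simp: dist_commute)
  qed
qed

text \<open>
  That \<open>x\<close> has distance less than \<open>\<rho>\<close> from the fibre is witnessed
  by a point of a countable dense set and a rational radius. This writes the enlargement as a
  countable union of rectangles whose second factors are projections.
\<close>

lemma enlargement_measurable:
  fixes D :: "('x::metric_space \<times> 'w) set"
  assumes X: "compact (UNIV :: 'x set)" and M: "complete_measure M" "finite_measure M"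
    and D: "D \<in> sets (borel \<Otimes>\<^sub>M M)"
  shows "{(x, \<omega>). \<exists>y. (y, \<omega>) \<in> D \<and> dist x y < \<rho>} \<in> sets (borel \<Otimes>\<^sub>M M)" (is "?E \<in> _")
proof -
  obtain Q :: "'x set" where Q: "countable Q" "\<And>x e. 0 < e \<Longrightarrow> \<exists>q\<in>Q. dist x q < e"
    using compact_UNIV_countable_dense[OF X] by blast
  have D_space: "D \<subseteq> UNIV \<times> space M"
    using sets.sets_into_space[OF D] by (simp add: space_pair_measure)
  let ?R = "\<lambda>q s. {x. dist x q < s} \<times> snd ` (D \<inter> {y. dist q y < \<rho> - s} \<times> space M)"
  have "?E = (\<Union>q\<in>Q. \<Union>s\<in>\<rat>. ?R q s)"
  proof (intro equalityI subsetI)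
    fix p assume "p \<in> ?E"
    then obtain x \<omega> y where p: "p = (x, \<omega>)" "(y, \<omega>) \<in> D" "dist x y < \<rho>" by blast
    define e where "e = (\<rho> - dist x y) / 4"
    have "0 < e" using p unfolding e_def by simp
    then obtain q where q: "q \<in> Q" "dist x q < e" using Q(2) by blast
    obtain s where s: "s \<in> \<rat>" "e < s" "s < 2 * e" using Rats_dense_in_real[of e "2 * e"] \<open>0 < e\<close> by auto
    have "dist q y \<le> dist x q + dist x y" by (metis dist_commute dist_triangle2 add.commute)
    then have "dist q y < \<rho> - s" using q s unfolding e_def by (simp add: field_simps)
    then have "p \<in> ?R q s" using p q s D_space by force
    then show "p \<in> (\<Union>q\<in>Q. \<Union>s\<in>\<rat>. ?R q s)" using q s by blast
  next
    fix p assume "p \<in> (\<Union>q\<in>Q. \<Union>s\<in>\<rat>. ?R q s)"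
    then obtain q s where "p \<in> ?R q s" by blast
    then obtain x \<omega> y where p: "p = (x, \<omega>)" "dist x q < s" "(y, \<omega>) \<in> D" "dist q y < \<rho> - s" by auto
    then have "dist x y < \<rho>" using dist_triangle[of x y q] by linarith
    then show "p \<in> ?E" using p by blast
  qed
  moreover have "?R q s \<in> sets (borel \<Otimes>\<^sub>M M)" for q s
  proof (rule pair_measureI)
    have "open {x. dist x q < s}" "open {y. dist q y < \<rho> - s}" 
      by (intro open_Collect_less continuous_intros)+
    then show "{x. dist x q < s} \<in> sets borel" "snd ` (D \<inter> {y. dist q y < \<rho> - s} \<times> space M) \<in> sets M"
      by (auto intro!: measurable_projection[OF X M] sets.Int[OF D] pair_measureI)
  qed
  ultimately show ?thesis
    using Q(1) countable_rat by (auto intro!: sets.countable_UN'')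
qed

text \<open>
  The points whose distance from the complement of \<open>U\<close> is at least
  \<open>1 / (m + 1)\<close>. As \<open>m\<close> grows, these closed random sets exhaust an
  open random set in such a way that every compact subset of a fibre is eventually contained in
  them.
\<close>

definition shrink :: "'w measure \<Rightarrow> ('x::metric_space \<times> 'w) set \<Rightarrow> nat \<Rightarrow> ('x \<times> 'w) set" where
  "shrink M U m = {(x, \<omega>). \<omega> \<in> space M \<and> ball x (inverse (real (Suc m))) \<subseteq> fibre U \<omega>}"

lemma shrink_subset: "shrink M U m \<subseteq> U"
proof
  fix p assume "p \<in> shrink M U m"
  moreover obtain x \<omega> where p: "p = (x, \<omega>)" by (cases p)
  moreover have "x \<in> ball x (inverse (real (Suc m)))" by simp
  ultimately show "p \<in> U" unfolding shrink_def fibre_def by blast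
qed

text \<open>
  The complement is an enlargement of the complement of \<open>U\<close>.
\<close>

lemma closed_random_set_shrink:
  fixes U :: "('x::metric_space \<times> 'w) set"
  assumes X: "compact (UNIV :: 'x set)" and M: "complete_measure M" "finite_measure M"
    and U: "random_set M U"
  shows "closed_random_set M (shrink M U m)"
  unfolding closed_random_set_def
proof (intro conjI ballI)
  let ?D = "UNIV \<times> space M - U" and ?\<rho> = "inverse (real (Suc m))"
  let ?E = "{(x, \<omega>). \<exists>y. (y, \<omega>) \<in> ?D \<and> dist x y < ?\<rho>}"
  have "?D \<in> sets (borel \<Otimes>\<^sub>M M)"
    using U unfolding random_set_def by (intro sets.Diff pair_measureI) auto
  then have "?E \<in> sets (borel \<Otimes>\<^sub>M M)" by (rule enlargement_measurable[OF X M])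
  then have "UNIV \<times> space M - ?E \<in> sets (borel \<Otimes>\<^sub>M M)"
    by (intro sets.Diff pair_measureI) auto
  also have "UNIV \<times> space M - ?E = shrink M U m"
    unfolding shrink_def fibre_def by (auto simp: subset_iff)
  finally show "random_set M (shrink M U m)" unfolding random_set_def .
  fix \<omega> assume w: "\<omega> \<in> space M"
  have "fibre (shrink M U m) \<omega> = (\<Inter>y\<in>- fibre U \<omega>. {x. ?\<rho> \<le> dist x y})"
  proof (intro set_eqI)
    fix x
    have "x \<in> fibre (shrink M U m) \<omega> \<longleftrightarrow> (\<forall>y. dist x y < ?\<rho> \<longrightarrow> y \<in> fibre U \<omega>)"
      using w unfolding shrink_def by (simp add: subset_iff fibre_def)
    also have "\<dots> \<longleftrightarrow> x \<in> (\<Inter>y\<in>- fibre U \<omega>. {x. ?\<rho> \<le> dist x y})"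
      by (auto simp del: of_nat_Suc simp: not_le[symmetric])
    finally show "x \<in> fibre (shrink M U m) \<omega> \<longleftrightarrow> x \<in> (\<Inter>y\<in>- fibre U \<omega>. {x. ?\<rho> \<le> dist x y})" .
  qed
  moreover have "closed {x. ?\<rho> \<le> dist x y}" for y :: 'x
    by (intro closed_Collect_le continuous_intros)
  ultimately show "closed (fibre (shrink M U m) \<omega>)" by auto
qed

lemma compact_subset_shrink:
  assumes w: "\<omega> \<in> space M" and "open (fibre U \<omega>)" "compact K" "K \<subseteq> fibre U \<omega>"
  obtains m where "K \<subseteq> fibre (shrink M U m) \<omega>"
proof -
  obtain d where d: "d > 0" "\<And>x. x \<in> K \<Longrightarrow> \<exists>V\<in>{fibre U \<omega>}. ball x d \<subseteq> V"
    using Heine_Borel_lemma[of K "{fibre U \<omega>}"] assms by auto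
  obtain m where m: "inverse (real (Suc m)) < d" using reals_Archimedean d(1) by blast
  have "K \<subseteq> fibre (shrink M U m) \<omega>"
  proof
    fix x assume "x \<in> K"
    then have "ball x (inverse (real (Suc m))) \<subseteq> fibre U \<omega>"
      using d(2) subset_ball[OF less_imp_le[OF m], of x] by blast
    then have "(x, \<omega>) \<in> shrink M U m" using w unfolding shrink_def by blast
    then show "x \<in> fibre (shrink M U m) \<omega>" unfolding fibre_def by blast
  qed
  then show ?thesis by (rule that)
qed

lemma fibre_inclusion_measurable:
  fixes A B :: "('x::metric_space \<times> 'w) set"
  assumes X: "compact (UNIV :: 'x set)" and M: "complete_measure M" "finite_measure M"
    and "random_set M A" "random_set M B"
  shows "{\<omega> \<in> space M. fibre A \<omega> \<subseteq> fibre B \<omega>} \<in> sets M"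
proof -
  have "A - B \<in> sets (borel \<Otimes>\<^sub>M M)" using assms unfolding random_set_def by auto
  then have "snd ` (A - B) \<in> sets M" by (rule measurable_projection[OF X M])
  moreover have "{\<omega> \<in> space M. fibre A \<omega> \<subseteq> fibre B \<omega>} = space M - snd ` (A - B)"
    unfolding fibre_def by force
  ultimately show ?thesis by simp
qed

lemma semidist_nonneg: "0 \<le> semidist P Q"
proof (cases "P = {} \<or> Q = {}")
  case False
  then obtain a where "a \<in> P" by blast
  have "0 \<le> (INF b\<in>Q. ereal (dist a b))" by (intro INF_greatest) simp
  also have "\<dots> \<le> (SUP a\<in>P. INF b\<in>Q. ereal (dist a b))" using \<open>a \<in> P\<close> by (rule SUP_upper)
  finally show ?thesis using False unfolding semidist_def by simp
qed (auto simp: semidist_def)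

lemma semidist_mono: "P \<subseteq> P' \<Longrightarrow> semidist P Q \<le> semidist P' Q"
  using semidist_nonneg[of P' Q] by (cases "P = {}") (auto simp: semidist_def intro!: SUP_subset_mono)

lemma semidist_leD:
  assumes "semidist P Q \<le> ereal \<delta>" "\<delta> < e" "p \<in> P"
  obtains q where "q \<in> Q" "dist p q < e"
proof -
  have ne: "P \<noteq> {}" "Q \<noteq> {}" using assms unfolding semidist_def by (auto split: if_splits)
  have "(INF q\<in>Q. ereal (dist p q)) \<le> semidist P Q"
    unfolding semidist_def using ne assms(3) by (auto intro: SUP_upper)
  also have "\<dots> < ereal e" using assms(1,2) by (metis ereal_less_eq(3) less_ereal.simps(1) order.strict_trans1)
  finally have "(INF q\<in>Q. ereal (dist p q)) < ereal e" .
  then obtain q where "q \<in> Q" "ereal (dist p q) < ereal e" unfolding INF_less_iff by blast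
  then show ?thesis by (intro that) auto
qed

section \<open>Recurrence and good times\<close>

context prob_space
begin

text \<open>
  Diagonal choice of times: at the \<open>k\<close>-th time the first \<open>k\<close> families
  have outer measure below \<open>2\<^sup>-\<^sup>k\<close>, and the Borel-Cantelli lemma
  applies to measurable envelopes.
\<close>

lemma null_along_subsequence:
  fixes Bad :: "'i::countable \<Rightarrow> nat \<Rightarrow> 'a set"
  assumes space: "\<And>i t. Bad i t \<subseteq> space M"
    and lim: "\<And>i. (\<lambda>t. outer_measure_of M (Bad i t)) \<longlonglongrightarrow> 0"
  obtains r :: "nat \<Rightarrow> nat" where
    "AE \<omega> in M. \<forall>i. \<forall>\<^sub>F k in sequentially. \<omega> \<notin> Bad i (r k)"
proof -
  have "\<exists>t. \<forall>i. to_nat i \<le> k \<longrightarrow> outer_measure_of M (Bad i t) < ennreal ((1/2)^k)" for k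
  proof -
    have "finite (to_nat -` {..k} :: 'i set)" by (intro finite_vimageI inj_to_nat) simp
    moreover have "\<forall>\<^sub>F t in sequentially. outer_measure_of M (Bad i t) < ennreal ((1/2)^k)" for i
      using lim[of i] by (rule order_tendstoD) simp
    ultimately have "\<forall>\<^sub>F t in sequentially. \<forall>i\<in>to_nat -` {..k}. outer_measure_of M (Bad i t) < ennreal ((1/2)^k)"
      by (intro eventually_ball_finite) auto
    then obtain t where "\<forall>i\<in>to_nat -` {..k}. outer_measure_of M (Bad i t) < ennreal ((1/2)^k)"
      using eventually_happens' sequentially_bot by blast
    then show ?thesis by auto
  qed
  then have "\<forall>k. \<exists>t. \<forall>i. to_nat i \<le> k \<longrightarrow> outer_measure_of M (Bad i t) < ennreal ((1/2)^k)" by blast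
  from choice[OF this] obtain r where r: "\<And>k i. to_nat i \<le> k \<Longrightarrow> outer_measure_of M (Bad i (r k)) < ennreal ((1/2)^k)" by blast
  have "AE \<omega> in M. \<forall>\<^sub>F k in sequentially. \<omega> \<notin> Bad i (r k)" for i
  proof -
    have "\<forall>k. \<exists>E. E \<in> sets M \<and> Bad i (r k) \<subseteq> E \<and> outer_measure_of M (Bad i (r k)) = emeasure M E"
      using outer_measure_of_attain[OF space] by blast
    from choice[OF this] obtain E where E: "\<And>k. E k \<in> sets M" "\<And>k. Bad i (r k) \<subseteq> E k"
      "\<And>k. outer_measure_of M (Bad i (r k)) = emeasure M (E k)" by blast
    define E' where "E' k = (if to_nat i \<le> k then E k else {})" for k
    have E'_sets: "E' k \<in> sets M" for k using E(1) unfolding E'_def by simp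
    have meas: "measure M (E' k) \<le> (1/2)^k" for k
    proof (cases "to_nat i \<le> k")
      case True
      then have "emeasure M (E k) < ennreal ((1/2)^k)" using r[OF True] E(3) by simp
      then show ?thesis unfolding E'_def using True by (simp add: emeasure_eq_measure ennreal_less_iff)
    qed (simp add: E'_def)
    have "summable (\<lambda>k. measure M (E' k))"
      by (rule summable_comparison_test'[of "\<lambda>k. (1/2)^k" 0]) (use meas in \<open>auto intro!: summable_geometric\<close>)
    then have "AE \<omega> in M. \<forall>\<^sub>F k in sequentially. \<omega> \<in> space M - E' k"
      using E'_sets by (intro borel_cantelli_AE1) (auto simp: less_top[symmetric])
    then show ?thesis
    proof (rule AE_mp, intro AE_I2 impI)
      fix \<omega> assume "\<forall>\<^sub>F k in sequentially. \<omega> \<in> space M - E' k"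
      then show "\<forall>\<^sub>F k in sequentially. \<omega> \<notin> Bad i (r k)"
        using eventually_ge_at_top[of "to_nat i"]
        by eventually_elim (use E(2) in \<open>auto simp: E'_def\<close>)
    qed
  qed
  then have "AE \<omega> in M. \<forall>i. \<forall>\<^sub>F k in sequentially. \<omega> \<notin> Bad i (r k)" by (simp add: AE_all_countable)
  then show ?thesis by (rule that)
qed

end

context ergodic_base
begin

lemma nat_in_T [simp]: "real n \<in> T"
  using time_set by auto

lemma minus_in_T [simp]: "t \<in> T \<Longrightarrow> - t \<in> T"
  using time_set by auto

lemma add_in_T [simp]: "t \<in> T \<Longrightarrow> s \<in> T \<Longrightarrow> t + s \<in> T"
  using time_set by auto

lemma diff_in_T [simp]: "t \<in> T \<Longrightarrow> s \<in> T \<Longrightarrow> t - s \<in> T"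
  using time_set by auto

lemma theta_space [simp]: "t \<in> T \<Longrightarrow> \<omega> \<in> space M \<Longrightarrow> \<theta> t \<omega> \<in> space M"
  by (rule measurable_space[OF theta_measurable])

lemma theta_minus [simp]: "t \<in> T \<Longrightarrow> \<omega> \<in> space M \<Longrightarrow> \<theta> (- t) (\<theta> t \<omega>) = \<omega>"
  using theta_add[of "- t" t \<omega>] theta_zero by simp

lemma theta_minus' [simp]: "t \<in> T \<Longrightarrow> \<omega> \<in> space M \<Longrightarrow> \<theta> t (\<theta> (- t) \<omega>) = \<omega>"
  using theta_minus[of "- t" \<omega>] by simp

lemma emeasure_theta_vimage:
  assumes "t \<in> T" "S \<in> sets M"
  shows "emeasure M (\<theta> t -` S \<inter> space M) = emeasure M S"
  using emeasure_distr[OF theta_measurable[OF assms(1)] assms(2)] theta_preserving[OF assms(1)] by simp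

lemma outer_measure_theta_vimage_le:
  assumes t: "t \<in> T" and S: "S \<subseteq> space M"
  shows "outer_measure_of M {\<omega> \<in> space M. \<theta> t \<omega> \<in> S} \<le> outer_measure_of M S"
proof -
  obtain E where E: "E \<in> sets M" "S \<subseteq> E" "outer_measure_of M S = emeasure M E"
    using outer_measure_of_attain[OF S] by blast
  have "outer_measure_of M {\<omega> \<in> space M. \<theta> t \<omega> \<in> S} \<le> outer_measure_of M (\<theta> t -` E \<inter> space M)"
    using E(2) by (intro outer_measure_of_mono) auto
  also have "\<dots> = emeasure M E"
    using emeasure_theta_vimage[OF t E(1)] measurable_sets[OF theta_measurable[OF t] E(1)] by simp
  finally show ?thesis using E(3) by simp
qed

text \<open>
  At each time \<open>s k\<close> the event \<open>\<theta> (s k) \<omega> \<in> G m\<close> has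
  the same probability as \<open>G m\<close>. So the event that it fails from some time on has
  probability at most that of the complement of \<open>G m\<close>, which tends to 0.
\<close>

lemma recurrence:
  fixes s :: "nat \<Rightarrow> real"
  assumes G: "\<And>m. G m \<in> sets M" "incseq G" "AE \<omega> in M. \<exists>m. \<omega> \<in> G m" and s: "\<And>k. s k \<in> T"
  shows "AE \<omega> in M. \<exists>m. \<exists>\<^sub>F k in sequentially. \<theta> (s k) \<omega> \<in> G m"
proof -
  define L where "L m k = \<theta> (s k) -` (space M - G m) \<inter> space M" for m k
  define H where "H m j = (\<Inter>k\<in>{j..}. L m k)" for m j
  have L_sets: "L m k \<in> sets M" for m k
    unfolding L_def using G(1) by (intro measurable_sets[OF theta_measurable[OF s]]) auto
  have H_sets: "H m j \<in> sets M" for m j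
    unfolding H_def using L_sets by (intro sets.countable_INT') auto
  have "emeasure M (\<Union>j. H m j) \<le> emeasure M (space M - G m)" for m
  proof -
    have "emeasure M (H m j) \<le> emeasure M (space M - G m)" for j
    proof -
      have "emeasure M (H m j) \<le> emeasure M (L m j)"
        unfolding H_def by (intro emeasure_mono L_sets) auto
      also have "\<dots> = emeasure M (space M - G m)"
        unfolding L_def using G(1) by (intro emeasure_theta_vimage[OF s]) auto
      finally show ?thesis .
    qed
    moreover have "incseq (H m)" unfolding H_def incseq_def by auto
    ultimately show ?thesis
      using H_sets by (subst SUP_emeasure_incseq[symmetric]) (auto intro: SUP_least)
  qed
  define N where "N = (\<Inter>m. \<Union>j. H m j)"
  have N_sets: "N \<in> sets M" unfolding N_def using H_sets by auto
  have "emeasure M N \<le> emeasure M (space M - G m)" for m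
  proof -
    have "emeasure M N \<le> emeasure M (\<Union>j. H m j)"
      unfolding N_def using H_sets by (intro emeasure_mono) auto
    then show ?thesis using \<open>\<And>m. emeasure M (\<Union>j. H m j) \<le> emeasure M (space M - G m)\<close> order_trans by blast
  qed
  then have "emeasure M N \<le> (INF m. emeasure M (space M - G m))" by (intro INF_greatest)
  also have "\<dots> = emeasure M (\<Inter>m. space M - G m)"
    using G(1,2) by (intro INF_emeasure_decseq) (auto simp: decseq_def incseq_def)
  also have "\<dots> = 0"
  proof -
    have "AE \<omega> in M. \<omega> \<notin> (\<Inter>m. space M - G m)" using G(3) by eventually_elim auto
    then show ?thesis using G(1) by (intro AE_iff_measurable[THEN iffD1, rotated 2]) auto
  qed
  finally have "N \<in> null_sets M" using N_sets by (auto simp: null_setsI)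
  then have "AE \<omega> in M. \<omega> \<notin> N" by (rule AE_not_in)
  then show ?thesis
  proof (rule AE_mp, intro AE_I2 impI)
    fix \<omega> assume w: "\<omega> \<in> space M" "\<omega> \<notin> N"
    show "\<exists>m. \<exists>\<^sub>F k in sequentially. \<theta> (s k) \<omega> \<in> G m"
    proof (rule ccontr)
      assume "\<not> ?thesis"
      then have *: "\<forall>m. \<exists>j. \<forall>k\<ge>j. \<theta> (s k) \<omega> \<notin> G m" unfolding frequently_def eventually_sequentially by simp
      have "\<omega> \<in> (\<Union>j. H m j)" for m
      proof -
        obtain j where "\<forall>k\<ge>j. \<theta> (s k) \<omega> \<notin> G m" using * by blast
        then have "\<omega> \<in> H m j" using w(1) s unfolding H_def L_def by auto
        then show ?thesis by blast
      qed
      then show False using w(2) unfolding N_def by blast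
    qed
  qed
qed

end

context linear_rds
begin

abbreviation \<phi> where "\<phi> \<equiv> projectivisation \<Phi>"

lemma invertible_Phi:
  assumes "t \<in> T" "\<omega> \<in> space M"
  shows "invertible (\<Phi> t \<omega>)"
proof -
  have "\<Phi> (- t) (\<theta> t \<omega>) ** \<Phi> t \<omega> = mat 1"
    using cocycle_add[of "- t" t \<omega>] cocycle_zero assms by simp
  then show ?thesis using invertible_left_inverse by blast
qed

lemma phi_abs_projective:
  "t \<in> T \<Longrightarrow> \<omega> \<in> space M \<Longrightarrow> x \<noteq> 0 \<Longrightarrow> \<phi> t \<omega> (abs_projective x) = abs_projective (\<Phi> t \<omega> *v x)"
  unfolding projectivisation_def by (intro proj_map_abs_projective invertible_Phi)

lemma phi_zero: "\<omega> \<in> space M \<Longrightarrow> \<phi> 0 \<omega> p = p"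
proof -
  assume w: "\<omega> \<in> space M"
  obtain x where x: "norm x = 1" "p = abs_projective x" by (rule projective_cases)
  then have "x \<noteq> 0" by auto
  then show ?thesis
    using phi_abs_projective[of 0 \<omega> x] nat_in_T[of 0] w unfolding x(2) by (simp add: cocycle_zero)
qed

lemma phi_add:
  assumes "t \<in> T" "s \<in> T" "\<omega> \<in> space M"
  shows "\<phi> (t + s) \<omega> p = \<phi> t (\<theta> s \<omega>) (\<phi> s \<omega> p)"
proof -
  obtain x where x: "norm x = 1" "p = abs_projective x" by (rule projective_cases)
  then have "x \<noteq> 0" "\<Phi> s \<omega> *v x \<noteq> 0" using assms by (auto simp: invertible_mult_eq_0[OF invertible_Phi])
  then show ?thesis
    unfolding x using assms by (simp add: phi_abs_projective cocycle_add matrix_vector_mul_assoc)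
qed

lemma phi_minus:
  "t \<in> T \<Longrightarrow> \<omega> \<in> space M \<Longrightarrow> \<phi> (- t) (\<theta> t \<omega>) (\<phi> t \<omega> p) = p"
  using phi_add[of "- t" t \<omega> p] phi_zero by simp

lemma phi_minus':
  "t \<in> T \<Longrightarrow> \<omega> \<in> space M \<Longrightarrow> \<phi> t (\<theta> (- t) \<omega>) (\<phi> (- t) \<omega> p) = p"
  using phi_minus[of "- t" \<omega> p] by simp

lemma continuous_phi: "t \<in> T \<Longrightarrow> \<omega> \<in> space M \<Longrightarrow> continuous_on UNIV (\<phi> t \<omega>)"
  unfolding projectivisation_def by (intro continuous_on_proj_map invertible_Phi)

lemmas projection_hypotheses = compact_UNIV_projective complete_measure_axioms finite_measure_axioms

text \<open>
  An attractor-repeller pair together with the neighbourhood that defines its repeller. Keeping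
  \<open>U\<close> explicit avoids discussing how the repeller depends on it.
\<close>

definition pair where
  "pair A R U \<longleftrightarrow> compact_random_set M A \<and> invariant M T \<theta> \<phi> A \<and>
    attractor_neighbourhood M T \<theta> \<phi> A U \<and> R = UNIV \<times> space M - basin M T \<theta> \<phi> U"

lemma pairD:
  assumes "pair A R U"
  shows "random_set M A" "random_set M U" "AE \<omega> in M. fibre A \<omega> \<subseteq> fibre U \<omega>"
    "\<And>\<omega>. \<omega> \<in> space M \<Longrightarrow> compact (fibre A \<omega>)" "\<And>\<omega>. \<omega> \<in> space M \<Longrightarrow> open (fibre U \<omega>)"
    "\<And>t \<omega>. t \<in> T \<Longrightarrow> \<omega> \<in> space M \<Longrightarrow> fibre A (\<theta> t \<omega>) = \<phi> t \<omega> ` fibre A \<omega>"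
    "\<And>t \<omega>. t \<in> T \<Longrightarrow> 0 \<le> t \<Longrightarrow> \<omega> \<in> space M \<Longrightarrow> \<phi> t \<omega> ` fibre U \<omega> \<subseteq> fibre U (\<theta> t \<omega>)"
  using assms unfolding pair_def attractor_neighbourhood_def compact_random_set_def
    open_random_set_def invariant_def forward_invariant_def by auto

lemma pair_attraction:
  assumes "pair A R U"
  shows "((\<lambda>t. outer_measure_of M {\<omega> \<in> space M.
      semidist (\<phi> t \<omega> ` fibre (shrink M U j) \<omega>) (fibre A (\<theta> t \<omega>)) > ereal (inverse (real (Suc l)))})
    \<longlongrightarrow> 0) (inf at_top (principal T))"
proof -
  have "closed_random_set M (shrink M U j)"
    by (intro closed_random_set_shrink projection_hypotheses pairD[OF assms])
  then show ?thesis
    using assms shrink_subset[of M U j] unfolding pair_def attractor_neighbourhood_def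
    by (auto simp del: of_nat_Suc)
qed

text \<open>
  The sets of points that have entered \<open>U\<close> by an integer time are open and increase
  with time, as \<open>U\<close> is forward invariant; a compact subset of the basin is
  contained in one of them.
\<close>

lemma compact_reaches_shrink:
  assumes P: "pair A R U" and w: "\<omega> \<in> space M" and K: "compact K" "K \<inter> fibre R \<omega> = {}"
  obtains n j where "\<phi> (real n) \<omega> ` K \<subseteq> fibre (shrink M U j) (\<theta> (real n) \<omega>)"
proof -
  define W where "W n = \<phi> (real n) \<omega> -` fibre U (\<theta> (real n) \<omega>)" for n
  have "open (W n)" for n
    unfolding W_def using w by (intro open_vimage continuous_phi pairD(5)[OF P]) auto
  have later: "\<phi> s \<omega> x \<in> fibre U (\<theta> s \<omega>)" if "\<phi> t \<omega> x \<in> fibre U (\<theta> t \<omega>)" "t \<le> s" "t \<in> T" "s \<in> T" for t s x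
  proof -
    have "\<phi> (s - t) (\<theta> t \<omega>) (\<phi> t \<omega> x) \<in> fibre U (\<theta> (s - t) (\<theta> t \<omega>))"
      using pairD(7)[OF P, of "s - t" "\<theta> t \<omega>"] that w by auto
    then show ?thesis
      using phi_add[of "s - t" t \<omega> x] theta_add[of "s - t" t \<omega>] that w by simp
  qed
  have "K \<subseteq> (\<Union>n. W n)"
  proof
    fix x assume "x \<in> K"
    then have "(x, \<omega>) \<in> basin M T \<theta> \<phi> U" using K(2) P w unfolding pair_def fibre_def by auto
    then obtain t where t: "t \<in> T" "\<phi> t \<omega> x \<in> fibre U (\<theta> t \<omega>)" unfolding basin_def by auto
    obtain n :: nat where "t \<le> real n" using real_arch_simple by blast
    then have "x \<in> W n" unfolding W_def using later[OF t(2)] t(1) by simp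
    then show "x \<in> (\<Union>n. W n)" by blast
  qed
  then obtain I where I: "finite I" "K \<subseteq> (\<Union>n\<in>I. W n)"
    using compactE_image[OF K(1), of UNIV W] \<open>\<And>n. open (W n)\<close> by (metis subset_UNIV)
  obtain n where n: "\<forall>i\<in>I. i \<le> n" using I(1) unfolding finite_nat_set_iff_bounded_le by blast
  have "W i \<subseteq> W n" if "i \<in> I" for i
    using later[of "real i" _ "real n"] n that unfolding W_def by auto
  then have "K \<subseteq> W n" using I(2) by blast
  then have "\<phi> (real n) \<omega> ` K \<subseteq> fibre U (\<theta> (real n) \<omega>)" unfolding W_def by blast
  moreover have "compact (\<phi> (real n) \<omega> ` K)"
    using w by (intro compact_continuous_image K continuous_on_subset[OF continuous_phi]) auto
  ultimately obtain j where "\<phi> (real n) \<omega> ` K \<subseteq> fibre (shrink M U j) (\<theta> (real n) \<omega>)"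
    using compact_subset_shrink[of "\<theta> (real n) \<omega>" M U] pairD(5)[OF P] w by (metis nat_in_T theta_space)
  then show ?thesis by (rule that)
qed

text \<open>
  Two pairs, indexed by \<open>bool\<close>, have to be treated simultaneously because the
  comparison of two attractors needs a common time. The index \<open>m\<close> does not depend
  on the compact sets; this allows choosing these sets after the distance that
  \<open>G m\<close> provides.

  The sets \<open>K b\<close> have entered closed random subsets of \<open>U b\<close> by some
  time \<open>n\<close>, and those are attracted in probability. Only countably many closed
  random sets are involved, so one sequence of times serves all of them.
\<close>

lemma forward_good_times:
  fixes A R U :: "bool \<Rightarrow> ('n projective \<times> 'w) set"
  assumes P: "\<And>b. pair (A b) (R b) (U b)"
    and G: "\<And>m. G m \<in> sets M" "incseq G" "AE \<omega> in M. \<exists>m. \<omega> \<in> G m"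
  shows "AE \<omega> in M. \<exists>m. \<forall>K. (\<forall>b. compact (K b) \<and> K b \<inter> fibre (R b) \<omega> = {}) \<longrightarrow>
    (\<forall>\<delta>>0. \<exists>n::nat. \<theta> n \<omega> \<in> G m \<and> (\<forall>b. semidist (\<phi> n \<omega> ` K b) (fibre (A b) (\<theta> n \<omega>)) \<le> ereal \<delta>))"
proof -
  define far where "far b j l t = {\<omega> \<in> space M.
      semidist (\<phi> t \<omega> ` fibre (shrink M (U b) j) \<omega>) (fibre (A b) (\<theta> t \<omega>)) > ereal (inverse (real (Suc l)))}"
    for b j l t
  \<comment> \<open>Failure of attraction at time \<open>t\<close> for the \<open>j\<close>-th closed set at
    time \<open>n\<close>. The elapsed time is \<open>t - n\<close>, so that all families
    refer to the same final time \<open>t\<close>.\<close>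
  define Bad where "Bad i t = (case i of (b, n, j, l) \<Rightarrow>
    {\<omega> \<in> space M. \<theta> (real n) \<omega> \<in> far b j l (real t - real n)})" for i :: "bool \<times> nat \<times> nat \<times> nat" and t :: nat
  have lim: "(\<lambda>t. outer_measure_of M (Bad i t)) \<longlonglongrightarrow> 0" for i
  proof -
    obtain b n j l where i: "i = (b, n, j, l)" by (rule prod_cases4)
    have "filterlim (\<lambda>t. real t - real n) (inf at_top (principal T)) sequentially"
      unfolding filterlim_inf filterlim_principal
    proof
      show "filterlim (\<lambda>t. real t - real n) at_top sequentially"
        using filterlim_tendsto_add_at_top[OF tendsto_const[of "- real n"] filterlim_real_sequentially]
        by (simp add: add.commute)
    qed simp
    then have "(\<lambda>t. outer_measure_of M (far b j l (real t - real n))) \<longlonglongrightarrow> 0"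
      unfolding far_def by (rule filterlim_compose[OF pair_attraction[OF P]])
    moreover have le: "outer_measure_of M (Bad i t) \<le> outer_measure_of M (far b j l (real t - real n))" for t
      unfolding i Bad_def prod.case by (rule outer_measure_theta_vimage_le) (auto simp: far_def)
    ultimately show ?thesis
      using tendsto_sandwich[of "\<lambda>_. 0" "\<lambda>t. outer_measure_of M (Bad i t)" sequentially
        "\<lambda>t. outer_measure_of M (far b j l (real t - real n))" 0] by simp
  qed
  obtain r :: "nat \<Rightarrow> nat" where r:
    "AE \<omega> in M. \<forall>i. \<forall>\<^sub>F k in sequentially. \<omega> \<notin> Bad i (r k)"
  proof (rule null_along_subsequence[of Bad])
    show "Bad i t \<subseteq> space M" for i t unfolding Bad_def by (auto split: prod.splits)
  qed (use lim in auto)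
  have "AE \<omega> in M. \<exists>m. \<exists>\<^sub>F k in sequentially. \<theta> (real (r k)) \<omega> \<in> G m"
    by (rule recurrence[OF G]) simp
  with r AE_space show ?thesis
  proof eventually_elim
    fix \<omega> assume notbad: "\<forall>i. \<forall>\<^sub>F k in sequentially. \<omega> \<notin> Bad i (r k)" and w: "\<omega> \<in> space M"
      and "\<exists>m. \<exists>\<^sub>F k in sequentially. \<theta> (real (r k)) \<omega> \<in> G m"
    then obtain m where m: "\<exists>\<^sub>F k in sequentially. \<theta> (real (r k)) \<omega> \<in> G m" by (elim exE)
    show "\<exists>m. \<forall>K. (\<forall>b. compact (K b) \<and> K b \<inter> fibre (R b) \<omega> = {}) \<longrightarrow>
      (\<forall>\<delta>>0. \<exists>n::nat. \<theta> n \<omega> \<in> G m \<and> (\<forall>b. semidist (\<phi> n \<omega> ` K b) (fibre (A b) (\<theta> n \<omega>)) \<le> ereal \<delta>))"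
    proof (rule exI[of _ m], intro allI impI)
      fix K and \<delta> :: real assume K: "\<forall>b. compact (K b) \<and> K b \<inter> fibre (R b) \<omega> = {}" and "0 < \<delta>"
      have ev: "\<forall>\<^sub>F k in sequentially. semidist (\<phi> (r k) \<omega> ` K b) (fibre (A b) (\<theta> (r k) \<omega>)) \<le> ereal \<delta>" for b
      proof -
        obtain n j where nj: "\<phi> (real n) \<omega> ` K b \<subseteq> fibre (shrink M (U b) j) (\<theta> n \<omega>)"
          using compact_reaches_shrink[OF P w, of "K b"] K by blast
        obtain l where l: "inverse (real (Suc l)) < \<delta>" using reals_Archimedean \<open>0 < \<delta>\<close> by blast
        have "\<forall>\<^sub>F k in sequentially. \<omega> \<notin> Bad (b, n, j, l) (r k)" using notbad by blast
        then show ?thesis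
        proof eventually_elim
          case (elim k)
          let ?s = "real (r k) - real n"
          have sT: "?s \<in> T" and s_eq: "?s + real n = real (r k)" by simp_all
          have eq: "\<theta> (r k) \<omega> = \<theta> ?s (\<theta> n \<omega>)"
            using theta_add[OF sT nat_in_T w, of n] unfolding s_eq .
          have ph: "\<phi> (r k) \<omega> p = \<phi> ?s (\<theta> n \<omega>) (\<phi> n \<omega> p)" for p
            using phi_add[OF sT nat_in_T w, of n p] unfolding s_eq .
          have eq': "\<phi> (r k) \<omega> ` K b = \<phi> ?s (\<theta> n \<omega>) ` \<phi> n \<omega> ` K b"
            unfolding image_image by (rule image_cong[OF refl ph])
          have "semidist (\<phi> (r k) \<omega> ` K b) (fibre (A b) (\<theta> (r k) \<omega>)) \<le>
            semidist (\<phi> ?s (\<theta> n \<omega>) ` fibre (shrink M (U b) j) (\<theta> n \<omega>)) (fibre (A b) (\<theta> ?s (\<theta> n \<omega>)))"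
            unfolding eq eq' by (intro semidist_mono image_mono nj)
          also have "\<dots> \<le> ereal (inverse (real (Suc l)))"
            using elim w unfolding Bad_def far_def by (simp del: of_nat_Suc add: not_less)
          also have "\<dots> \<le> ereal \<delta>" using l by simp
          finally show ?case .
        qed
      qed
      have "\<forall>\<^sub>F k in sequentially. \<forall>b. semidist (\<phi> (r k) \<omega> ` K b) (fibre (A b) (\<theta> (r k) \<omega>)) \<le> ereal \<delta>"
        using ev by (intro eventually_all_finite) 
      then have "\<exists>\<^sub>F k in sequentially. \<theta> (real (r k)) \<omega> \<in> G m \<and>
          (\<forall>b. semidist (\<phi> (r k) \<omega> ` K b) (fibre (A b) (\<theta> (r k) \<omega>)) \<le> ereal \<delta>)"
        using m by (intro frequently_eventually_frequently)
      then obtain k where "\<theta> (real (r k)) \<omega> \<in> G m \<and>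
          (\<forall>b. semidist (\<phi> (r k) \<omega> ` K b) (fibre (A b) (\<theta> (r k) \<omega>)) \<le> ereal \<delta>)"
        by (rule exE[OF frequently_ex])
      then show "\<exists>n::nat. \<theta> n \<omega> \<in> G m \<and> (\<forall>b. semidist (\<phi> n \<omega> ` K b) (fibre (A b) (\<theta> n \<omega>)) \<le> ereal \<delta>)"
        by blast
    qed
  qed
qed

lemma forward_good_times_single:
  assumes P: "pair A R U"
    and G: "\<And>m. G m \<in> sets M" "incseq G" "AE \<omega> in M. \<exists>m. \<omega> \<in> G m"
  shows "AE \<omega> in M. \<exists>m. \<forall>K. compact K \<and> K \<inter> fibre R \<omega> = {} \<longrightarrow>
    (\<forall>\<delta>>0. \<exists>n::nat. \<theta> n \<omega> \<in> G m \<and> semidist (\<phi> n \<omega> ` K) (fibre A (\<theta> n \<omega>)) \<le> ereal \<delta>)"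
  using forward_good_times[of "\<lambda>_. A" "\<lambda>_. R" "\<lambda>_. U" G, OF P G]
proof eventually_elim
  case (elim \<omega>)
  then obtain m where m: "\<forall>K. (\<forall>b::bool. compact (K b) \<and> K b \<inter> fibre R \<omega> = {}) \<longrightarrow> (\<forall>\<delta>>0.
    \<exists>n::nat. \<theta> n \<omega> \<in> G m \<and> (\<forall>b. semidist (\<phi> n \<omega> ` K b) (fibre A (\<theta> n \<omega>)) \<le> ereal \<delta>))"
    by (rule exE)
  show ?case
  proof (rule exI[of _ m], intro allI impI)
    fix K and \<delta> :: real assume "compact K \<and> K \<inter> fibre R \<omega> = {}" "0 < \<delta>"
    then show "\<exists>n::nat. \<theta> n \<omega> \<in> G m \<and> semidist (\<phi> n \<omega> ` K) (fibre A (\<theta> n \<omega>)) \<le> ereal \<delta>"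
      using m[rule_format, of "\<lambda>_. K" \<delta>] by simp
  qed
qed

text \<open>
  The pull-back version of attraction: the same probabilities, evaluated at the shifted point
  \<open>\<theta> (- t) \<omega>\<close>, so that the images are compared with \<open>A\<close>
  over the fixed \<open>\<omega>\<close>.
\<close>

lemma backward_good_times:
  assumes P: "pair A R U"
    and G: "\<And>m. G m \<in> sets M" "incseq G" "AE \<omega> in M. \<exists>m. \<omega> \<in> G m"
  shows "AE \<omega> in M. \<exists>m. \<forall>j. \<forall>\<delta>>0. \<exists>n::nat. \<theta> (- real n) \<omega> \<in> G m \<and>
    semidist (\<phi> n (\<theta> (- real n) \<omega>) ` fibre (shrink M U j) (\<theta> (- real n) \<omega>)) (fibre A \<omega>) \<le> ereal \<delta>"
proof -
  define far where "far j l t = {\<omega> \<in> space M.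
      semidist (\<phi> t \<omega> ` fibre (shrink M U j) \<omega>) (fibre A (\<theta> t \<omega>)) > ereal (inverse (real (Suc l)))}"
    for j l t
  define Bad where "Bad i t = (case i of (j, l) \<Rightarrow>
    {\<omega> \<in> space M. \<theta> (- real t) \<omega> \<in> far j l (real t)})" for i :: "nat \<times> nat" and t :: nat
  have lim: "(\<lambda>t. outer_measure_of M (Bad i t)) \<longlonglongrightarrow> 0" for i
  proof -
    obtain j l where i: "i = (j, l)" by (cases i)
    have "filterlim real (inf at_top (principal T)) sequentially"
      unfolding filterlim_inf filterlim_principal using filterlim_real_sequentially by simp
    then have "(\<lambda>t. outer_measure_of M (far j l (real t))) \<longlonglongrightarrow> 0"
      unfolding far_def by (rule filterlim_compose[OF pair_attraction[OF P]])
    moreover have le: "outer_measure_of M (Bad i t) \<le> outer_measure_of M (far j l (real t))" for t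
      unfolding i Bad_def prod.case by (rule outer_measure_theta_vimage_le) (auto simp: far_def)
    ultimately show ?thesis
      using tendsto_sandwich[of "\<lambda>_. 0" "\<lambda>t. outer_measure_of M (Bad i t)" sequentially
        "\<lambda>t. outer_measure_of M (far j l (real t))" 0] by simp
  qed
  obtain r :: "nat \<Rightarrow> nat" where r:
    "AE \<omega> in M. \<forall>i. \<forall>\<^sub>F k in sequentially. \<omega> \<notin> Bad i (r k)"
  proof (rule null_along_subsequence[of Bad])
    show "Bad i t \<subseteq> space M" for i t unfolding Bad_def by (auto split: prod.splits)
  qed (use lim in auto)
  have "AE \<omega> in M. \<exists>m. \<exists>\<^sub>F k in sequentially. \<theta> (- real (r k)) \<omega> \<in> G m"
    by (rule recurrence[OF G]) simp
  with r AE_space show ?thesis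
  proof eventually_elim
    case (elim \<omega>)
    from elim(3) obtain m where m: "\<exists>\<^sub>F k in sequentially. \<theta> (- real (r k)) \<omega> \<in> G m" by (rule exE)
    show ?case
    proof (rule exI[of _ m], intro allI impI)
      fix j :: nat and \<delta> :: real assume "0 < \<delta>"
      obtain l where l: "inverse (real (Suc l)) < \<delta>" using reals_Archimedean \<open>0 < \<delta>\<close> by blast
      have "\<forall>\<^sub>F k in sequentially. \<omega> \<notin> Bad (j, l) (r k)" using elim(1) by (rule spec)
      then have "\<exists>\<^sub>F k in sequentially. \<theta> (- real (r k)) \<omega> \<in> G m \<and> \<omega> \<notin> Bad (j, l) (r k)"
        using m by (intro frequently_eventually_frequently)
      then have "\<exists>k. \<theta> (- real (r k)) \<omega> \<in> G m \<and> \<omega> \<notin> Bad (j, l) (r k)" by (rule frequently_ex)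
      then obtain k where k: "\<theta> (- real (r k)) \<omega> \<in> G m" "\<omega> \<notin> Bad (j, l) (r k)" by blast
      have "semidist (\<phi> (r k) (\<theta> (- real (r k)) \<omega>) ` fibre (shrink M U j) (\<theta> (- real (r k)) \<omega>)) (fibre A \<omega>)
          \<le> ereal (inverse (real (Suc l)))"
        using k(2) elim unfolding Bad_def far_def by (simp del: of_nat_Suc add: not_less)
      also have "\<dots> \<le> ereal \<delta>" using l by simp
      finally show "\<exists>n::nat. \<theta> (- real n) \<omega> \<in> G m \<and>
        semidist (\<phi> n (\<theta> (- real n) \<omega>) ` fibre (shrink M U j) (\<theta> (- real n) \<omega>)) (fibre A \<omega>) \<le> ereal \<delta>"
        by (intro exI[of _ "r k"] conjI k(1))
    qed
  qed
qed

end

section \<open>Linearity of attractors and repellers\<close>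

lemma closed_distance_pos:
  fixes C :: "'x::metric_space set"
  assumes "closed C" "x \<notin> C"
  obtains d where "0 < d" "\<And>y. y \<in> C \<Longrightarrow> d \<le> dist x y"
proof -
  have "open (- C)" "x \<in> - C" using assms by auto
  then obtain d where d: "0 < d" "ball x d \<subseteq> - C" unfolding open_contains_ball by blast
  then have "d \<le> dist x y" if "y \<in> C" for y
    using that by (meson ComplD in_mono mem_ball not_le)
  with d(1) show ?thesis by (rule that)
qed

context linear_rds
begin

lemma neighbourhood_forward:
  assumes P: "pair A R U" and w: "\<omega> \<in> space M"
    and t: "t \<in> T" "s \<in> T" "t \<le> s" and x: "\<phi> t \<omega> x \<in> fibre U (\<theta> t \<omega>)"
  shows "\<phi> s \<omega> x \<in> fibre U (\<theta> s \<omega>)"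
proof -
  have "\<phi> (s - t) (\<theta> t \<omega>) (\<phi> t \<omega> x) \<in> fibre U (\<theta> (s - t) (\<theta> t \<omega>))"
    using pairD(7)[OF P, of "s - t" "\<theta> t \<omega>"] t x w by auto
  then show ?thesis
    using phi_add[of "s - t" t \<omega> x] theta_add[of "s - t" t \<omega>] t w by simp
qed

lemma basin_step:
  assumes P: "pair A R U" and w: "\<omega> \<in> space M" and t: "t \<in> T"
    and x: "(x, \<omega>) \<in> basin M T \<theta> \<phi> U"
  shows "(\<phi> t \<omega> x, \<theta> t \<omega>) \<in> basin M T \<theta> \<phi> U"
proof -
  obtain s where s: "s \<in> T" "\<phi> s \<omega> x \<in> fibre U (\<theta> s \<omega>)" using x unfolding basin_def by auto
  define s' where "s' = max (s - t) 0"
  have s': "s' \<in> T" "0 \<le> s'" "s \<le> s' + t" unfolding s'_def using s t nat_in_T[of 0] by (auto simp: max_def)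
  have "\<phi> (s' + t) \<omega> x \<in> fibre U (\<theta> (s' + t) \<omega>)"
    using s s' t by (intro neighbourhood_forward[OF P w s(1) _ _ s(2)]) auto
  then have "\<phi> s' (\<theta> t \<omega>) (\<phi> t \<omega> x) \<in> fibre U (\<theta> s' (\<theta> t \<omega>))"
    using phi_add[OF s'(1) t w] theta_add[OF s'(1) t w] by simp
  then show ?thesis using s' t w unfolding basin_def by auto
qed

lemma basin_step_iff:
  assumes P: "pair A R U" and w: "\<omega> \<in> space M" and t: "t \<in> T"
  shows "(\<phi> t \<omega> x, \<theta> t \<omega>) \<in> basin M T \<theta> \<phi> U \<longleftrightarrow> (x, \<omega>) \<in> basin M T \<theta> \<phi> U"
  using basin_step[OF P w t, of x] basin_step[OF P theta_space[OF t w] minus_in_T[OF t], of "\<phi> t \<omega> x"]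
    phi_minus[OF t w] theta_minus[OF t w] by auto

lemma repeller_mem_iff:
  assumes P: "pair A R U" and w: "\<omega> \<in> space M"
  shows "x \<in> fibre R \<omega> \<longleftrightarrow> (x, \<omega>) \<notin> basin M T \<theta> \<phi> U"
  using P w unfolding pair_def fibre_def by auto

lemma repeller_step:
  assumes P: "pair A R U" and w: "\<omega> \<in> space M" and t: "t \<in> T"
  shows "\<phi> t \<omega> x \<in> fibre R (\<theta> t \<omega>) \<longleftrightarrow> x \<in> fibre R \<omega>"
  using basin_step_iff[OF P w t] repeller_mem_iff[OF P] w t by simp

lemma attractor_step:
  assumes P: "pair A R U" and w: "\<omega> \<in> space M" and t: "t \<in> T"
  shows "\<phi> t \<omega> x \<in> fibre A (\<theta> t \<omega>) \<longleftrightarrow> x \<in> fibre A \<omega>"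
proof
  assume "\<phi> t \<omega> x \<in> fibre A (\<theta> t \<omega>)"
  then obtain y where "y \<in> fibre A \<omega>" "\<phi> t \<omega> x = \<phi> t \<omega> y" unfolding pairD(6)[OF P t w] by auto
  then show "x \<in> fibre A \<omega>" using phi_minus[OF t w] by metis
qed (simp add: pairD(6)[OF P t w])

lemma Phi_proj_vimage_iff:
  assumes w: "\<omega> \<in> space M" and t: "t \<in> T"
    and step: "\<And>x. \<phi> t \<omega> x \<in> fibre D (\<theta> t \<omega>) \<longleftrightarrow> x \<in> fibre D \<omega>"
  shows "\<Phi> t \<omega> *v x \<in> proj_vimage (fibre D (\<theta> t \<omega>)) \<longleftrightarrow> x \<in> proj_vimage (fibre D \<omega>)"
proof (cases "x = 0")
  case False
  then have "\<Phi> t \<omega> *v x \<noteq> 0" using invertible_mult_eq_0[OF invertible_Phi[OF t w]] by simp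
  then show ?thesis
    using False step[of "abs_projective x"] phi_abs_projective[OF t w False] by (simp add: proj_vimage_iff)
qed simp

lemma repeller_disjoint_neighbourhood:
  assumes P: "pair A R U" and w: "\<omega> \<in> space M"
  shows "fibre R \<omega> \<inter> fibre U \<omega> = {}"
proof -
  have "(x, \<omega>) \<in> basin M T \<theta> \<phi> U" if "x \<in> fibre U \<omega>" for x
    using that w phi_zero[OF w] theta_zero[OF w] nat_in_T[of 0] unfolding basin_def
    by (auto intro!: bexI[of _ 0])
  then show ?thesis using repeller_mem_iff[OF P w] by blast
qed

lemma closed_repeller:
  assumes P: "pair A R U" and w: "\<omega> \<in> space M"
  shows "closed (fibre R \<omega>)"
proof -
  have "- fibre R \<omega> = (\<Union>t\<in>{t\<in>T. 0 \<le> t}. \<phi> t \<omega> -` fibre U (\<theta> t \<omega>))"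
    using repeller_mem_iff[OF P w] w unfolding basin_def by auto
  moreover have "open (\<phi> t \<omega> -` fibre U (\<theta> t \<omega>))" if "t \<in> T" for t
    using that w by (intro open_vimage continuous_phi pairD(5)[OF P]) auto
  ultimately show ?thesis unfolding closed_def by auto
qed

lemma closed_attractor: "pair A R U \<Longrightarrow> \<omega> \<in> space M \<Longrightarrow> closed (fibre A \<omega>)"
  using pairD(4) compact_imp_closed by blast

text \<open>
  The event that \<open>A\<close> stays at distance at least \<open>1 / (m + 1)\<close> from the
  complement of \<open>U\<close>, in particular from the repeller of \<open>U\<close>.
\<close>

definition margin where
  "margin A U m = {\<omega> \<in> space M. fibre A \<omega> \<subseteq> fibre (shrink M U m) \<omega>}"

text \<open>
  The margins make recurrence quantitative: a compact random set inside an open one keeps a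
  fixed distance from the complement with probability as close to 1 as desired.
\<close>

lemma margin_events:
  assumes P: "pair A R U" and P': "pair A' R' U'" and sub: "AE \<omega> in M. fibre A \<omega> \<subseteq> fibre U' \<omega>"
  shows "margin A U' m \<in> sets M" "incseq (margin A U')" "AE \<omega> in M. \<exists>m. \<omega> \<in> margin A U' m"
proof -
  have "random_set M (shrink M U' m)"
    using closed_random_set_shrink[OF projection_hypotheses pairD(2)[OF P']] unfolding closed_random_set_def by blast
  then show "margin A U' m \<in> sets M"
    unfolding margin_def by (intro fibre_inclusion_measurable projection_hypotheses pairD(1)[OF P])
  show "incseq (margin A U')"
  proof (rule incseq_SucI)
    fix m
    have "inverse (real (Suc (Suc m))) \<le> inverse (real (Suc m))" by (intro le_imp_inverse_le) auto
    then have "ball x (inverse (real (Suc (Suc m)))) \<subseteq> ball x (inverse (real (Suc m)))" for x :: "'n projective"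
      by (rule subset_ball)
    then have "shrink M U' m \<subseteq> shrink M U' (Suc m)" unfolding shrink_def by blast
    then have "fibre (shrink M U' m) \<omega> \<subseteq> fibre (shrink M U' (Suc m)) \<omega>" for \<omega>
      unfolding fibre_def by blast
    then show "margin A U' m \<subseteq> margin A U' (Suc m)" unfolding margin_def by blast
  qed
  show "AE \<omega> in M. \<exists>m. \<omega> \<in> margin A U' m"
    using sub AE_space
  proof eventually_elim
    case (elim \<omega>)
    then obtain m where "fibre A \<omega> \<subseteq> fibre (shrink M U' m) \<omega>"
      using compact_subset_shrink[OF elim(2) pairD(5)[OF P' elim(2)] pairD(4)[OF P elim(2)]] by blast
    then show ?case using elim(2) unfolding margin_def by blast
  qed
qed

lemma margin_repeller_dist:
  assumes P: "pair A' R' U'" and w: "\<omega> \<in> margin A U' m" and "a \<in> fibre A \<omega>" "q \<in> fibre R' \<omega>"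
  shows "inverse (real (Suc m)) \<le> dist a q"
proof (rule ccontr)
  assume "\<not> ?thesis"
  then have "q \<in> ball a (inverse (real (Suc m)))" by simp
  moreover have "(a, \<omega>) \<in> shrink M U' m" using w assms(3) unfolding margin_def fibre_def by auto
  ultimately have "q \<in> fibre U' \<omega>" unfolding shrink_def by auto
  moreover have "\<omega> \<in> space M" using w unfolding margin_def by blast
  ultimately show False using repeller_disjoint_neighbourhood[OF P] assms(4) by blast
qed

text \<open>
  The points \<open>b + r b'\<close> and \<open>b + r\<^sup>-\<^sup>1 b'\<close> in a gap of the
  cone over \<open>R\<close> are in the basin. At a good time their images are close to
  \<open>A\<close>, hence bounded away from \<open>R\<close>, which contains the images of
  \<open>b\<close> and \<open>b'\<close>.
\<close>

lemma subspace_repeller: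
  assumes P: "pair A R U"
  shows "AE \<omega> in M. subspace (proj_vimage (fibre R \<omega>))"
  using forward_good_times_single[OF P margin_events[OF P P pairD(3)[OF P]]] AE_space
proof eventually_elim
  case (elim \<omega>)
  note w = elim(2)
  from elim(1) obtain m where m: "\<forall>K. compact K \<and> K \<inter> fibre R \<omega> = {} \<longrightarrow>
    (\<forall>\<delta>>0. \<exists>n::nat. \<theta> n \<omega> \<in> margin A U m \<and> semidist (\<phi> n \<omega> ` K) (fibre A (\<theta> n \<omega>)) \<le> ereal \<delta>)"
    by (rule exE)
  show ?case
  proof (rule ccontr)
    assume ns: "\<not> ?thesis"
    obtain b b' where b: "b \<noteq> 0" "b' \<noteq> 0" "b \<in> proj_vimage (fibre R \<omega>)" "b' \<in> proj_vimage (fibre R \<omega>)"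
      and gap: "\<And>r. 0 < r \<Longrightarrow> b + r *\<^sub>R b' \<notin> proj_vimage (fibre R \<omega>)"
      using not_subspace_gap[OF closed_repeller[OF P w] ns] by blast
    define \<epsilon> where "\<epsilon> = inverse (real (Suc m))"
    have "0 < \<epsilon>" unfolding \<epsilon>_def by simp
    \<comment> \<open>The distance from \<open>R\<close> at the good time will be
      \<open>\<epsilon> / 4\<close>, which exceeds \<open>2 r\<close>.\<close>
    define r where "r = \<epsilon> / 16"
    have r: "0 < r" "0 < inverse r" unfolding r_def using \<open>0 < \<epsilon>\<close> by auto
    let ?c = "b + r *\<^sub>R b'" and ?c' = "b + inverse r *\<^sub>R b'"
    have nz: "?c \<noteq> 0" "?c' \<noteq> 0" using gap[OF r(1)] gap[OF r(2)] by (metis zero_in_proj_vimage)+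
    let ?K = "{abs_projective ?c, abs_projective ?c'}"
    have "?K \<inter> fibre R \<omega> = {}" using gap[OF r(1)] gap[OF r(2)] nz by (simp add: proj_vimage_iff)
    then have "compact ?K \<and> ?K \<inter> fibre R \<omega> = {}" by (simp add: finite_imp_compact)
    from m[rule_format, OF this, of "\<epsilon> / 2"] \<open>0 < \<epsilon>\<close> obtain n :: nat
      where n: "\<theta> n \<omega> \<in> margin A U m" "semidist (\<phi> n \<omega> ` ?K) (fibre A (\<theta> n \<omega>)) \<le> ereal (\<epsilon> / 2)" by auto
    have sep: "\<epsilon> / 4 \<le> dist (\<phi> n \<omega> p) (\<phi> n \<omega> q)" if p: "p \<in> ?K" and q: "q \<in> fibre R \<omega>" for p q
    proof -
      obtain a where a: "a \<in> fibre A (\<theta> n \<omega>)" "dist (\<phi> n \<omega> p) a < 3 * \<epsilon> / 4"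
        using semidist_leD[OF n(2), of "3 * \<epsilon> / 4" "\<phi> n \<omega> p"] p \<open>0 < \<epsilon>\<close> by auto
      have "\<phi> n \<omega> q \<in> fibre R (\<theta> n \<omega>)" using repeller_step[OF P w] q by simp
      then have "\<epsilon> \<le> dist a (\<phi> n \<omega> q)" unfolding \<epsilon>_def by (rule margin_repeller_dist[OF P n(1) a(1)])
      then show ?thesis using a(2) dist_triangle[of a "\<phi> n \<omega> q" "\<phi> n \<omega> p"] by (simp add: dist_commute)
    qed
    have "abs_projective b \<in> fibre R \<omega>" "abs_projective b' \<in> fibre R \<omega>"
      using b by (simp_all add: proj_vimage_iff)
    then have "\<epsilon> / 4 \<le> 2 * r"
      using sep \<open>0 < \<epsilon>\<close> unfolding projectivisation_def
      by (intro separated_segment_bound[OF invertible_Phi[OF nat_in_T w] r(1) b(1,2) nz]) auto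
    then show False unfolding r_def using \<open>0 < \<epsilon>\<close> by simp
  qed
qed

text \<open>
  The points \<open>b + r b'\<close> and \<open>b + r\<^sup>-\<^sup>1 b'\<close> in a gap of the
  cone over \<open>A\<close> have positive distance from \<open>A(\<omega>)\<close>. If the
  preimage of one of them at a good backward time were close to \<open>A\<close>, it would lie
  in a closed random subset of \<open>U\<close>, and the dynamics would push it closer to
  \<open>A(\<omega>)\<close> than it is.
\<close>

lemma subspace_attractor:
  assumes P: "pair A R U"
  shows "AE \<omega> in M. subspace (proj_vimage (fibre A \<omega>))"
  using backward_good_times[OF P margin_events[OF P P pairD(3)[OF P]]] AE_space
proof eventually_elim
  case (elim \<omega>)
  note w = elim(2)
  from elim(1) obtain m where m: "\<forall>j. \<forall>\<delta>>0. \<exists>n::nat. \<theta> (- real n) \<omega> \<in> margin A U m \<and>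
    semidist (\<phi> n (\<theta> (- real n) \<omega>) ` fibre (shrink M U j) (\<theta> (- real n) \<omega>)) (fibre A \<omega>) \<le> ereal \<delta>"
    by (rule exE)
  show ?case
  proof (rule ccontr)
    assume ns: "\<not> ?thesis"
    obtain b b' where b: "b \<noteq> 0" "b' \<noteq> 0" "b \<in> proj_vimage (fibre A \<omega>)" "b' \<in> proj_vimage (fibre A \<omega>)"
      and gap: "\<And>r. 0 < r \<Longrightarrow> b + r *\<^sub>R b' \<notin> proj_vimage (fibre A \<omega>)"
      using not_subspace_gap[OF closed_attractor[OF P w] ns] by blast
    define \<epsilon> where "\<epsilon> = inverse (real (Suc m))"
    have "0 < \<epsilon>" unfolding \<epsilon>_def by simp
    \<comment> \<open>The distance from \<open>A\<close> at the good time will be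
      \<open>\<epsilon> / 2\<close>, which exceeds \<open>2 r\<close>.\<close>
    define r where "r = \<epsilon> / 8"
    have r: "0 < r" "0 < inverse r" unfolding r_def using \<open>0 < \<epsilon>\<close> by auto
    let ?c = "b + r *\<^sub>R b'" and ?c' = "b + inverse r *\<^sub>R b'"
    have nz: "?c \<noteq> 0" "?c' \<noteq> 0" using gap[OF r(1)] gap[OF r(2)] by (metis zero_in_proj_vimage)+
    let ?K = "{abs_projective ?c, abs_projective ?c'}"
    have K: "p \<notin> fibre A \<omega>" if "p \<in> ?K" for p
      using gap[OF r(1)] gap[OF r(2)] nz that by (auto simp: proj_vimage_iff)
    obtain d where d: "0 < d" "\<And>y. y \<in> fibre A \<omega> \<Longrightarrow> d \<le> dist (abs_projective ?c) y"
      using closed_distance_pos[OF closed_attractor[OF P w] K[of "abs_projective ?c"]] by blast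
    obtain d' where d': "0 < d'" "\<And>y. y \<in> fibre A \<omega> \<Longrightarrow> d' \<le> dist (abs_projective ?c') y"
      using closed_distance_pos[OF closed_attractor[OF P w] K[of "abs_projective ?c'"]] by blast
    have far: "min d d' \<le> dist p y" if "p \<in> ?K" "y \<in> fibre A \<omega>" for p y
      using that d(2) d'(2) by fastforce
    \<comment> \<open>With this index the \<open>\<epsilon> / 2\<close>-neighbourhood of \<open>A\<close> lies
      in \<open>shrink M U j\<close> on the event \<open>margin A U m\<close>.\<close>
    define j where "j = 2 * m + 1"
    have j: "inverse (real (Suc j)) = \<epsilon> / 2" unfolding j_def \<epsilon>_def by (simp add: field_simps)
    from m[rule_format, of "min d d' / 2" j] d(1) d'(1) obtain n :: nat
      where n: "\<theta> (- real n) \<omega> \<in> margin A U m"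
        "semidist (\<phi> n (\<theta> (- real n) \<omega>) ` fibre (shrink M U j) (\<theta> (- real n) \<omega>)) (fibre A \<omega>) \<le> ereal (min d d' / 2)"
      by auto
    let ?t = "- real n"
    have t: "?t \<in> T" by simp
    have sep: "\<epsilon> / 2 \<le> dist (\<phi> ?t \<omega> p) (\<phi> ?t \<omega> q)" if p: "p \<in> ?K" and q: "q \<in> fibre A \<omega>" for p q
    proof (rule ccontr)
      assume "\<not> ?thesis"
      then have close: "dist (\<phi> ?t \<omega> q) (\<phi> ?t \<omega> p) < \<epsilon> / 2" by (simp add: dist_commute)
      have "\<phi> ?t \<omega> q \<in> fibre A (\<theta> ?t \<omega>)" using attractor_step[OF P w t] q by simp
      then have "(\<phi> ?t \<omega> q, \<theta> ?t \<omega>) \<in> shrink M U m"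
        using n(1) unfolding margin_def fibre_def by blast
      then have "ball (\<phi> ?t \<omega> q) \<epsilon> \<subseteq> fibre U (\<theta> ?t \<omega>)" unfolding shrink_def \<epsilon>_def by auto
      moreover have "ball (\<phi> ?t \<omega> p) (\<epsilon> / 2) \<subseteq> ball (\<phi> ?t \<omega> q) \<epsilon>"
      proof
        fix y assume "y \<in> ball (\<phi> ?t \<omega> p) (\<epsilon> / 2)"
        then show "y \<in> ball (\<phi> ?t \<omega> q) \<epsilon>"
          using close dist_triangle[of "\<phi> ?t \<omega> q" y "\<phi> ?t \<omega> p"] by simp
      qed
      ultimately have "ball (\<phi> ?t \<omega> p) (inverse (real (Suc j))) \<subseteq> fibre U (\<theta> ?t \<omega>)" unfolding j by blast
      then have "(\<phi> ?t \<omega> p, \<theta> ?t \<omega>) \<in> shrink M U j"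
        using theta_space[OF t w] unfolding shrink_def by blast
      then have "\<phi> n (\<theta> ?t \<omega>) (\<phi> ?t \<omega> p) \<in> \<phi> n (\<theta> ?t \<omega>) ` fibre (shrink M U j) (\<theta> ?t \<omega>)"
        unfolding fibre_def by blast
      then have "p \<in> \<phi> n (\<theta> ?t \<omega>) ` fibre (shrink M U j) (\<theta> ?t \<omega>)"
        unfolding phi_minus'[OF nat_in_T w] .
      moreover have "min d d' / 2 < min d d'" using d(1) d'(1) by (auto simp: min_def)
      ultimately obtain a where "a \<in> fibre A \<omega>" "dist p a < min d d'"
        using semidist_leD[OF n(2)] by blast
      then show False using far[OF p] by fastforce
    qed
    have "abs_projective b \<in> fibre A \<omega>" "abs_projective b' \<in> fibre A \<omega>"
      using b by (simp_all add: proj_vimage_iff)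
    then have "\<epsilon> / 2 \<le> 2 * r"
      using sep \<open>0 < \<epsilon>\<close> unfolding projectivisation_def
      by (intro separated_segment_bound[OF invertible_Phi[OF t w] r(1) b(1,2) nz]) auto
    then show False unfolding r_def using \<open>0 < \<epsilon>\<close> by simp
  qed
qed

lemma attractor_Int_repeller:
  assumes P: "pair A R U"
  shows "AE \<omega> in M. fibre A \<omega> \<inter> fibre R \<omega> = {}"
  using pairD(3)[OF P] AE_space
  by eventually_elim (use repeller_disjoint_neighbourhood[OF P] in blast)

text \<open>
  Otherwise the span \<open>E\<close> of \<open>V\<close> and some \<open>z\<close> outside
  \<open>V + W\<close> meets \<open>W\<close> in 0 only and is attracted by \<open>A\<close>.
  But the image of \<open>E\<close> always contains a direction orthogonal to the image of
  \<open>V\<close>, whose projective distance from \<open>A\<close> is \<open>\<surd>2\<close>.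
  The argument includes the case of an empty attractor.
\<close>

lemma attractor_plus_repeller:
  assumes P: "pair A R U"
  shows "AE \<omega> in M. \<forall>z. \<exists>v\<in>proj_vimage (fibre A \<omega>). \<exists>w\<in>proj_vimage (fibre R \<omega>). z = v + w"
  using subspace_attractor[OF P] subspace_repeller[OF P] attractor_Int_repeller[OF P]
    forward_good_times_single[OF P margin_events[OF P P pairD(3)[OF P]]] AE_space
proof eventually_elim
  case (elim \<omega>)
  note w = elim(5)
  let ?V = "proj_vimage (fibre A \<omega>)" and ?W = "proj_vimage (fibre R \<omega>)"
  have VW: "?V \<inter> ?W = {0}" using elim(3) by (simp add: proj_vimage_empty flip: proj_vimage_Int)
  show ?case
  proof (rule ccontr)
    assume "\<not> ?thesis"
    then obtain z where z: "\<And>v w. v \<in> ?V \<Longrightarrow> w \<in> ?W \<Longrightarrow> z \<noteq> v + w" by blast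
    define E where "E = span (insert z ?V)"
    have E: "subspace E" unfolding E_def by simp
    have "E \<inter> ?W \<subseteq> {0}"
    proof
      fix x assume x: "x \<in> E \<inter> ?W"
      then obtain k where k: "x - k *\<^sub>R z \<in> ?V"
        using span_eq_iff[THEN iffD2, OF elim(1)] unfolding E_def by (auto simp: span_breakdown_eq)
      have "k = 0"
      proof (rule ccontr)
        assume "k \<noteq> 0"
        then have "z = (- inverse k) *\<^sub>R (x - k *\<^sub>R z) + inverse k *\<^sub>R x" by (simp add: algebra_simps)
        moreover have "inverse k *\<^sub>R x \<in> ?W" using x by (blast intro: proj_vimage_scaleR)
        ultimately show False using z proj_vimage_scaleR[OF k] by blast
      qed
      then show "x \<in> {0}" using k x VW by auto
    qed
    have "proj_image E \<inter> fibre R \<omega> = {}"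
    proof (rule equals0I)
      fix p assume "p \<in> proj_image E \<inter> fibre R \<omega>"
      then obtain x where "x \<in> E" "x \<noteq> 0" "abs_projective x \<in> fibre R \<omega>"
        unfolding proj_image_def by blast
      then show False using \<open>E \<inter> ?W \<subseteq> {0}\<close> by (auto simp: proj_vimage_iff)
    qed
    with compact_proj_image_subspace[OF E] have K: "compact (proj_image E) \<and> proj_image E \<inter> fibre R \<omega> = {}" by blast
    from elim(4) obtain m where m: "\<forall>K. compact K \<and> K \<inter> fibre R \<omega> = {} \<longrightarrow>
      (\<forall>\<delta>>0. \<exists>n::nat. \<theta> n \<omega> \<in> margin A U m \<and> semidist (\<phi> n \<omega> ` K) (fibre A (\<theta> n \<omega>)) \<le> ereal \<delta>)"
      by (rule exE)
    from m[rule_format, OF K, of "1/2"] obtain n :: nat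
      where n: "semidist (\<phi> n \<omega> ` proj_image E) (fibre A (\<theta> n \<omega>)) \<le> ereal (1/2)" by auto
    define \<Psi> where "\<Psi> = \<Phi> n \<omega>"
    have inv: "invertible \<Psi>" unfolding \<Psi>_def by (rule invertible_Phi[OF nat_in_T w])
    have V_iff: "\<Psi> *v x \<in> proj_vimage (fibre A (\<theta> n \<omega>)) \<longleftrightarrow> x \<in> ?V" for x
      unfolding \<Psi>_def by (rule Phi_proj_vimage_iff[OF w nat_in_T attractor_step[OF P w nat_in_T]])
    have subE: "subspace ((*v) \<Psi> ` E)" and subV: "subspace ((*v) \<Psi> ` ?V)"
      using E elim(1) by (auto intro!: linear_subspace_image)
    have "z \<notin> ?V" using z[of z 0] by auto
    have "z \<in> E" "?V \<subseteq> E" unfolding E_def by (auto intro: span_base)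
    have "(*v) \<Psi> ` ?V \<subset> (*v) \<Psi> ` E"
    proof (rule psubsetI)
      show "(*v) \<Psi> ` ?V \<subseteq> (*v) \<Psi> ` E" using \<open>?V \<subseteq> E\<close> by blast
      have "\<Psi> *v z \<notin> (*v) \<Psi> ` ?V" using V_iff \<open>z \<notin> ?V\<close> by (metis imageE)
      then show "(*v) \<Psi> ` ?V \<noteq> (*v) \<Psi> ` E" using \<open>z \<in> E\<close> by blast
    qed
    then have "span ((*v) \<Psi> ` ?V) \<subset> span ((*v) \<Psi> ` E)"
      unfolding span_eq_iff[THEN iffD2, OF subE] span_eq_iff[THEN iffD2, OF subV] .
    then obtain u where u: "u \<noteq> 0" "u \<in> span ((*v) \<Psi> ` E)" "\<And>y. y \<in> span ((*v) \<Psi> ` ?V) \<Longrightarrow> orthogonal u y"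
      using orthogonal_to_subspace_exists_gen by blast
    then obtain e where e: "e \<in> E" "u = \<Psi> *v e" unfolding span_eq_iff[THEN iffD2, OF subE] by blast
    have "e \<noteq> 0" using e u by auto
    have "\<phi> n \<omega> (abs_projective e) = abs_projective u"
      unfolding e \<Psi>_def by (rule phi_abs_projective[OF nat_in_T w \<open>e \<noteq> 0\<close>])
    moreover have "abs_projective e \<in> proj_image E" unfolding proj_image_def using e \<open>e \<noteq> 0\<close> by blast
    ultimately have "abs_projective u \<in> \<phi> n \<omega> ` proj_image E" by force
    then obtain a where a: "a \<in> fibre A (\<theta> n \<omega>)" "dist (abs_projective u) a < 1"
      using semidist_leD[OF n, of 1] by auto
    obtain v where v: "norm v = 1" "a = abs_projective v" by (rule projective_cases)
    have "v \<noteq> 0" using v by auto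
    obtain v' where v': "v = \<Psi> *v v'"
      using inv by (metis invertible_def matrix_vector_mul_assoc matrix_vector_mul_lid)
    have "v \<in> proj_vimage (fibre A (\<theta> n \<omega>))" using a(1) v \<open>v \<noteq> 0\<close> by (simp add: proj_vimage_iff)
    then have "v' \<in> ?V" using V_iff v' by simp
    then have "orthogonal u v" using u(3) v' by (blast intro: span_base)
    then have ort: "orthogonal (u /\<^sub>R norm u) v" by (simp add: orthogonal_def)
    have "1 \<le> norm (u /\<^sub>R norm u - v)" "1 \<le> norm (u /\<^sub>R norm u + v)"
    proof -
      have "norm (u /\<^sub>R norm u) = 1" using u(1) by simp
      then have "(norm (u /\<^sub>R norm u + v))\<^sup>2 = 2" "(norm (u /\<^sub>R norm u - v))\<^sup>2 = 2"
        using norm_add_Pythagorean[OF ort] norm_add_Pythagorean[of "u /\<^sub>R norm u" "- v"] ort v(1)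
        by (simp_all add: orthogonal_def)
      then show "1 \<le> norm (u /\<^sub>R norm u - v)" "1 \<le> norm (u /\<^sub>R norm u + v)"
        by (auto intro!: power2_le_imp_le[of 1])
    qed
    then have "1 \<le> dist (abs_projective u) a"
      unfolding v(2) dist_abs_projective[OF u(1) \<open>v \<noteq> 0\<close>] proj_dist_def using v(1) by simp
    then show False using a(2) by simp
  qed
qed

section \<open>Comparison of attractors\<close>

text \<open>
  Inclusion of invariant random sets is an invariant event.
\<close>

lemma attractor_subset_zero_one:
  assumes P: "pair A R U" and P': "pair A' R' U'"
  shows "(AE \<omega> in M. fibre A \<omega> \<subseteq> fibre A' \<omega>) \<or> (AE \<omega> in M. \<not> fibre A \<omega> \<subseteq> fibre A' \<omega>)"
proof -
  let ?B = "{\<omega> \<in> space M. fibre A \<omega> \<subseteq> fibre A' \<omega>}"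
  have B: "?B \<in> sets M" by (intro fibre_inclusion_measurable projection_hypotheses pairD(1)[OF P] pairD(1)[OF P'])
  have "\<theta> t -` ?B \<inter> space M = ?B" if t: "t \<in> T" for t
  proof -
    have "fibre A (\<theta> t \<omega>) \<subseteq> fibre A' (\<theta> t \<omega>) \<longleftrightarrow> fibre A \<omega> \<subseteq> fibre A' \<omega>" if w: "\<omega> \<in> space M" for \<omega>
      using pairD(6)[OF P t w] attractor_step[OF P' w t] by (auto simp: subset_iff)
    then show ?thesis using t by auto
  qed
  then have "measure M ?B = 0 \<or> measure M ?B = 1" using theta_ergodic[OF B] by blast
  then show ?thesis
  proof
    assume "measure M ?B = 0"
    then have "AE \<omega> in M. \<omega> \<notin> ?B" using B by (simp add: prob_eq_0)
    then have "AE \<omega> in M. \<not> fibre A \<omega> \<subseteq> fibre A' \<omega>" using AE_space by eventually_elim auto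
    then show ?thesis ..
  next
    assume "measure M ?B = 1"
    then have "AE \<omega> in M. \<omega> \<in> ?B" using B by (simp add: prob_eq_1)
    then have "AE \<omega> in M. fibre A \<omega> \<subseteq> fibre A' \<omega>" by eventually_elim auto
    then show ?thesis ..
  qed
qed

text \<open>
  If \<open>A\<close> were contained in the basin of \<open>A'\<close> with positive
  probability, the compact set \<open>A\<close> would be attracted by \<open>A'\<close>. As
  \<open>A\<close> is invariant, it would then be close to \<open>A'\<close> at times at which,
  by recurrence, it contains a point that is not.
\<close>

lemma not_subset_imp_meets_repeller:
  assumes P: "pair A R U" and P': "pair A' R' U'"
    and ns: "AE \<omega> in M. \<not> fibre A \<omega> \<subseteq> fibre A' \<omega>"
  shows "AE \<omega> in M. fibre A \<omega> \<inter> fibre R' \<omega> \<noteq> {}"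
proof -
  define E where "E m = {(x, \<omega>). \<exists>y. (y, \<omega>) \<in> A' \<and> dist x y < inverse (real (Suc m))}" for m
  define G where "G m = space M - {\<omega> \<in> space M. fibre A \<omega> \<subseteq> fibre (E m) \<omega>}" for m
  have "random_set M (E m)" for m
    using enlargement_measurable[OF projection_hypotheses] pairD(1)[OF P'] unfolding E_def random_set_def by blast
  then have G1: "G m \<in> sets M" for m
    unfolding G_def by (intro sets.compl_sets fibre_inclusion_measurable projection_hypotheses pairD(1)[OF P])
  have G2: "incseq G"
  proof (rule incseq_SucI)
    fix m
    have "inverse (real (Suc (Suc m))) \<le> inverse (real (Suc m))" by (intro le_imp_inverse_le) auto
    then have "r < inverse (real (Suc (Suc m))) \<Longrightarrow> r < inverse (real (Suc m))" for r by linarith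
    then have "E (Suc m) \<subseteq> E m" unfolding E_def by blast
    then have "fibre (E (Suc m)) \<omega> \<subseteq> fibre (E m) \<omega>" for \<omega> unfolding fibre_def by blast
    then show "G m \<subseteq> G (Suc m)" unfolding G_def by blast
  qed
  have G3: "AE \<omega> in M. \<exists>m. \<omega> \<in> G m"
    using ns AE_space
  proof eventually_elim
    case (elim \<omega>)
    then obtain x where x: "x \<in> fibre A \<omega>" "x \<notin> fibre A' \<omega>" by blast
    obtain d where d: "0 < d" "\<And>y. y \<in> fibre A' \<omega> \<Longrightarrow> d \<le> dist x y"
      using closed_distance_pos[OF closed_attractor[OF P' elim(2)] x(2)] by blast
    obtain m where m: "inverse (real (Suc m)) < d" using reals_Archimedean d(1) by blast
    have "x \<notin> fibre (E m) \<omega>"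
    proof
      assume "x \<in> fibre (E m) \<omega>"
      then obtain y where "y \<in> fibre A' \<omega>" "dist x y < inverse (real (Suc m))"
        unfolding E_def fibre_def by blast
      then show False using d(2)[of y] m by linarith
    qed
    then show ?case using x elim(2) unfolding G_def by blast
  qed
  show ?thesis
    using forward_good_times_single[OF P' G1 G2 G3] AE_space
  proof eventually_elim
    case (elim \<omega>)
    note w = elim(2)
    from elim(1) obtain m where m: "\<forall>K. compact K \<and> K \<inter> fibre R' \<omega> = {} \<longrightarrow>
      (\<forall>\<delta>>0. \<exists>n::nat. \<theta> n \<omega> \<in> G m \<and> semidist (\<phi> n \<omega> ` K) (fibre A' (\<theta> n \<omega>)) \<le> ereal \<delta>)"
      by (rule exE)
    show ?case
    proof
      assume "fibre A \<omega> \<inter> fibre R' \<omega> = {}"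
      then have K: "compact (fibre A \<omega>) \<and> fibre A \<omega> \<inter> fibre R' \<omega> = {}" using pairD(4)[OF P w] by blast
      define \<epsilon> where "\<epsilon> = inverse (real (Suc m))"
      have "0 < \<epsilon>" unfolding \<epsilon>_def by simp
      with m[rule_format, OF K, of "\<epsilon> / 2"] obtain n :: nat
        where n: "\<theta> n \<omega> \<in> G m" "semidist (\<phi> n \<omega> ` fibre A \<omega>) (fibre A' (\<theta> n \<omega>)) \<le> ereal (\<epsilon> / 2)" by auto
      obtain x where x: "x \<in> fibre A (\<theta> n \<omega>)" "x \<notin> fibre (E m) (\<theta> n \<omega>)"
        using n(1) unfolding G_def by blast
      have "x \<in> \<phi> n \<omega> ` fibre A \<omega>" using x(1) pairD(6)[OF P nat_in_T w] by simp
      moreover have "\<epsilon> / 2 < \<epsilon>" using \<open>0 < \<epsilon>\<close> by simp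
      ultimately obtain y where "y \<in> fibre A' (\<theta> n \<omega>)" "dist x y < \<epsilon>"
        using semidist_leD[OF n(2)] by blast
      then have "x \<in> fibre (E m) (\<theta> n \<omega>)" unfolding E_def fibre_def \<epsilon>_def by blast
      then show False using x(2) by blast
    qed
  qed
qed

text \<open>
  A point of \<open>R'\<close> outside \<open>R\<close> would be attracted by \<open>A\<close>,
  hence approach \<open>A'\<close>, without leaving \<open>R'\<close>. In particular the
  repeller is determined by the attractor almost surely.
\<close>

lemma subset_imp_repeller_supset:
  assumes P: "pair A R U" and P': "pair A' R' U'"
    and sub: "AE \<omega> in M. fibre A \<omega> \<subseteq> fibre A' \<omega>"
  shows "AE \<omega> in M. fibre R' \<omega> \<subseteq> fibre R \<omega>"
proof -
  have "AE \<omega> in M. fibre A \<omega> \<subseteq> fibre U' \<omega>" using sub pairD(3)[OF P'] by eventually_elim blast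
  note G = margin_events[OF P P' this]
  show ?thesis
    using forward_good_times_single[OF P G] AE_space
  proof eventually_elim
    case (elim \<omega>)
    note w = elim(2)
    from elim(1) obtain m where m: "\<forall>K. compact K \<and> K \<inter> fibre R \<omega> = {} \<longrightarrow>
      (\<forall>\<delta>>0. \<exists>n::nat. \<theta> n \<omega> \<in> margin A U' m \<and> semidist (\<phi> n \<omega> ` K) (fibre A (\<theta> n \<omega>)) \<le> ereal \<delta>)"
      by (rule exE)
    show ?case
    proof (rule subsetI, rule ccontr)
      fix x assume x: "x \<in> fibre R' \<omega>" "x \<notin> fibre R \<omega>"
      then have K: "compact {x} \<and> {x} \<inter> fibre R \<omega> = {}" by simp
      define \<epsilon> where "\<epsilon> = inverse (real (Suc m))"
      have "0 < \<epsilon>" unfolding \<epsilon>_def by simp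
      with m[rule_format, OF K, of "\<epsilon> / 2"] obtain n :: nat
        where n: "\<theta> n \<omega> \<in> margin A U' m" "semidist (\<phi> n \<omega> ` {x}) (fibre A (\<theta> n \<omega>)) \<le> ereal (\<epsilon> / 2)" by auto
      have "\<epsilon> / 2 < \<epsilon>" using \<open>0 < \<epsilon>\<close> by simp
      then obtain a where a: "a \<in> fibre A (\<theta> n \<omega>)" "dist (\<phi> n \<omega> x) a < \<epsilon>"
        using semidist_leD[OF n(2), of \<epsilon> "\<phi> n \<omega> x"] by blast
      have "\<phi> n \<omega> x \<in> fibre R' (\<theta> n \<omega>)" using repeller_step[OF P' w nat_in_T] x(1) by simp
      then have "\<epsilon> \<le> dist a (\<phi> n \<omega> x)" unfolding \<epsilon>_def by (rule margin_repeller_dist[OF P' n(1) a(1)])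
      then show False using a(2) by (simp add: dist_commute)
    qed
  qed
qed

text \<open>
  If the direction of \<open>x + y\<close> is close to a subspace containing \<open>x\<close>,
  and \<open>y\<close> is not dominated by \<open>x\<close>, then the direction of
  \<open>y\<close> is close to the subspace as well.
\<close>

lemma component_near_attractor:
  fixes x y :: "real ^ 'n"
  assumes V: "subspace (proj_vimage A)" and x: "x \<in> proj_vimage A" and y: "y \<noteq> 0" "x + y \<noteq> 0"
    and big: "norm x \<le> norm y" and a: "a \<in> A" "dist (abs_projective (x + y)) a < \<delta>"
    and \<delta>: "\<delta> \<le> 1/4"
  shows "\<exists>a'\<in>A. dist a' (abs_projective y) \<le> 4 * \<delta>"
proof -
  obtain v0 where v0: "norm v0 = 1" "a = abs_projective v0" by (rule projective_cases)
  have "v0 \<noteq> 0" using v0 by auto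
  have v0A: "v0 \<in> proj_vimage A" using a(1) v0 \<open>v0 \<noteq> 0\<close> by (simp add: proj_vimage_iff)
  define z where "z = x + y"
  have "min (norm (z /\<^sub>R norm z - v0)) (norm (z /\<^sub>R norm z + v0)) < \<delta>"
    using a(2) y(2) \<open>v0 \<noteq> 0\<close> v0(1) unfolding v0(2) z_def
    by (simp add: dist_abs_projective proj_dist_def)
  then obtain v where v: "v \<in> proj_vimage A" "norm (z /\<^sub>R norm z - v) < \<delta>"
  proof (cases "norm (z /\<^sub>R norm z - v0) < \<delta>")
    case False
    assume "min (norm (z /\<^sub>R norm z - v0)) (norm (z /\<^sub>R norm z + v0)) < \<delta>"
    then have "norm (z /\<^sub>R norm z - (- v0)) < \<delta>" using False by simp
    moreover have "- v0 \<in> proj_vimage A" using proj_vimage_scaleR[OF v0A, of "-1"] by simp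
    ultimately show ?thesis using that by blast
  qed (use v0A that in blast)
  \<comment> \<open>Near \<open>x + y\<close> there is the vector \<open>norm z *\<^sub>R v\<close> of the
    subspace; subtracting \<open>x\<close> gives one near \<open>y\<close>.\<close>
  define v' where "v' = norm z *\<^sub>R v - x"
  have v'A: "v' \<in> proj_vimage A"
    unfolding v'_def using V x v(1) by (simp add: subspace_diff subspace_scale)
  have "y - v' = norm z *\<^sub>R (z /\<^sub>R norm z - v)"
    using y(2) unfolding v'_def z_def by (simp add: algebra_simps)
  then have "norm (y - v') = norm z * norm (z /\<^sub>R norm z - v)" by simp
  also have "\<dots> \<le> (2 * norm y) * \<delta>"
    using norm_triangle_ineq[of x y] big v(2) unfolding z_def by (intro mult_mono) auto
  finally have close: "norm (y - v') \<le> 2 * norm y * \<delta>" .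
  have "v' \<noteq> 0"
  proof
    assume "v' = 0"
    then have "norm y \<le> 2 * norm y * \<delta>" using close by simp
    also have "\<dots> \<le> 2 * norm y * (1/4)" using \<delta> by (intro mult_left_mono) auto
    finally show False using y(1) by simp
  qed
  have "dist (abs_projective v') (abs_projective y) \<le> 2 * norm (v' - y) / norm y"
    by (rule dist_abs_projective_le[OF \<open>v' \<noteq> 0\<close> y(1)])
  also have "\<dots> \<le> 4 * \<delta>" using close y(1) by (simp add: field_simps norm_minus_commute)
  finally show ?thesis using v'A \<open>v' \<noteq> 0\<close> proj_vimage_iff by blast
qed

text \<open>
  Let \<open>x\<close> and \<open>y\<close> span points of \<open>A \<inter> R'\<close> and
  \<open>A' \<inter> R\<close>. At a common good time the direction of the image of
  \<open>x + y\<close> is close to both attractors. The larger of the images of \<open>x\<close>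
  and \<open>y\<close> is then close to the attractor that contains the other one, although it
  lies in the repeller of that attractor.
\<close>

lemma attractors_not_crossing:
  assumes P: "pair A R U" and P': "pair A' R' U'"
    and m1: "AE \<omega> in M. fibre A \<omega> \<inter> fibre R' \<omega> \<noteq> {}" and m2: "AE \<omega> in M. fibre A' \<omega> \<inter> fibre R \<omega> \<noteq> {}"
  shows False
proof -
  define AA where "AA b = (if b then A else A')" for b
  define RR where "RR b = (if b then R else R')" for b
  define UU where "UU b = (if b then U else U')" for b
  have PP: "pair (AA b) (RR b) (UU b)" for b unfolding AA_def RR_def UU_def using P P' by simp
  note G = margin_events[OF P P pairD(3)[OF P]] and G' = margin_events[OF P' P' pairD(3)[OF P']]
  define H where "H m = margin A U m \<inter> margin A' U' m" for m
  have H1: "H m \<in> sets M" for m unfolding H_def using G(1) G'(1) by blast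
  have H2: "incseq H" using G(2) G'(2) unfolding H_def incseq_def by blast
  have H3: "AE \<omega> in M. \<exists>m. \<omega> \<in> H m"
    using G(3) G'(3)
  proof eventually_elim
    case (elim \<omega>)
    then obtain m m' where "\<omega> \<in> margin A U m" "\<omega> \<in> margin A' U' m'" by blast
    then have "\<omega> \<in> margin A U (max m m')" "\<omega> \<in> margin A' U' (max m m')"
      using incseqD[OF G(2), of m "max m m'"] incseqD[OF G'(2), of m' "max m m'"] by auto
    then show ?case unfolding H_def by blast
  qed
  have "AE \<omega> in M. False"
    using forward_good_times[of AA RR UU, OF PP H1 H2 H3] m1 m2 AE_space
      subspace_attractor[OF P] subspace_repeller[OF P] subspace_attractor[OF P'] subspace_repeller[OF P']
      attractor_Int_repeller[OF P] attractor_Int_repeller[OF P']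
  proof eventually_elim
    case (elim \<omega>)
    note w = elim(4)
    from elim(1) obtain m where m: "\<forall>K. (\<forall>b. compact (K b) \<and> K b \<inter> fibre (RR b) \<omega> = {}) \<longrightarrow>
      (\<forall>\<delta>>0. \<exists>n::nat. \<theta> n \<omega> \<in> H m \<and> (\<forall>b. semidist (\<phi> n \<omega> ` K b) (fibre (AA b) (\<theta> n \<omega>)) \<le> ereal \<delta>))"
      by (rule exE)
    obtain p where p: "p \<in> fibre A \<omega>" "p \<in> fibre R' \<omega>" using elim(2) by blast
    obtain q where q: "q \<in> fibre A' \<omega>" "q \<in> fibre R \<omega>" using elim(3) by blast
    obtain x where x: "norm x = 1" "p = abs_projective x" by (rule projective_cases)
    obtain y where y: "norm y = 1" "q = abs_projective y" by (rule projective_cases)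
    have nz: "x \<noteq> 0" "y \<noteq> 0" using x y by auto
    have xm: "x \<in> proj_vimage (fibre A \<omega>)" "x \<in> proj_vimage (fibre R' \<omega>)" "x \<notin> proj_vimage (fibre R \<omega>)"
      and ym: "y \<in> proj_vimage (fibre A' \<omega>)" "y \<in> proj_vimage (fibre R \<omega>)" "y \<notin> proj_vimage (fibre R' \<omega>)"
      using p q x y nz elim(9,10) by (auto simp: proj_vimage_iff)
    have zR: "x + y \<notin> proj_vimage (fibre R \<omega>)"
      using xm(3) ym(2) subspace_diff[OF elim(6), of "x + y" y] by auto
    have zR': "x + y \<notin> proj_vimage (fibre R' \<omega>)"
      using ym(3) xm(2) subspace_diff[OF elim(8), of "x + y" x] by auto
    have znz: "x + y \<noteq> 0" using zR by (metis zero_in_proj_vimage)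
    define \<epsilon> where "\<epsilon> = inverse (real (Suc m))"
    have e: "0 < \<epsilon>" "\<epsilon> \<le> 1" unfolding \<epsilon>_def by (auto simp: field_simps)
    have K: "\<forall>b. compact {abs_projective (x + y)} \<and> {abs_projective (x + y)} \<inter> fibre (RR b) \<omega> = {}"
      using zR zR' znz unfolding RR_def by (simp add: proj_vimage_iff)
    from m[rule_format, of "\<lambda>_. {abs_projective (x + y)}", OF K[rule_format], of "\<epsilon> / 16"] e(1) obtain n :: nat
      where n: "\<theta> n \<omega> \<in> H m"
        "\<And>b. semidist (\<phi> n \<omega> ` {abs_projective (x + y)}) (fibre (AA b) (\<theta> n \<omega>)) \<le> ereal (\<epsilon> / 16)" by auto
    define \<Psi> where "\<Psi> = \<Phi> n \<omega>"
    have inv: "invertible \<Psi>" unfolding \<Psi>_def by (rule invertible_Phi[OF nat_in_T w])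
    have nz': "\<Psi> *v x \<noteq> 0" "\<Psi> *v y \<noteq> 0" "\<Psi> *v x + \<Psi> *v y \<noteq> 0"
      using invertible_mult_eq_0[OF inv] nz znz by (simp_all flip: matrix_vector_right_distrib)
    have img: "\<phi> n \<omega> (abs_projective (x + y)) = abs_projective (\<Psi> *v x + \<Psi> *v y)"
      using phi_abs_projective[OF nat_in_T w znz, of n] unfolding \<Psi>_def matrix_vector_right_distrib .
    have lt: "\<epsilon> / 16 < \<epsilon> / 8" using e by simp
    obtain a where a: "a \<in> fibre A (\<theta> n \<omega>)" "dist (abs_projective (\<Psi> *v x + \<Psi> *v y)) a < \<epsilon> / 8"
      using semidist_leD[OF n(2)[of True] lt imageI[OF singletonI]] unfolding img AA_def by auto
    obtain a' where a': "a' \<in> fibre A' (\<theta> n \<omega>)" "dist (abs_projective (\<Psi> *v x + \<Psi> *v y)) a' < \<epsilon> / 8"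
      using semidist_leD[OF n(2)[of False] lt imageI[OF singletonI]] unfolding img AA_def by auto
    have sub: "subspace (proj_vimage (fibre D (\<theta> n \<omega>)))"
      if D: "subspace (proj_vimage (fibre D \<omega>))" "\<And>x. \<phi> n \<omega> x \<in> fibre D (\<theta> n \<omega>) \<longleftrightarrow> x \<in> fibre D \<omega>" for D
    proof -
      have iff: "\<Psi> *v v \<in> proj_vimage (fibre D (\<theta> n \<omega>)) \<longleftrightarrow> v \<in> proj_vimage (fibre D \<omega>)" for v
        unfolding \<Psi>_def by (rule Phi_proj_vimage_iff[OF w nat_in_T D(2)])
      have "proj_vimage (fibre D (\<theta> n \<omega>)) = (*v) \<Psi> ` proj_vimage (fibre D \<omega>)"
      proof (intro equalityI subsetI)
        fix v assume v: "v \<in> proj_vimage (fibre D (\<theta> n \<omega>))"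
        obtain v' where "v = \<Psi> *v v'"
          using inv by (metis invertible_def matrix_vector_mul_assoc matrix_vector_mul_lid)
        then show "v \<in> (*v) \<Psi> ` proj_vimage (fibre D \<omega>)" using v iff by blast
      qed (use iff in blast)
      then show ?thesis using linear_subspace_image[OF matrix_vector_mul_linear D(1)] by simp
    qed
    have small: "\<epsilon> / 8 \<le> 1 / 4" using e by simp
    have mg: "\<theta> n \<omega> \<in> margin A U m" "\<theta> n \<omega> \<in> margin A' U' m" using n(1) unfolding H_def by auto
    show False
    proof (cases "norm (\<Psi> *v x) \<le> norm (\<Psi> *v y)")
      case True
      have "\<Psi> *v x \<in> proj_vimage (fibre A (\<theta> n \<omega>))"
        unfolding \<Psi>_def using Phi_proj_vimage_iff[OF w nat_in_T attractor_step[OF P w nat_in_T]] xm(1) by simp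
      then obtain c where c: "c \<in> fibre A (\<theta> n \<omega>)" "dist c (abs_projective (\<Psi> *v y)) \<le> 4 * (\<epsilon> / 8)"
        using component_near_attractor[OF sub[OF elim(5) attractor_step[OF P w nat_in_T]] _ nz'(2,3) True a small] by blast
      have "abs_projective (\<Psi> *v y) \<in> fibre R (\<theta> n \<omega>)"
        using repeller_step[OF P w nat_in_T] q(2) phi_abs_projective[OF nat_in_T w nz(2)] unfolding y(2) \<Psi>_def by metis
      from margin_repeller_dist[OF P mg(1) c(1) this] show False using c(2) e unfolding \<epsilon>_def[symmetric] by simp
    next
      case False
      have nz2: "\<Psi> *v y + \<Psi> *v x \<noteq> 0" using nz'(3) by (simp add: add.commute)
      have "\<Psi> *v y \<in> proj_vimage (fibre A' (\<theta> n \<omega>))"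
        unfolding \<Psi>_def using Phi_proj_vimage_iff[OF w nat_in_T attractor_step[OF P' w nat_in_T]] ym(1) by simp
      then obtain c where c: "c \<in> fibre A' (\<theta> n \<omega>)" "dist c (abs_projective (\<Psi> *v x)) \<le> 4 * (\<epsilon> / 8)"
        using component_near_attractor[OF sub[OF elim(7) attractor_step[OF P' w nat_in_T]] _ nz'(1) nz2 _ a'(1) _ small]
          False a'(2) by (auto simp: add.commute)
      have "abs_projective (\<Psi> *v x) \<in> fibre R' (\<theta> n \<omega>)"
        using repeller_step[OF P' w nat_in_T] p(2) phi_abs_projective[OF nat_in_T w nz(1)] unfolding x(2) \<Psi>_def by metis
      from margin_repeller_dist[OF P' mg(2) c(1) this] show False using c(2) e unfolding \<epsilon>_def[symmetric] by simp
    qed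
  qed
  then show False by simp
qed

lemma attractors_totally_ordered:
  assumes "pair A R U" "pair A' R' U'"
  shows "(AE \<omega> in M. fibre A \<omega> \<subseteq> fibre A' \<omega>) \<or> (AE \<omega> in M. fibre A' \<omega> \<subseteq> fibre A \<omega>)"
  using attractor_subset_zero_one[OF assms] attractor_subset_zero_one[OF assms(2,1)]
    not_subset_imp_meets_repeller[OF assms] not_subset_imp_meets_repeller[OF assms(2,1)]
    attractors_not_crossing[OF assms] by blast

end

section \<open>Flags of subspaces\<close>

lemma flag_mono:
  fixes V :: "nat \<Rightarrow> 'v set"
  assumes "\<And>i. i < n \<Longrightarrow> V i \<subseteq> V (Suc i)" "i \<le> j" "j \<le> n"
  shows "V i \<subseteq> V j"
  using assms(2,3)
proof (induction j rule: dec_induct)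
  case (step k)
  then show ?case using assms(1)[of k] by auto
qed simp

text \<open>
  The modular law: \<open>V (Suc j) = V j \<oplus> (V (Suc j) \<inter> W j)\<close>, as
  \<open>V j\<close> is contained in \<open>V (Suc j)\<close> and \<open>W j\<close> is a
  complement of it.
\<close>

lemma flag_direct_sum:
  fixes V W :: "nat \<Rightarrow> 'v::real_vector set"
  assumes V: "\<And>i. i \<le> n \<Longrightarrow> subspace (V i)" and W: "\<And>i. i \<le> n \<Longrightarrow> subspace (W i)"
    and VW: "\<And>i. i \<le> n \<Longrightarrow> V i \<inter> W i = {0}"
    and sum: "\<And>i z. i \<le> n \<Longrightarrow> \<exists>v\<in>V i. \<exists>w\<in>W i. z = v + w"
    and inc: "\<And>i. i < n \<Longrightarrow> V i \<subseteq> V (Suc i)" and V0: "V 0 = {0}" and Vn: "V n = UNIV"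
  shows "is_direct_sum n (\<lambda>i. V i \<inter> W (i - 1))"
proof -
  let ?M = "\<lambda>i. V i \<inter> W (i - 1)"
  have M: "subspace (?M i)" if "i \<in> {1..n}" for i
    using that V[of i] W[of "i - 1"] by (auto intro: subspace_inter)
  have insert_Suc: "{1..Suc j} = insert (Suc j) {1..j}" for j by auto
  have ex: "\<exists>v. v \<in> (\<Pi>\<^sub>E i\<in>{1..j}. ?M i) \<and> (\<Sum>i = 1..j. v i) = x" if "j \<le> n" "x \<in> V j" for j x
    using that
  proof (induction j arbitrary: x)
    case 0
    then show ?case using V0 by (intro exI[of _ "\<lambda>_. undefined"]) auto
  next
    case (Suc j)
    obtain a w where aw: "a \<in> V j" "w \<in> W j" "x = a + w" using sum[of j x] Suc.prems by auto
    obtain v where v: "v \<in> (\<Pi>\<^sub>E i\<in>{1..j}. ?M i)" "(\<Sum>i = 1..j. v i) = a"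
      using Suc.IH[OF _ aw(1)] Suc.prems by auto
    have "a \<in> V (Suc j)" using inc[of j] aw(1) Suc.prems by auto
    then have "x - a \<in> V (Suc j)" using Suc.prems by (intro subspace_diff V) auto
    then have w: "w \<in> ?M (Suc j)" using aw by simp
    have "v(Suc j := w) \<in> (\<Pi>\<^sub>E i\<in>{1..Suc j}. ?M i)"
      unfolding insert_Suc by (rule PiE_fun_upd[OF w v(1)])
    moreover have "(\<Sum>i = 1..Suc j. (v(Suc j := w)) i) = x"
    proof -
      have "(\<Sum>i = 1..j. (v(Suc j := w)) i) = (\<Sum>i = 1..j. v i)" by (intro sum.cong) auto
      then show ?thesis using v(2) aw(3) by simp
    qed
    ultimately show ?case by blast
  qed
  have zero: "\<forall>i\<in>{1..j}. d i = 0"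
    if "j \<le> n" "\<forall>i\<in>{1..j}. d i \<in> ?M i" "(\<Sum>i = 1..j. d i) = 0" for j and d :: "nat \<Rightarrow> 'v"
    using that
  proof (induction j)
    case (Suc j)
    have "d i \<in> V j" if "i \<in> {1..j}" for i
    proof -
      have "V i \<subseteq> V j" using that Suc.prems(1) by (intro flag_mono[of n V, OF inc]) auto
      moreover have "d i \<in> V i" using Suc.prems(2) that by auto
      ultimately show ?thesis by blast
    qed
    then have "(\<Sum>i = 1..j. d i) \<in> V j" using Suc.prems(1) by (intro subspace_sum V) auto
    moreover have "d (Suc j) = - (\<Sum>i = 1..j. d i)"
      using Suc.prems(3) by (simp add: eq_neg_iff_add_eq_0 add.commute)
    ultimately have "d (Suc j) \<in> V j" using subspace_neg[OF V[of j]] Suc.prems(1) by simp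
    moreover have "d (Suc j) \<in> W j" using Suc.prems(2)[rule_format, of "Suc j"] by simp
    ultimately have d0: "d (Suc j) = 0" using VW[of j] Suc.prems(1) by auto
    have pm: "\<forall>i\<in>{1..j}. d i \<in> ?M i" using Suc.prems(2) unfolding insert_Suc by blast
    have "(\<Sum>i = 1..j. d i) = 0" using Suc.prems(3) d0 by simp
    from Suc.IH[OF Suc_leD[OF Suc.prems(1)] pm this] show ?case unfolding insert_Suc using d0 by simp
  qed simp
  show ?thesis
    unfolding is_direct_sum_def
  proof (intro conjI ballI allI M)
    fix x
    obtain v where v: "v \<in> (\<Pi>\<^sub>E i\<in>{1..n}. ?M i)" "(\<Sum>i = 1..n. v i) = x" using ex[of n x] Vn by auto
    show "\<exists>!v. v \<in> (\<Pi>\<^sub>E i\<in>{1..n}. ?M i) \<and> (\<Sum>i = 1..n. v i) = x"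
    proof (intro ex1I conjI)
      fix u assume u: "u \<in> (\<Pi>\<^sub>E i\<in>{1..n}. ?M i) \<and> (\<Sum>i = 1..n. u i) = x"
      have "\<forall>i\<in>{1..n}. u i - v i = 0"
      proof (rule zero)
        show "\<forall>i\<in>{1..n}. u i - v i \<in> ?M i"
          using u v by (intro ballI subspace_diff M) (auto simp: PiE_iff)
        show "(\<Sum>i = 1..n. u i - v i) = 0" using u v by (simp add: sum_subtractf)
      qed simp
      then show "u = v" using u v by (intro PiE_ext[of u _ ?M v]) auto
    qed (use v in auto)
  qed
qed

lemma strict_flag_length:
  fixes V :: "nat \<Rightarrow> 'v::euclidean_space set"
  assumes V: "\<And>i. i \<le> n \<Longrightarrow> subspace (V i)" and inc: "\<And>i. i < n \<Longrightarrow> V i \<subset> V (Suc i)"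
  shows "n \<le> DIM('v)"
proof -
  have "j \<le> dim (V j)" if "j \<le> n" for j
    using that
  proof (induction j)
    case (Suc j)
    have "span (V j) \<subset> span (V (Suc j))"
      using inc[of j] Suc.prems
      unfolding span_eq_iff[THEN iffD2, OF V[OF Suc.prems]] span_eq_iff[THEN iffD2, OF V[OF Suc_leD[OF Suc.prems]]]
      by simp
    then have "dim (V j) < dim (V (Suc j))" by (rule dim_psubset)
    then show ?case using Suc by simp
  qed simp
  then show ?thesis using dim_subset_UNIV[of "V n"] order_refl[of n] order_trans by blast
qed

lemma same_decomposition_sym:
  assumes "same_decomposition M n D m E"
  shows "same_decomposition M m E n D"
proof -
  obtain \<pi> where pi: "bij_betw \<pi> {1..n} {1..m}" "\<And>i. i \<in> {1..n} \<Longrightarrow> ae_equal M (D i) (E (\<pi> i))"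
    using assms unfolding same_decomposition_def by blast
  have "ae_equal M (E j) (D (inv_into {1..n} \<pi> j))" if j: "j \<in> {1..m}" for j
  proof -
    have im: "j \<in> \<pi> ` {1..n}" using pi(1) j unfolding bij_betw_def by blast
    have "ae_equal M (D (inv_into {1..n} \<pi> j)) (E j)"
      using pi(2)[OF inv_into_into[OF im]] unfolding f_inv_into_f[OF im] .
    then show ?thesis unfolding ae_equal_def by eventually_elim simp
  qed
  then show ?thesis
    unfolding same_decomposition_def using bij_betw_inv_into[OF pi(1)] by blast
qed

lemma same_decomposition_trans:
  assumes "same_decomposition M n D m E" "same_decomposition M m E l F"
  shows "same_decomposition M n D l F"
proof -
  obtain \<pi> where pi: "bij_betw \<pi> {1..n} {1..m}" "\<And>i. i \<in> {1..n} \<Longrightarrow> ae_equal M (D i) (E (\<pi> i))"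
    using assms(1) unfolding same_decomposition_def by blast
  obtain \<rho> where rho: "bij_betw \<rho> {1..m} {1..l}" "\<And>i. i \<in> {1..m} \<Longrightarrow> ae_equal M (E i) (F (\<rho> i))"
    using assms(2) unfolding same_decomposition_def by blast
  have "ae_equal M (D i) (F ((\<rho> \<circ> \<pi>) i))" if i: "i \<in> {1..n}" for i
  proof -
    have "\<pi> i \<in> {1..m}" using bij_betwE[OF pi(1)] i by blast
    from rho(2)[OF this] pi(2)[OF i] show ?thesis
      unfolding ae_equal_def comp_def by eventually_elim simp
  qed
  then show ?thesis
    unfolding same_decomposition_def using bij_betw_trans[OF pi(1) rho(1)] by blast
qed

lemma fibre_Int: "fibre (D \<inter> E) \<omega> = fibre D \<omega> \<inter> fibre E \<omega>"
  by (auto simp: fibre_def)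

section \<open>Chains of attractors and the finest decomposition\<close>

context linear_rds
begin

lemma weak_attractor_repeller_pair_iff:
  "weak_attractor_repeller_pair M T \<theta> \<phi> A R \<longleftrightarrow> (\<exists>U. pair A R U)"
  unfolding weak_attractor_repeller_pair_def local_weak_attractor_def pair_def by blast

lemma pair_empty: "pair {} (UNIV \<times> space M) {}"
  unfolding pair_def attractor_neighbourhood_def compact_random_set_def open_random_set_def
    random_set_def invariant_def forward_invariant_def basin_def fibre_def
  by (auto simp: semidist_def)

lemma pair_UNIV: "pair (UNIV \<times> space M) {} (UNIV \<times> space M)"
proof -
  let ?X = "UNIV \<times> space M :: ('n projective \<times> 'w) set"
  have X: "random_set M ?X" unfolding random_set_def by (intro pair_measureI) auto
  have f: "fibre ?X \<omega> = UNIV" if "\<omega> \<in> space M" for \<omega> using that unfolding fibre_def by auto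
  have le0: "semidist P UNIV \<le> 0" for P :: "'n projective set"
  proof -
    have "(INF b. ereal (dist a b)) \<le> 0" for a :: "'n projective"
      by (rule INF_lower2[of a]) auto
    then show ?thesis unfolding semidist_def by (auto intro: SUP_least)
  qed
  have "compact_random_set M ?X" "open_random_set M ?X"
    unfolding compact_random_set_def open_random_set_def using X f compact_UNIV_projective by auto
  moreover have "invariant M T \<theta> \<phi> ?X"
    unfolding invariant_def
  proof (intro ballI)
    fix \<omega> t assume w: "\<omega> \<in> space M" and t: "t \<in> T"
    have "p \<in> range (\<phi> t \<omega>)" for p
      using phi_minus'[OF t theta_space[OF t w], of p] theta_minus[OF t w] by (metis rangeI)
    then show "\<phi> t \<omega> ` fibre ?X \<omega> = fibre ?X (\<theta> t \<omega>)" using f w t by auto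
  qed
  moreover have fwd: "forward_invariant M T \<theta> \<phi> ?X"
    unfolding forward_invariant_def using f by auto
  have never: "{\<omega> \<in> space M. semidist (\<phi> t \<omega> ` fibre C \<omega>) (fibre ?X (\<theta> t \<omega>)) > ereal \<epsilon>} = {}"
    if "t \<in> T" "0 < \<epsilon>" for t \<epsilon> and C :: "('n projective \<times> 'w) set"
  proof -
    have "\<not> ereal \<epsilon> < semidist (\<phi> t \<omega> ` fibre C \<omega>) (fibre ?X (\<theta> t \<omega>))" if "\<omega> \<in> space M" for \<omega>
      using le0[of "\<phi> t \<omega> ` fibre C \<omega>"] f[OF theta_space[OF \<open>t \<in> T\<close> that]] \<open>0 < \<epsilon>\<close>
      by (metis ereal_less(2) leD less_le_trans order_less_imp_le)
    then show ?thesis by blast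
  qed
  moreover have "((\<lambda>t. outer_measure_of M {\<omega> \<in> space M. semidist (\<phi> t \<omega> ` fibre C \<omega>) (fibre ?X (\<theta> t \<omega>)) > ereal \<epsilon>})
      \<longlongrightarrow> 0) (inf at_top (principal T))" if "0 < \<epsilon>" for \<epsilon> and C :: "('n projective \<times> 'w) set"
  proof (intro tendsto_eventually)
    show "\<forall>\<^sub>F t in inf at_top (principal T).
      outer_measure_of M {\<omega> \<in> space M. semidist (\<phi> t \<omega> ` fibre C \<omega>) (fibre ?X (\<theta> t \<omega>)) > ereal \<epsilon>} = 0"
      unfolding eventually_inf_principal
      by (intro always_eventually allI impI) (simp only: never[OF _ that] outer_measure_of_eq[OF sets.empty_sets] emeasure_empty)
  qed
  moreover have "basin M T \<theta> \<phi> ?X = ?X"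
    using nat_in_T[of 0] f unfolding basin_def by (auto intro!: bexI[of _ 0] simp: theta_zero)
  ultimately show ?thesis
    using fwd unfolding pair_def attractor_neighbourhood_def by auto
qed

definition attractor_chain where
  "attractor_chain n A R \<longleftrightarrow> (\<forall>i\<le>n. \<exists>U. pair (A i) (R i) U) \<and>
    (AE \<omega> in M. fibre (A 0) \<omega> = {} \<and> (\<forall>i<n. fibre (A i) \<omega> \<subset> fibre (A (Suc i)) \<omega>) \<and> fibre (A n) \<omega> = UNIV)"

lemma weak_morse_decomposition_iff:
  "weak_morse_decomposition M T \<theta> \<phi> n D \<longleftrightarrow>
    (\<exists>A R. attractor_chain n A R \<and> (\<forall>i\<in>{1..n}. D i = A i \<inter> R (i - 1)))"
proof -
  have "(\<forall>i\<in>{0..n}. P i) \<longleftrightarrow> (\<forall>i\<le>n. P i)" for P by auto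
  then show ?thesis
    unfolding weak_morse_decomposition_def attractor_chain_def weak_attractor_repeller_pair_iff
    by (simp only: conj_assoc)
qed

lemma attractor_chain_linear:
  assumes "attractor_chain n A R"
  shows "AE \<omega> in M. (\<forall>i\<le>n. subspace (proj_vimage (fibre (A i) \<omega>)) \<and> subspace (proj_vimage (fibre (R i) \<omega>)) \<and>
      proj_vimage (fibre (A i) \<omega>) \<inter> proj_vimage (fibre (R i) \<omega>) = {0} \<and>
      (\<forall>z. \<exists>v\<in>proj_vimage (fibre (A i) \<omega>). \<exists>w\<in>proj_vimage (fibre (R i) \<omega>). z = v + w)) \<and>
    proj_vimage (fibre (A 0) \<omega>) = {0} \<and> proj_vimage (fibre (A n) \<omega>) = UNIV \<and>
    (\<forall>i<n. proj_vimage (fibre (A i) \<omega>) \<subset> proj_vimage (fibre (A (Suc i)) \<omega>))"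
proof -
  have "AE \<omega> in M. subspace (proj_vimage (fibre (A i) \<omega>)) \<and> subspace (proj_vimage (fibre (R i) \<omega>)) \<and>
      proj_vimage (fibre (A i) \<omega>) \<inter> proj_vimage (fibre (R i) \<omega>) = {0} \<and>
      (\<forall>z. \<exists>v\<in>proj_vimage (fibre (A i) \<omega>). \<exists>w\<in>proj_vimage (fibre (R i) \<omega>). z = v + w)"
    if i: "i \<in> {..n}" for i
  proof -
    obtain U where P: "pair (A i) (R i) U" using assms i unfolding attractor_chain_def by blast
    show ?thesis
      using subspace_attractor[OF P] subspace_repeller[OF P] attractor_Int_repeller[OF P] attractor_plus_repeller[OF P]
    proof eventually_elim
      case (elim \<omega>)
      then show ?case by (simp only: proj_vimage_empty flip: proj_vimage_Int) simp
    qed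
  qed
  then have "AE \<omega> in M. \<forall>i\<in>{..n}. subspace (proj_vimage (fibre (A i) \<omega>)) \<and> subspace (proj_vimage (fibre (R i) \<omega>)) \<and>
      proj_vimage (fibre (A i) \<omega>) \<inter> proj_vimage (fibre (R i) \<omega>) = {0} \<and>
      (\<forall>z. \<exists>v\<in>proj_vimage (fibre (A i) \<omega>). \<exists>w\<in>proj_vimage (fibre (R i) \<omega>). z = v + w)"
    by (intro AE_finite_allI) auto
  moreover have "AE \<omega> in M. fibre (A 0) \<omega> = {} \<and> (\<forall>i<n. fibre (A i) \<omega> \<subset> fibre (A (Suc i)) \<omega>) \<and> fibre (A n) \<omega> = UNIV"
    using assms unfolding attractor_chain_def by blast
  ultimately show ?thesis
  proof eventually_elim
    case (elim \<omega>)
    have "proj_vimage (fibre (A i) \<omega>) \<subset> proj_vimage (fibre (A (Suc i)) \<omega>)" if "i < n" for i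
      using elim(2) that proj_vimage_subset_iff unfolding less_le_not_le by metis
    then show ?case using elim by (simp add: proj_vimage_empty proj_vimage_UNIV)
  qed
qed

lemma attractor_chain_length:
  assumes "attractor_chain n A R"
  shows "n \<le> CARD('n)"
proof -
  have "AE \<omega> in M. n \<le> CARD('n)"
    using attractor_chain_linear[OF assms]
  proof eventually_elim
    case (elim \<omega>)
    then show ?case
      using strict_flag_length[of n "\<lambda>i. proj_vimage (fibre (A i) \<omega>)"] by simp
  qed
  then show ?thesis by (simp only: AE_const)
qed

lemma attractor_chain_direct_sum:
  assumes "attractor_chain n A R" "\<forall>i\<in>{1..n}. D i = A i \<inter> R (i - 1)"
  shows "AE \<omega> in M. is_direct_sum n (\<lambda>i. proj_vimage (fibre (D i) \<omega>))"
  using attractor_chain_linear[OF assms(1)]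
proof eventually_elim
  case (elim \<omega>)
  let ?V = "\<lambda>i. proj_vimage (fibre (A i) \<omega>)" and ?W = "\<lambda>i. proj_vimage (fibre (R i) \<omega>)"
  have "is_direct_sum n (\<lambda>i. ?V i \<inter> ?W (i - 1))"
    using elim by (intro flag_direct_sum) auto
  moreover have eq: "?V i \<inter> ?W (i - 1) = proj_vimage (fibre (D i) \<omega>)" if "i \<in> {1..n}" for i
    using assms(2) that by (simp only: proj_vimage_Int[symmetric] fibre_Int)
  moreover have "(\<Pi>\<^sub>E i\<in>{1..n}. ?V i \<inter> ?W (i - 1)) = (\<Pi>\<^sub>E i\<in>{1..n}. proj_vimage (fibre (D i) \<omega>))"
    by (rule PiE_cong) (rule eq)
  ultimately show ?case unfolding is_direct_sum_def by simp
qed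

text \<open>
  Nonempty and pairwise disjoint Morse sets make \<open>finer\<close> antisymmetric.
\<close>

lemma attractor_chain_Morse_sets:
  assumes "attractor_chain n A R" "\<forall>i\<in>{1..n}. D i = A i \<inter> R (i - 1)"
  shows "AE \<omega> in M. \<forall>i\<in>{1..n}. fibre (D i) \<omega> \<noteq> {} \<and> (\<forall>k\<in>{1..n}. i \<noteq> k \<longrightarrow> fibre (D i) \<omega> \<inter> fibre (D k) \<omega> = {})"
  using attractor_chain_linear[OF assms(1)]
proof eventually_elim
  case (elim \<omega>)
  let ?V = "\<lambda>i. proj_vimage (fibre (A i) \<omega>)" and ?W = "\<lambda>i. proj_vimage (fibre (R i) \<omega>)"
  have D: "fibre (D i) \<omega> = fibre (A i) \<omega> \<inter> fibre (R (i - 1)) \<omega>" if "i \<in> {1..n}" for i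
    using assms(2) that by (auto simp: fibre_def)
  have V: "subspace (?V i)" and VW: "?V i \<inter> ?W i = {0}"
    and total: "\<exists>v\<in>?V i. \<exists>w\<in>?W i. z = v + w" if "i \<le> n" for i z
    using conjunct1[OF elim, rule_format, OF that] by simp_all
  have step: "?V i \<subset> ?V (Suc i)" if "i < n" for i
    using elim that by simp
  have ne: "fibre (D i) \<omega> \<noteq> {}" if i: "i \<in> {1..n}" for i
  proof -
    have "i - 1 < n" "Suc (i - 1) = i" "i - 1 \<le> n" using i by auto
    then have "?V (i - 1) \<subset> ?V i" using step[of "i - 1"] by simp
    then obtain x where x: "x \<in> ?V i" "x \<notin> ?V (i - 1)" by blast
    obtain a w where aw: "a \<in> ?V (i - 1)" "w \<in> ?W (i - 1)" "x = a + w"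
      using total[OF \<open>i - 1 \<le> n\<close>, of x] by blast
    have "a \<in> ?V i" using aw(1) \<open>?V (i - 1) \<subset> ?V i\<close> by blast
    then have "x - a \<in> ?V i" using i x(1) by (intro subspace_diff V) auto
    then have "w \<in> ?V i" using aw(3) by simp
    moreover have "w \<noteq> 0" using aw x by auto
    ultimately have "abs_projective w \<in> fibre (D i) \<omega>"
      using aw(2) D[OF i] by (simp add: proj_vimage_iff)
    then show ?thesis by blast
  qed
  have dis: "fibre (D i) \<omega> \<inter> fibre (D k) \<omega> = {}" if "i \<in> {1..n}" "k \<in> {1..n}" "i < k" for i k
  proof -
    have "?V i \<subseteq> ?V (k - 1)"
      using that by (intro flag_mono[of n ?V, OF psubset_imp_subset[OF step]]) auto
    then have "fibre (A i) \<omega> \<subseteq> fibre (A (k - 1)) \<omega>" using proj_vimage_subset_iff by blast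
    moreover have "?V (k - 1) \<inter> ?W (k - 1) = {0}" using VW that by simp
    then have "fibre (A (k - 1)) \<omega> \<inter> fibre (R (k - 1)) \<omega> = {}"
      using proj_vimage_subset_iff[of "fibre (A (k - 1)) \<omega> \<inter> fibre (R (k - 1)) \<omega>" "{}"]
      by (simp add: proj_vimage_Int proj_vimage_empty)
    ultimately show ?thesis using D that by blast
  qed
  show ?case
  proof (intro ballI conjI impI ne)
    fix i k assume "i \<in> {1..n}" "k \<in> {1..n}" "i \<noteq> k"
    then show "fibre (D i) \<omega> \<inter> fibre (D k) \<omega> = {}" using dis[of i k] dis[of k i] by (metis Int_commute nat_neq_iff)
  qed
qed

definition maximal_chain where
  "maximal_chain N A R \<longleftrightarrow> attractor_chain N A R \<and> (\<forall>n A' R'. attractor_chain n A' R' \<longrightarrow> n \<le> N)"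

lemma maximal_chain_exists: "\<exists>N A R. maximal_chain N A R"
proof -
  define S where "S = {n. \<exists>A R. attractor_chain n A R}"
  have "attractor_chain 1 (\<lambda>i. if i = 0 then {} else UNIV \<times> space M) (\<lambda>i. if i = 0 then UNIV \<times> space M else {})"
    unfolding attractor_chain_def
  proof (intro conjI allI impI)
    fix i :: nat
    show "\<exists>U. pair (if i = 0 then {} else UNIV \<times> space M) (if i = 0 then UNIV \<times> space M else {}) U"
      using pair_empty pair_UNIV by (cases "i = 0") auto
  next
    show "AE \<omega> in M. fibre (if (0::nat) = 0 then {} else UNIV \<times> space M) \<omega> = ({} :: 'n projective set) \<and>
      (\<forall>i<1. fibre (if i = 0 then {} else UNIV \<times> space M) \<omega> \<subset>
        fibre (if Suc i = 0 then {} else UNIV \<times> space M) \<omega>) \<and>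
      fibre (if (1::nat) = 0 then {} else UNIV \<times> space M) \<omega> = (UNIV :: 'n projective set)"
      by (rule AE_I2) (auto simp: fibre_def)
  qed
  then have "S \<noteq> {}" unfolding S_def by blast
  moreover have "finite S"
  proof (rule finite_subset)
    show "S \<subseteq> {..CARD('n)}"
    proof
      fix n assume "n \<in> S"
      then obtain A R where "attractor_chain n A R" unfolding S_def by blast
      then show "n \<in> {..CARD('n)}" using attractor_chain_length by simp
    qed
  qed simp
  ultimately have "Max S \<in> S" "\<And>n. n \<in> S \<Longrightarrow> n \<le> Max S" by auto
  then show ?thesis unfolding maximal_chain_def S_def by blast
qed

lemma attractor_chain_step:
  assumes "attractor_chain n A R"
  shows "AE \<omega> in M. \<forall>i<n. fibre (A i) \<omega> \<subset> fibre (A (Suc i)) \<omega>"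
proof -
  have "AE \<omega> in M. fibre (A 0) \<omega> = {} \<and> (\<forall>i<n. fibre (A i) \<omega> \<subset> fibre (A (Suc i)) \<omega>) \<and> fibre (A n) \<omega> = UNIV"
    using assms unfolding attractor_chain_def by (rule conjunct2)
  then show ?thesis by eventually_elim (elim conjE)
qed

lemma attractor_chain_mono:
  assumes "attractor_chain n A R" "i \<le> j" "j \<le> n"
  shows "AE \<omega> in M. fibre (A i) \<omega> \<subseteq> fibre (A j) \<omega>"
  using attractor_chain_step[OF assms(1)]
proof eventually_elim
  case (elim \<omega>)
  show ?case
    using elim by (intro flag_mono[of n "\<lambda>i. fibre (A i) \<omega>", OF _ assms(2,3)]) blast
qed

lemma attractor_chain_strict:
  assumes c: "attractor_chain n A R" and "i < j" "j \<le> n"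
  shows "\<not> (AE \<omega> in M. fibre (A j) \<omega> \<subseteq> fibre (A i) \<omega>)"
proof
  assume a: "AE \<omega> in M. fibre (A j) \<omega> \<subseteq> fibre (A i) \<omega>"
  have b: "AE \<omega> in M. fibre (A (Suc i)) \<omega> \<subseteq> fibre (A j) \<omega>"
    using assms by (intro attractor_chain_mono) auto
  have "i < n" using assms by simp
  have "AE \<omega> in M. False"
    using a b attractor_chain_step[OF c]
  proof eventually_elim
    case (elim \<omega>)
    have "fibre (A i) \<omega> \<subset> fibre (A (Suc i)) \<omega>" using elim(3) \<open>i < n\<close> by blast
    then show False using elim(1,2) by blast
  qed
  then show False by simp
qed

text \<open>
  The attractor \<open>A'\<close> is comparable with all members of the chain. If it agrees with
  none of them, it lies strictly between two neighbours and extends the chain.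
\<close>

lemma maximal_chain_complete:
  assumes m: "maximal_chain N A R" and P': "pair A' R' U'"
  shows "\<exists>i\<le>N. AE \<omega> in M. fibre A' \<omega> = fibre (A i) \<omega>"
proof (rule ccontr)
  assume none: "\<not> ?thesis"
  have c: "attractor_chain N A R" using m unfolding maximal_chain_def by blast
  then have pairs: "\<And>i. i \<le> N \<Longrightarrow> \<exists>U. pair (A i) (R i) U"
    and c0: "AE \<omega> in M. fibre (A 0) \<omega> = {} \<and> (\<forall>i<N. fibre (A i) \<omega> \<subset> fibre (A (Suc i)) \<omega>) \<and> fibre (A N) \<omega> = UNIV"
    unfolding attractor_chain_def by blast+
  let ?Q = "\<lambda>i. \<not> (AE \<omega> in M. fibre (A i) \<omega> \<subseteq> fibre A' \<omega>)"
  have not_both: False if "i \<le> N" "AE \<omega> in M. fibre (A i) \<omega> \<subseteq> fibre A' \<omega>" "AE \<omega> in M. fibre A' \<omega> \<subseteq> fibre (A i) \<omega>" for i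
  proof -
    have "AE \<omega> in M. fibre A' \<omega> = fibre (A i) \<omega>" using that(2,3) by eventually_elim blast
    then show False using none that(1) by blast
  qed
  have "AE \<omega> in M. fibre (A 0) \<omega> \<subseteq> fibre A' \<omega>" using c0 by eventually_elim simp
  then have "\<not> ?Q 0" by blast
  moreover have "?Q N"
  proof
    assume a: "AE \<omega> in M. fibre (A N) \<omega> \<subseteq> fibre A' \<omega>"
    have "AE \<omega> in M. fibre A' \<omega> \<subseteq> fibre (A N) \<omega>" using c0 by eventually_elim blast
    then show False using not_both[OF order_refl a] by blast
  qed
  ultimately obtain k where k: "k < N" "\<not> ?Q k" "?Q (Suc k)" using ex_least_nat_less[of ?Q N] by blast
  obtain U where P: "pair (A k) (R k) U" using pairs k(1) by fastforce
  obtain U1 where P1: "pair (A (Suc k)) (R (Suc k)) U1" using pairs k(1) by (meson Suc_leI)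
  have up: "AE \<omega> in M. fibre A' \<omega> \<subseteq> fibre (A (Suc k)) \<omega>"
    using attractors_totally_ordered[OF P1 P'] k(3) by blast
  have lo: "AE \<omega> in M. fibre (A k) \<omega> \<subseteq> fibre A' \<omega>" using k(2) by blast
  \<comment> \<open>By the zero-one law a failing inclusion fails almost surely, so the new inclusions are
    strict almost surely.\<close>
  have ns: "AE \<omega> in M. \<not> fibre A' \<omega> \<subseteq> fibre (A k) \<omega>"
    using attractor_subset_zero_one[OF P' P] not_both[OF less_imp_le[OF k(1)] lo] by blast
  have ns1: "AE \<omega> in M. \<not> fibre (A (Suc k)) \<omega> \<subseteq> fibre A' \<omega>"
    using attractor_subset_zero_one[OF P1 P'] k(3) by blast
  define B where "B j = (if j \<le> k then A j else if j = Suc k then A' else A (j - 1))" for j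
  define S where "S j = (if j \<le> k then R j else if j = Suc k then R' else R (j - 1))" for j
  have "attractor_chain (Suc N) B S"
    unfolding attractor_chain_def
  proof (intro conjI allI impI)
    fix i assume "i \<le> Suc N"
    then show "\<exists>U. pair (B i) (S i) U"
      using pairs[of i] pairs[of "i - 1"] P' k(1) unfolding B_def S_def by auto
  next
    show "AE \<omega> in M. fibre (B 0) \<omega> = {} \<and> (\<forall>i<Suc N. fibre (B i) \<omega> \<subset> fibre (B (Suc i)) \<omega>) \<and> fibre (B (Suc N)) \<omega> = UNIV"
      using c0 up ns ns1 lo
    proof eventually_elim
      case (elim \<omega>)
      have "fibre (B i) \<omega> \<subset> fibre (B (Suc i)) \<omega>" if "i < Suc N" for i
      proof -
        consider "i < k" | "i = k" | "i = Suc k" | "Suc k < i" by linarith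
        then show ?thesis
        proof cases
          case 1 then show ?thesis using elim(1) k(1) unfolding B_def by simp
        next
          case 2 then show ?thesis using elim(3,5) unfolding B_def by auto
        next
          case 3 then show ?thesis using elim(2,4) unfolding B_def by auto
        next
          case 4
          then have "i - 1 < N" "Suc (i - 1) = i" using that by auto
          then have "fibre (A (i - 1)) \<omega> \<subset> fibre (A i) \<omega>" using elim(1) by metis
          then show ?thesis using 4 unfolding B_def by simp
        qed
      qed
      then show ?case using elim(1) k(1) unfolding B_def by simp
    qed
  qed
  then have "Suc N \<le> N" using m unfolding maximal_chain_def by blast
  then show False by simp
qed

text \<open>
  Every chain is, up to null sets, a subchain of the maximal one. Its attractor
  \<open>B j\<close> is \<open>A (f j)\<close>, and its previous attractor
  \<open>B (j - 1)\<close> is contained in \<open>A (f j - 1)\<close>, which reverses the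
  inclusion of the repellers.
\<close>

lemma maximal_chain_embeds:
  assumes m: "maximal_chain N A R" and D: "\<forall>i\<in>{1..N}. D i = A i \<inter> R (i - 1)"
    and c: "attractor_chain n B S" and E: "\<forall>i\<in>{1..n}. E i = B i \<inter> S (i - 1)"
  obtains f where "strict_mono_on {..n} f" "\<And>j. j \<in> {1..n} \<Longrightarrow> f j \<in> {1..N}"
    "\<And>j. j \<in> {1..n} \<Longrightarrow> AE \<omega> in M. fibre (D (f j)) \<omega> \<subseteq> fibre (E j) \<omega>"
proof -
  have cA: "attractor_chain N A R" using m unfolding maximal_chain_def by blast
  have pairA: "\<And>i. i \<le> N \<Longrightarrow> \<exists>U. pair (A i) (R i) U" using cA unfolding attractor_chain_def by blast
  have pairB: "\<And>i. i \<le> n \<Longrightarrow> \<exists>U. pair (B i) (S i) U" using c unfolding attractor_chain_def by blast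
  have "\<forall>j. \<exists>i. j \<le> n \<longrightarrow> i \<le> N \<and> (AE \<omega> in M. fibre (B j) \<omega> = fibre (A i) \<omega>)"
    using maximal_chain_complete[OF m] pairB by blast
  from choice[OF this] obtain f
    where f: "\<And>j. j \<le> n \<Longrightarrow> f j \<le> N" "\<And>j. j \<le> n \<Longrightarrow> AE \<omega> in M. fibre (B j) \<omega> = fibre (A (f j)) \<omega>" by blast
  have mono: "f j < f k" if "j < k" "k \<le> n" for j k
  proof (rule ccontr)
    assume "\<not> f j < f k"
    then have "AE \<omega> in M. fibre (A (f k)) \<omega> \<subseteq> fibre (A (f j)) \<omega>"
      using that f(1) by (intro attractor_chain_mono[OF cA]) auto
    moreover have "AE \<omega> in M. fibre (B j) \<omega> = fibre (A (f j)) \<omega>" "AE \<omega> in M. fibre (B k) \<omega> = fibre (A (f k)) \<omega>"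
      using that by (auto intro!: f(2))
    ultimately have "AE \<omega> in M. fibre (B k) \<omega> \<subseteq> fibre (B j) \<omega>" by eventually_elim simp
    then show False using attractor_chain_strict[OF c that] by blast
  qed
  show ?thesis
  proof (rule that)
    show "strict_mono_on {..n} f" using mono by (intro strict_mono_onI) auto
    fix j assume j: "j \<in> {1..n}"
    have "f (j - 1) < f j" using j by (intro mono) auto
    then show fj: "f j \<in> {1..N}" using f(1)[of j] j by auto
    have eq: "AE \<omega> in M. fibre (B (j - 1)) \<omega> = fibre (A (f (j - 1))) \<omega>" using j by (intro f(2)) auto
    have "AE \<omega> in M. fibre (A (f (j - 1))) \<omega> \<subseteq> fibre (A (f j - 1)) \<omega>"
      using \<open>f (j - 1) < f j\<close> fj by (intro attractor_chain_mono[OF cA]) auto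
    with eq have sub: "AE \<omega> in M. fibre (B (j - 1)) \<omega> \<subseteq> fibre (A (f j - 1)) \<omega>" by eventually_elim blast
    obtain U where U: "pair (B (j - 1)) (S (j - 1)) U" using pairB[of "j - 1"] j by fastforce
    obtain U' where U': "pair (A (f j - 1)) (R (f j - 1)) U'" using pairA[of "f j - 1"] fj by fastforce
    have "AE \<omega> in M. fibre (B j) \<omega> = fibre (A (f j)) \<omega>" using j by (intro f(2)) auto
    with subset_imp_repeller_supset[OF U U' sub]
    show "AE \<omega> in M. fibre (D (f j)) \<omega> \<subseteq> fibre (E j) \<omega>"
    proof eventually_elim
      case (elim \<omega>)
      have "D (f j) = A (f j) \<inter> R (f j - 1)" "E j = B j \<inter> S (j - 1)" using D E fj j by blast+
      then show ?case using elim unfolding fibre_def by blast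
    qed
  qed
qed

lemma maximal_chain_finer:
  assumes m: "maximal_chain N A R" and D: "\<forall>i\<in>{1..N}. D i = A i \<inter> R (i - 1)"
    and E: "weak_morse_decomposition M T \<theta> \<phi> n E"
  shows "finer M N D n E"
proof -
  obtain B S where BS: "attractor_chain n B S" "\<forall>i\<in>{1..n}. E i = B i \<inter> S (i - 1)"
    using E unfolding weak_morse_decomposition_iff by blast
  show ?thesis
    using maximal_chain_embeds[OF m D BS] unfolding finer_def by metis
qed

text \<open>
  If \<open>E\<close> is finer than \<open>D\<close>, then
  \<open>D (f j) \<subseteq> E j \<subseteq> D i\<close> for suitable indices. As Morse sets are
  nonempty and disjoint, \<open>i = f j\<close> and all inclusions are equalities.
\<close>

lemma maximal_chain_finest:
  assumes m: "maximal_chain N A R" and D: "\<forall>i\<in>{1..N}. D i = A i \<inter> R (i - 1)"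
  shows "finest_weak_morse_decomposition M T \<theta> \<phi> N D"
  unfolding finest_weak_morse_decomposition_def
proof (intro conjI allI impI)
  have cA: "attractor_chain N A R" using m unfolding maximal_chain_def by blast
  then show "weak_morse_decomposition M T \<theta> \<phi> N D" unfolding weak_morse_decomposition_iff using D by blast
  fix n E assume "weak_morse_decomposition M T \<theta> \<phi> n E \<and> finer M n E N D"
  then obtain B S where BS: "attractor_chain n B S" "\<forall>i\<in>{1..n}. E i = B i \<inter> S (i - 1)"
    and fin: "finer M n E N D"
    unfolding weak_morse_decomposition_iff by blast
  obtain f where f: "strict_mono_on {..n} f" "\<And>j. j \<in> {1..n} \<Longrightarrow> f j \<in> {1..N}"
    "\<And>j. j \<in> {1..n} \<Longrightarrow> AE \<omega> in M. fibre (D (f j)) \<omega> \<subseteq> fibre (E j) \<omega>"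
    using maximal_chain_embeds[OF m D BS] by blast
  have inj: "inj_on f {1..n}"
    using strict_mono_on_imp_inj_on[OF f(1)] by (rule inj_on_subset) auto
  have covered: "\<exists>j\<in>{1..n}. f j = i \<and> (AE \<omega> in M. fibre (E j) \<omega> \<subseteq> fibre (D i) \<omega>)" if i: "i \<in> {1..N}" for i
  proof -
    obtain j where j: "j \<in> {1..n}" "AE \<omega> in M. fibre (E j) \<omega> \<subseteq> fibre (D i) \<omega>"
      using fin i unfolding finer_def by blast
    have "AE \<omega> in M. fibre (D (f j)) \<omega> \<subseteq> fibre (D i) \<omega> \<and> fibre (D (f j)) \<omega> \<noteq> {} \<and>
      (f j \<noteq> i \<longrightarrow> fibre (D (f j)) \<omega> \<inter> fibre (D i) \<omega> = {})"
      using j(2) f(3)[OF j(1)] attractor_chain_Morse_sets[OF cA D]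
      by eventually_elim (use f(2)[OF j(1)] i in blast)
    then have "AE \<omega> in M. f j = i" by eventually_elim blast
    then have "f j = i" by (simp only: AE_const)
    then show ?thesis using j by blast
  qed
  have "bij_betw f {1..n} {1..N}"
    unfolding bij_betw_def using inj f(2) covered by blast
  moreover have "ae_equal M (E j) (D (f j))" if j: "j \<in> {1..n}" for j
  proof -
    obtain j' where "j' \<in> {1..n}" "f j' = f j" "AE \<omega> in M. fibre (E j') \<omega> \<subseteq> fibre (D (f j)) \<omega>"
      using covered[OF f(2)[OF j]] by blast
    then have "AE \<omega> in M. fibre (E j) \<omega> \<subseteq> fibre (D (f j)) \<omega>" using inj_onD[OF inj] j by blast
    with f(3)[OF j] show ?thesis unfolding ae_equal_def by eventually_elim blast
  qed
  ultimately show "same_decomposition M n E N D" unfolding same_decomposition_def by blast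
qed

end

theorem theorem3p6:
  fixes M :: "'w measure" and T :: "real set" and \<theta> :: "real \<Rightarrow> 'w \<Rightarrow> 'w"
    and \<Phi> :: "real \<Rightarrow> 'w \<Rightarrow> real ^ 'n ^ 'n"
  assumes "linear_rds M T \<theta> \<Phi>"
  shows "(\<exists>n D. finest_weak_morse_decomposition M T \<theta> (projectivisation \<Phi>) n D) \<and>
    (\<forall>n D m E. finest_weak_morse_decomposition M T \<theta> (projectivisation \<Phi>) n D \<and>
      finest_weak_morse_decomposition M T \<theta> (projectivisation \<Phi>) m E \<longrightarrow> same_decomposition M n D m E) \<and>
    (\<forall>n D. finest_weak_morse_decomposition M T \<theta> (projectivisation \<Phi>) n D \<longrightarrow>
      n \<le> CARD('n) \<and>
      (AE \<omega> in M. is_direct_sum n (\<lambda>i. proj_vimage (fibre (D i) \<omega>))))"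
proof -
  interpret linear_rds M T \<theta> \<Phi> by fact
  obtain N A R where m: "maximal_chain N A R" using maximal_chain_exists by blast
  define D where "D i = A i \<inter> R (i - 1)" for i
  have D: "\<forall>i\<in>{1..N}. D i = A i \<inter> R (i - 1)" unfolding D_def by blast
  have D_morse: "weak_morse_decomposition M T \<theta> \<phi> N D"
    and D_finest: "finest_weak_morse_decomposition M T \<theta> \<phi> N D"
    using maximal_chain_finest[OF m D] unfolding finest_weak_morse_decomposition_def by blast+
  have same: "same_decomposition M N D n E" if E: "finest_weak_morse_decomposition M T \<theta> \<phi> n E" for n E
    using E D_morse maximal_chain_finer[OF m D] unfolding finest_weak_morse_decomposition_def by blast
  show ?thesis
  proof (intro conjI allI impI)
    show "\<exists>n D. finest_weak_morse_decomposition M T \<theta> \<phi> n D" using D_finest by blast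
  next
    fix n D' m E
    assume "finest_weak_morse_decomposition M T \<theta> \<phi> n D' \<and> finest_weak_morse_decomposition M T \<theta> \<phi> m E"
    then show "same_decomposition M n D' m E"
      using same same_decomposition_sym same_decomposition_trans by metis
  next
    fix n D' assume "finest_weak_morse_decomposition M T \<theta> \<phi> n D'"
    then obtain B S where BS: "attractor_chain n B S" "\<forall>i\<in>{1..n}. D' i = B i \<inter> S (i - 1)"
      unfolding finest_weak_morse_decomposition_def weak_morse_decomposition_iff by blast
    show "n \<le> CARD('n)" by (rule attractor_chain_length[OF BS(1)])
    show "AE \<omega> in M. is_direct_sum n (\<lambda>i. proj_vimage (fibre (D' i) \<omega>))"
      by (rule attractor_chain_direct_sum[OF BS])
  qed
qed

end
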